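(* Let $\alpha\in(0,1)$ and $k\ge1$, and suppose that the stiffness matrix $\widetilde{\mathbb{S}}=(a(\phi_i,\phi_j))_{i,j=1}^N$ is an M-matrix (positive diagonal entries and non-positive off-diagonal entries). Let $f$ be continuous with $f\ge0$. Then the lumped mass semi-discrete approximation $u_h=\mathbb{A}^{-\alpha}\mathcal{I}_hf$ and the lumped mass fully discrete approximation $w_h=\lambda_1^{-\alpha}r_{\alpha,k}(\lambda_1\mathbb{A}^{-1})\mathcal{I}_hf$, where $\lambda_1$ is the smallest eigenvalue of $\mathbb{A}$, are both non-negative on $\Omega$.
   Context: $\Omega\subset\mathbb{R}^d$ is a bounded domain, $a$ is a measurable coefficient, bounded above, with $0<a_0\le a(x)$ on $\Omega$, and $a(w,\theta)=\int_\Omega a(x)\nabla w\cdot\nabla\theta\,dx$ on $H^1_0(\Omega)$. $V_h\subset H^1_0(\Omega)$ is the space of continuous piecewise linear functions (vanishing on $\partial\Omega$) over a quasi-uniform partition $\mathcal{T}_h$ of $\Omega$ into $d$-simplices, with nodal basis $\{\phi_j\}_{j=1}^N$ associated with the interior nodes. The lumped mass inner product on $V_h$ is $$(z,v)_h=\frac1{d+1}\sum_{\tau\in\mathcal{T}_h}\sum_{i=1}^{d+1}|\tau|\,z(P_i)v(P_i),$$ with $P_1,\dots,P_{d+1}$ the vertices of $\tau$ and $|\tau|$ its $d$-dimensional measure. The operator $\mathbb{A}:V_h\to V_h$ is defined by $(\mathbb{A}v_h,\theta_h)_h=a(v_h,\theta_h)$ for all $v_h,\theta_h\in V_h$; in the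 nodal basis its matrix is $\widetilde{\mathbb{M}}_h^{-1}\widetilde{\mathbb{S}}$, where $\widetilde{\mathbb{M}}_h=((\phi_i,\phi_j)_h)_{i,j}$ is the (diagonal, positive) lumped mass matrix. $\mathbb{A}$ is symmetric positive definite with respect to $(\cdot,\cdot)_h$, and functions of $\mathbb{A}$ are defined through its eigen-decomposition. $\mathcal{I}_hf\in V_h$ is the element of $V_h$ that agrees with $f$ at all interior nodes. $\mathcal{R}_k$ denotes the set of rational functions $P(t)/Q(t)$ with $P,Q$ real polynomials of degree at most $k$ and $Q(0)=1$; $r_{\alpha,k}\in\mathcal{R}_k$ is the best uniform rational approximation of $t^\alpha$ on $[0,1]$, i.e. the minimizer of $\|s(t)-t^\alpha\|_{L^\infty[0,1]}$ over $s\in\mathcal{R}_k$. It is known (Saff–Stahl) that $r_{\alpha,k}=P/Q$ with $P,Q$ of exact degree $k$ whose roots $\zeta_i$ (of $P$) and $d_i$ (of $Q$) satisfy $0>\zeta_1>d_1>\zeta_2>d_2>\cdots>\zeta_k>d_k$. *)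

theory Defs
  imports "HOL-Analysis.Analysis" "HOL-Computational_Algebra.Polynomial"
begin

section \<open>Domain and mesh\<close>

definition bounded_domain :: "(real^'d) set \<Rightarrow> bool" where
  "bounded_domain \<Omega> \<longleftrightarrow> open \<Omega> \<and> connected \<Omega> \<and> bounded \<Omega> \<and> \<Omega> \<noteq> {}"

text \<open>
  Conforming partition into \<open>d\<close>-simplices: any two simplices of a \<^const>\<open>triangulation\<close>
  meet in a common face. The last conjunct says that the boundary of \<open>\<Omega>\<close> is resolved by the mesh,
  i.e. it is a union of faces (of any dimension) of simplices.
\<close>
definition simplicial_mesh :: "(real^'d) set \<Rightarrow> (real^'d) set set \<Rightarrow> bool" where
  "simplicial_mesh \<Omega> T \<longleftrightarrow>
     triangulation T \<and>
     (\<forall>\<tau>\<in>T. int CARD('d) simplex \<tau>) \<and>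
     \<Union>T = closure \<Omega> \<and>
     frontier \<Omega> = \<Union>{F. F \<subseteq> frontier \<Omega> \<and> (\<exists>\<tau>\<in>T. F face_of \<tau>)}"

text \<open>
  Quasi-uniformity is a property of a family of meshes, indexed by the mesh sizes \<open>h \<in> H\<close>:
  the constant \<open>\<rho>\<close> does not depend on \<open>h\<close>.
\<close>
definition quasi_uniform :: "real set \<Rightarrow> (real \<Rightarrow> (real^'d) set set) \<Rightarrow> bool" where
  "quasi_uniform H \<T> \<longleftrightarrow>
     (\<exists>\<rho>>0. \<forall>h\<in>H. \<forall>\<tau>\<in>\<T> h. diameter \<tau> \<le> h \<and> (\<exists>x. cball x (\<rho> * h) \<subseteq> \<tau>))"

definition vertices :: "(real^'d) set \<Rightarrow> (real^'d) set" where
  "vertices \<tau> = {P. P extreme_point_of \<tau>}"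

definition interior_nodes :: "(real^'d) set \<Rightarrow> (real^'d) set set \<Rightarrow> (real^'d) set" where
  "interior_nodes \<Omega> T = (\<Union>\<tau>\<in>T. vertices \<tau>) \<inter> \<Omega>"


section \<open>Finite element space, nodal basis and interpolation\<close>

text \<open>
  Elements of the finite element space are extended by zero to the whole space, so that equality
  of functions on \<open>\<Omega>\<close> is equality in HOL. As \<open>\<Omega>\<close> is open, this includes the homogeneous
  Dirichlet condition.
\<close>
definition fe_space :: "(real^'d) set \<Rightarrow> (real^'d) set set \<Rightarrow> (real^'d \<Rightarrow> real) set" where
  "fe_space \<Omega> T =
     {v. continuous_on (closure \<Omega>) v \<and>
         (\<forall>\<tau>\<in>T. \<exists>g b. \<forall>x\<in>\<tau>. v x = g \<bullet> x + b) \<and>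
         (\<forall>x. x \<notin> \<Omega> \<longrightarrow> v x = 0)}"

definition nodal_interpolant ::
  "(real^'d) set \<Rightarrow> (real^'d) set set \<Rightarrow> (real^'d \<Rightarrow> real) \<Rightarrow> (real^'d \<Rightarrow> real)" where
  "nodal_interpolant \<Omega> T f =
     (THE v. v \<in> fe_space \<Omega> T \<and> (\<forall>P\<in>interior_nodes \<Omega> T. v P = f P))"

text \<open>The nodal basis is indexed by the interior nodes themselves.\<close>
definition nodal_basis ::
  "(real^'d) set \<Rightarrow> (real^'d) set set \<Rightarrow> real^'d \<Rightarrow> (real^'d \<Rightarrow> real)" where
  "nodal_basis \<Omega> T P =
     (THE v. v \<in> fe_space \<Omega> T \<and>
             (\<forall>Q\<in>interior_nodes \<Omega> T. v Q = (if Q = P then 1 else 0)))"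


section \<open>Bilinear forms and the discrete operator\<close>

definition gradient :: "(real^'d \<Rightarrow> real) \<Rightarrow> real^'d \<Rightarrow> real^'d" where
  "gradient w x = (THE g. GDERIV w x :> g)"

text \<open>
  The form is only used on the finite element space. Its members are Lipschitz and piecewise affine,
  so the weak gradient is the classical one, which exists almost everywhere; the value of
  \<^const>\<open>gradient\<close> on the remaining null set is irrelevant.
\<close>
definition energy_form ::
  "(real^'d) set \<Rightarrow> (real^'d \<Rightarrow> real) \<Rightarrow> (real^'d \<Rightarrow> real) \<Rightarrow> (real^'d \<Rightarrow> real) \<Rightarrow> real" where
  "energy_form \<Omega> a w \<theta> =
     (LINT x|lebesgue_on \<Omega>. a x * (gradient w x \<bullet> gradient \<theta> x))"

definition lumped_inner ::
  "(real^'d) set set \<Rightarrow> (real^'d \<Rightarrow> real) \<Rightarrow> (real^'d \<Rightarrow> real) \<Rightarrow> real" where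
  "lumped_inner T z v =
     1 / (real CARD('d) + 1) *
     (\<Sum>\<tau>\<in>T. \<Sum>P\<in>vertices \<tau>. measure lebesgue \<tau> * z P * v P)"

definition stiffness_matrix ::
  "(real^'d) set \<Rightarrow> (real^'d) set set \<Rightarrow> (real^'d \<Rightarrow> real) \<Rightarrow> real^'d \<Rightarrow> real^'d \<Rightarrow> real" where
  "stiffness_matrix \<Omega> T a P Q =
     energy_form \<Omega> a (nodal_basis \<Omega> T P) (nodal_basis \<Omega> T Q)"

text \<open>
  M-matrix in the sense of sign conditions only. For the stiffness matrix, which is symmetric
  positive definite, this agrees with the usual notion.
\<close>
definition M_matrix :: "'i set \<Rightarrow> ('i \<Rightarrow> 'i \<Rightarrow> real) \<Rightarrow> bool" where
  "M_matrix I S \<longleftrightarrow>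
     (\<forall>i\<in>I. S i i > 0) \<and> (\<forall>i\<in>I. \<forall>j\<in>I. i \<noteq> j \<longrightarrow> S i j \<le> 0)"

definition lumped_operator ::
  "(real^'d) set \<Rightarrow> (real^'d) set set \<Rightarrow> (real^'d \<Rightarrow> real) \<Rightarrow>
   (real^'d \<Rightarrow> real) \<Rightarrow> (real^'d \<Rightarrow> real)" where
  "lumped_operator \<Omega> T a v =
     (THE w. w \<in> fe_space \<Omega> T \<and>
             (\<forall>\<theta>\<in>fe_space \<Omega> T. lumped_inner T w \<theta> = energy_form \<Omega> a v \<theta>))"


section \<open>Functions of a symmetric operator via its eigen-decomposition\<close>

text \<open>
  Here \<open>V\<close> is a finite-dimensional space of real functions, \<open>B\<close> an inner product on \<open>V\<close> and
  \<open>A\<close> an operator on \<open>V\<close> that is symmetric with respect to \<open>B\<close>. Orthogonal projections onto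
  the eigenspaces are used instead of a choice of eigenbasis.
\<close>
definition eigenspace ::
  "('x \<Rightarrow> real) set \<Rightarrow> (('x \<Rightarrow> real) \<Rightarrow> ('x \<Rightarrow> real)) \<Rightarrow> real \<Rightarrow> ('x \<Rightarrow> real) set" where
  "eigenspace V A l = {v \<in> V. A v = (\<lambda>x. l * v x)}"

definition eigenvalues ::
  "('x \<Rightarrow> real) set \<Rightarrow> (('x \<Rightarrow> real) \<Rightarrow> ('x \<Rightarrow> real)) \<Rightarrow> real set" where
  "eigenvalues V A = {l. \<exists>v\<in>eigenspace V A l. v \<noteq> (\<lambda>x. 0)}"

definition eigenprojection ::
  "('x \<Rightarrow> real) set \<Rightarrow> (('x \<Rightarrow> real) \<Rightarrow> ('x \<Rightarrow> real) \<Rightarrow> real) \<Rightarrow>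
   (('x \<Rightarrow> real) \<Rightarrow> ('x \<Rightarrow> real)) \<Rightarrow> real \<Rightarrow> ('x \<Rightarrow> real) \<Rightarrow> ('x \<Rightarrow> real)" where
  "eigenprojection V B A l v =
     (THE w. w \<in> eigenspace V A l \<and>
             (\<forall>z\<in>eigenspace V A l. B (\<lambda>x. v x - w x) z = 0))"

definition operator_function ::
  "('x \<Rightarrow> real) set \<Rightarrow> (('x \<Rightarrow> real) \<Rightarrow> ('x \<Rightarrow> real) \<Rightarrow> real) \<Rightarrow>
   (('x \<Rightarrow> real) \<Rightarrow> ('x \<Rightarrow> real)) \<Rightarrow> (real \<Rightarrow> real) \<Rightarrow> ('x \<Rightarrow> real) \<Rightarrow> ('x \<Rightarrow> real)" where
  "operator_function V B A g v =
     (\<lambda>x. \<Sum>l\<in>eigenvalues V A. g l * eigenprojection V B A l v x)"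


section \<open>Best uniform rational approximation\<close>

definition rational_functions :: "nat \<Rightarrow> (real \<Rightarrow> real) set" where
  "rational_functions k =
     {\<lambda>t. poly P t / poly Q t | P Q. degree P \<le> k \<and> degree Q \<le> k \<and> poly Q 0 = 1}"

text \<open>
  The error is extended real, so that it is infinite if there is a pole in the unit interval (the
  value \<open>0\<close> assigned at the pole itself does not affect this). At a common zero of \<open>P\<close> and \<open>Q\<close>
  the quotient is \<open>0\<close> as well; this does not affect the infimum, since cancelling the common factor
  again gives an element of the set.
\<close>
definition uniform_error :: "real \<Rightarrow> (real \<Rightarrow> real) \<Rightarrow> ereal" where
  "uniform_error \<alpha> s = (SUP t\<in>{0..1}. ereal \<bar>s t - t powr \<alpha>\<bar>)"

definition best_rational_approx :: "real \<Rightarrow> nat \<Rightarrow> (real \<Rightarrow> real) \<Rightarrow> bool" where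
  "best_rational_approx \<alpha> k r \<longleftrightarrow>
     is_arg_min (uniform_error \<alpha>) (\<lambda>s. s \<in> rational_functions k) r"


section \<open>Lumped mass approximations\<close>

definition smallest_eigenvalue ::
  "(real^'d) set \<Rightarrow> (real^'d) set set \<Rightarrow> (real^'d \<Rightarrow> real) \<Rightarrow> real" where
  "smallest_eigenvalue \<Omega> T a = Min (eigenvalues (fe_space \<Omega> T) (lumped_operator \<Omega> T a))"

definition semidiscrete_approx ::
  "(real^'d) set \<Rightarrow> (real^'d) set set \<Rightarrow> (real^'d \<Rightarrow> real) \<Rightarrow> real \<Rightarrow>
   (real^'d \<Rightarrow> real) \<Rightarrow> (real^'d \<Rightarrow> real)" where
  "semidiscrete_approx \<Omega> T a \<alpha> f =
     operator_function (fe_space \<Omega> T) (lumped_inner T) (lumped_operator \<Omega> T a)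
       (\<lambda>l. l powr (- \<alpha>)) (nodal_interpolant \<Omega> T f)"

definition fully_discrete_approx ::
  "(real^'d) set \<Rightarrow> (real^'d) set set \<Rightarrow> (real^'d \<Rightarrow> real) \<Rightarrow> real \<Rightarrow> (real \<Rightarrow> real) \<Rightarrow>
   (real^'d \<Rightarrow> real) \<Rightarrow> (real^'d \<Rightarrow> real)" where
  "fully_discrete_approx \<Omega> T a \<alpha> r f =
     (let l1 = smallest_eigenvalue \<Omega> T a in
      (\<lambda>x. l1 powr (- \<alpha>) *
         operator_function (fe_space \<Omega> T) (lumped_inner T) (lumped_operator \<Omega> T a)
           (\<lambda>l. r (l1 * inverse l)) (nodal_interpolant \<Omega> T f) x))"

end

theory Submission
  imports Defs
    "HOL-Computational_Algebra.Fundamental_Theorem_Algebra"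
    "HOL-Computational_Algebra.Field_as_Ring"
    "HOL-Computational_Algebra.Polynomial_Factorial"
begin

text \<open>
  Both approximations have the form \<open>g(A) v\<close>, where \<open>v\<close> is the nodal interpolant of \<open>f\<close>, which is
  non-negative at the nodes, and \<open>g(l)\<close> is \<open>l powr (-\<alpha>)\<close> in the first case and
  \<open>r(l\<^sub>1 / l)\<close> in the second. In both cases \<open>g\<close> is a superposition, with non-negative weights, of
  constants and of the functions \<open>1 / (l + s)\<close> with \<open>s > 0\<close>. So everything follows from the
  positivity of the resolvents \<open>(A + s)\<^sup>-\<^sup>1\<close> (lemma \<open>resolvent_nonneg\<close>). That is a discrete minimum
  principle: testing \<open>(A + s) w \<ge> 0\<close> with the nodal negative part of \<open>w\<close>, the stiffness matrix
  couples positive and negative parts with a favourable sign, because its off-diagonal entries are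
  non-positive, and the lumped mass matrix does not couple them at all, because it is diagonal.
  A finite element function that is non-negative at the nodes is non-negative everywhere, being a
  convex combination of nodal values on each simplex.

  For \<open>l powr (-\<alpha>)\<close> the superposition is the Stieltjes integral (lemma \<open>stieltjes_integral\<close>). For the
  best approximation \<open>r = P/Q\<close> it is the partial fraction decomposition
  \<open>r t = c + (\<Sum>z. \<beta> z * t / (t - z))\<close> with poles \<open>z < 0\<close> and \<open>c, \<beta> z \<ge> 0\<close>
  (lemma \<open>best_rational_approx_partial_fractions\<close>), which encodes the interlacing of zeros and poles.
  It is obtained as follows.
  If the error \<open>r t - t powr \<alpha>\<close> had too few zeros in the open unit interval, a polynomial with the sign of
  the error would be a tangent direction along which the error decreases; hence \<open>r\<close> interpolates
  \<open>t powr \<alpha>\<close> at \<open>k + n + 1\<close> points, where \<open>n \<le> k\<close> is the larger degree of \<open>P\<close> and \<open>Q\<close> in lowest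
  terms. Now \<open>t powr (\<alpha> - 1)\<close> is a positive superposition of the kernels \<open>1 / (t + s)\<close>, and the divided
  difference of \<open>h(t) / (t + s)\<close> over the interpolation points is an explicit multiple of \<open>h(-s)\<close>.
  Therefore the divided difference of \<open>h(t) * t powr (\<alpha> - 1)\<close> has a definite sign whenever \<open>h\<close> does
  not change sign on the negative half-line (lemma \<open>divided_difference_powr_pos\<close>).
  Different choices of \<open>h\<close> give \<open>n = k\<close>, the location of the
  poles, the sign of the residues and the sign of \<open>r 0\<close>.
\<close>

section \<open>Polynomials matching the sign of a function\<close>

text \<open>
  Walking through \<open>Z\<close> from left to right, a linear factor is added exactly at those points where \<open>e\<close>
  changes sign. The hypothesis only says that every sign change happens across a point of \<open>Z\<close>, so that
  the lemma applies to continuous functions on any interval and the largest point of \<open>Z\<close> can be split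
  off by restricting \<open>J\<close>.
\<close>
lemma sign_matching_product:
  fixes e :: "real \<Rightarrow> real"
  assumes "finite Z"
    and "\<And>s t. s \<in> J \<Longrightarrow> t \<in> J \<Longrightarrow> s < t \<Longrightarrow> e s * e t < 0 \<Longrightarrow> \<exists>z\<in>Z. s < z \<and> z < t"
    and "\<And>z. z \<in> Z \<Longrightarrow> e z = 0"
  shows "\<exists>S c. S \<subseteq> Z \<and> \<bar>c\<bar> = 1 \<and> (\<forall>t\<in>J. e t \<noteq> 0 \<longrightarrow> c * (\<Prod>z\<in>S. t - z) * e t > 0)"
  using assms
proof (induction Z arbitrary: J rule: finite_linorder_max_induct)
  case empty
  show ?case
  proof (cases "\<exists>t\<in>J. e t < 0")
    case True
    then obtain t0 where t0: "t0 \<in> J" "e t0 < 0" by blast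
    have "e t < 0" if "t \<in> J" "e t \<noteq> 0" for t
      using empty.prems(1)[of t t0] empty.prems(1)[of t0 t] that t0
      by (metis empty_iff linorder_less_linear mult_neg_pos mult_pos_neg)
    then show ?thesis by (intro exI[of _ "{}"] exI[of _ "-1"]) auto
  next
    case False
    then show ?thesis by (intro exI[of _ "{}"] exI[of _ "1"]) force
  qed
next
  case (insert b Z)
  let ?L = "J \<inter> {..<b}" and ?R = "J \<inter> {b<..}"
  have "\<exists>z\<in>Z. s < z \<and> z < t" if "s \<in> ?L" "t \<in> ?L" "s < t" "e s * e t < 0" for s t
    using insert.prems(1)[of s t] that by auto
  then have "\<exists>S c. S \<subseteq> Z \<and> \<bar>c\<bar> = 1 \<and> (\<forall>t\<in>?L. e t \<noteq> 0 \<longrightarrow> c * (\<Prod>z\<in>S. t - z) * e t > 0)"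
    using insert.prems(2) by (intro insert.IH) auto
  then obtain S c where S: "S \<subseteq> Z" and c1: "\<bar>c\<bar> = 1"
    and L: "\<And>t. t \<in> ?L \<Longrightarrow> e t \<noteq> 0 \<Longrightarrow> c * (\<Prod>z\<in>S. t - z) * e t > 0"
    by blast
  have c: "c = 1 \<or> c = -1" using c1 by (auto simp: abs_if split: if_splits)
  have fS: "finite S" using S insert.hyps finite_subset by auto
  have bS: "b \<notin> S" using S insert.hyps by blast
  have pR: "(\<Prod>z\<in>S. t - z) > 0" if "t > b" for t
    using that S insert.hyps by (intro prod_pos) force
  have eb: "e b = 0" using insert.prems(2) by blast
  have same: "e s * e t \<ge> 0" if "s \<in> ?R" "t \<in> ?R" for s t
  proof (rule ccontr)
    assume "\<not> ?thesis"
    then have neg: "e s * e t < 0" by simp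
    have "\<exists>z\<in>insert b Z. z > b"
    proof (cases s t rule: linorder_cases)
      case less
      with insert.prems(1)[of s t] that neg
      obtain z where "z \<in> insert b Z" "s < z" by auto
      moreover have "b < s" using that by simp
      ultimately show ?thesis by (meson less_trans)
    next
      case equal
      then show ?thesis using neg by (simp add: not_less zero_le_square)
    next
      case greater
      with insert.prems(1)[of t s] that neg
      obtain z where "z \<in> insert b Z" "t < z" by (auto simp: mult.commute)
      moreover have "b < t" using that by simp
      ultimately show ?thesis by (meson less_trans)
    qed
    then show False using insert.hyps by force
  qed
  have R: "t \<in> ?L \<or> t \<in> ?R" if "t \<in> J" "e t \<noteq> 0" for t
    using that eb by (cases t b rule: linorder_cases) auto
  show ?case
  proof (cases "\<exists>t\<in>?R. c * e t < 0")
    case True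
    then obtain t0 where t0: "t0 \<in> ?R" "c * e t0 < 0" by blast
    have neg: "c * e t < 0" if "t \<in> ?R" "e t \<noteq> 0" for t
      using same[OF that(1) t0(1)] c t0(2) that(2) by (auto simp: zero_le_mult_iff)
    show ?thesis
    proof (intro exI[of _ "insert b S"] exI[of _ "-c"] conjI ballI impI)
      fix t assume t: "t \<in> J" "e t \<noteq> 0"
      have *: "- c * (\<Prod>z\<in>insert b S. t - z) * e t = (b - t) * (c * (\<Prod>z\<in>S. t - z) * e t)"
        using fS bS by (simp add: algebra_simps)
      have **: "- c * (\<Prod>z\<in>insert b S. t - z) * e t = ((t - b) * (\<Prod>z\<in>S. t - z)) * (- (c * e t))"
        using fS bS by (simp add: algebra_simps)
      show "- c * (\<Prod>z\<in>insert b S. t - z) * e t > 0"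
        using R[OF t]
      proof
        assume tL: "t \<in> ?L" 
        have "0 < (b - t) * (c * (\<Prod>z\<in>S. t - z) * e t)"
          using tL by (intro mult_pos_pos L t) auto
        then show ?thesis unfolding * .
      next
        assume "t \<in> ?R" then show ?thesis unfolding ** using neg[of t] pR[of t] t
          by (intro mult_pos_pos) auto
      qed
    qed (use S c in auto)
  next
    case False
    then have pos: "c * e t > 0" if "t \<in> ?R" "e t \<noteq> 0" for t
      using that c by (metis linorder_neqE_linordered_idom mult_eq_0_iff one_neq_zero neg_equal_0_iff_equal)
    show ?thesis
    proof (intro exI[of _ S] exI[of _ c] conjI ballI impI)
      fix t assume t: "t \<in> J" "e t \<noteq> 0"
      have **: "c * (\<Prod>z\<in>S. t - z) * e t = (\<Prod>z\<in>S. t - z) * (c * e t)" by simp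
      show "c * (\<Prod>z\<in>S. t - z) * e t > 0"
        using R[OF t]
      proof
        assume tR: "t \<in> ?R"
        then have "(\<Prod>z\<in>S. t - z) * (c * e t) > 0"
          by (intro mult_pos_pos pos pR t) auto
        then show ?thesis unfolding ** .
      qed (use L t in auto)
    qed (use S c in auto)
  qed
qed

section \<open>Divided differences and the Stieltjes representation of powers\<close>

definition divided_difference :: "real set \<Rightarrow> (real \<Rightarrow> real) \<Rightarrow> real" where
  "divided_difference X f = (\<Sum>x\<in>X. f x / (\<Prod>y\<in>X - {x}. x - y))"

lemma lagrange_interpolation:
  fixes h :: "real poly"
  assumes "finite X" "degree h < card X"
  shows "poly h z = (\<Sum>x\<in>X. poly h x * (\<Prod>y\<in>X - {x}. (z - y) / (x - y)))"
proof -
  define L where "L = (\<Sum>x\<in>X. smult (poly h x * (\<Prod>y\<in>X - {x}. 1 / (x - y))) (\<Prod>y\<in>X - {x}. [:-y, 1:]))"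
  have Lz: "poly L z = (\<Sum>x\<in>X. poly h x * (\<Prod>y\<in>X - {x}. (z - y) / (x - y)))" for z
    by (simp add: L_def poly_sum poly_prod prod_dividef mult.assoc)
  have dL: "degree L < card X"
  proof -
    have *: "degree (smult (poly h x * (\<Prod>y\<in>X - {x}. 1 / (x - y))) (\<Prod>y\<in>X - {x}. [:-y, 1:])) \<le> card X - 1"
      if "x \<in> X" for x
    proof -
      have "degree (\<Prod>y\<in>X - {x}. [:-y, 1:]) \<le> (\<Sum>y\<in>X - {x}. degree [:-y, 1::real:])"
        using degree_prod_sum_le[of "X - {x}" "\<lambda>y. [:-y, 1:]"] assms by (simp add: o_def)
      also have "\<dots> = card X - 1" using that assms by (simp add: card_Diff_singleton)
      finally show ?thesis using degree_smult_le order_trans by blast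
    qed
    have "degree L \<le> card X - 1" unfolding L_def using * assms by (intro degree_sum_le) auto
    then show ?thesis using assms(2) by linarith
  qed
  have "poly h x = poly L x" if "x \<in> X" for x
  proof -
    have "poly L x = (\<Sum>x'\<in>X. if x' = x then poly h x else 0)"
      unfolding Lz
    proof (intro sum.cong refl)
      fix x' assume x': "x' \<in> X"
      show "poly h x' * (\<Prod>y\<in>X - {x'}. (x - y) / (x' - y)) = (if x' = x then poly h x else 0)"
      proof (cases "x' = x")
        case True
        have "(\<Prod>y\<in>X - {x}. (x - y) / (x - y)) = 1" by (intro prod.neutral) auto
        then show ?thesis using True by simp
      next
        case False
        have "(\<Prod>y\<in>X - {x'}. (x - y) / (x' - y)) = 0"
          using False that assms by (intro prod_zero) auto
        then show ?thesis using False by simp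
      qed
    qed
    then show ?thesis using that assms by simp
  qed
  then have "h = L" by (intro poly_eqI_degree[of X]) (use assms dL in auto)
  then show ?thesis using Lz by metis
qed

text \<open>
  This is Lagrange interpolation of \<open>h\<close>, evaluated at \<open>-s\<close> and divided by the node polynomial. The
  sign of the divided difference is thus the sign of \<open>h(-s)\<close>, whatever the points of \<open>X\<close> are.
\<close>
lemma divided_difference_kernel:
  fixes h :: "real poly"
  assumes X: "finite X" "\<And>x. x \<in> X \<Longrightarrow> x > 0" and "degree h < card X" and "s \<ge> 0"
  shows "divided_difference X (\<lambda>x. poly h x / (x + s)) =
           (-1) ^ (card X - 1) * poly h (-s) / (\<Prod>x\<in>X. x + s)"
proof -
  have ne: "x + s \<noteq> 0" if "x \<in> X" for x using X(2)[OF that] assms(4) by linarith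
  have pne: "(\<Prod>x\<in>X. x + s) \<noteq> 0" using ne X by simp
  have "poly h (-s) = (\<Sum>x\<in>X. poly h x * (\<Prod>y\<in>X - {x}. (-s - y) / (x - y)))"
    by (rule lagrange_interpolation) (use assms in auto)
  also have "\<dots> = (\<Sum>x\<in>X. (-1) ^ (card X - 1) * (\<Prod>x\<in>X. x + s) * (poly h x / (x + s) / (\<Prod>y\<in>X - {x}. x - y)))"
  proof (intro sum.cong refl)
    fix x assume x: "x \<in> X"
    have "(\<Prod>y\<in>X - {x}. (-s - y) / (x - y)) = (\<Prod>y\<in>X - {x}. (-1) * (y + s)) / (\<Prod>y\<in>X - {x}. x - y)"
      unfolding prod_dividef by (intro arg_cong2[of _ _ _ _ "(/)"] prod.cong) auto
    also have "(\<Prod>y\<in>X - {x}. (-1) * (y + s)) = (-1) ^ (card X - 1) * (\<Prod>y\<in>X - {x}. y + s)"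
      unfolding prod.distrib using x X by (simp add: card_Diff_singleton)
    also have "(\<Prod>y\<in>X - {x}. y + s) = (\<Prod>y\<in>X. y + s) / (x + s)"
      using prod.remove[OF X(1) x, of "\<lambda>y. y + s"] ne[OF x] by (simp add: field_simps)
    finally show "poly h x * (\<Prod>y\<in>X - {x}. (-s - y) / (x - y)) = 
      (-1) ^ (card X - 1) * (\<Prod>x\<in>X. x + s) * (poly h x / (x + s) / (\<Prod>y\<in>X - {x}. x - y))" by simp
  qed
  also have "\<dots> = (-1) ^ (card X - 1) * (\<Prod>x\<in>X. x + s) * divided_difference X (\<lambda>x. poly h x / (x + s))"
    by (simp add: divided_difference_def sum_distrib_left)
  finally show ?thesis using pne by (simp add: field_simps flip: power_add mult_2)
qed

text \<open>
  The case \<open>s = 0\<close> of the previous lemma for the polynomial \<open>t * p(t)\<close>, which vanishes at \<open>0\<close>.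
\<close>
lemma divided_difference_poly_eq_0:
  fixes p :: "real poly"
  assumes X: "finite X" "\<And>x. x \<in> X \<Longrightarrow> x > 0" and "degree p + 1 < card X"
  shows "divided_difference X (poly p) = 0"
proof -
  have "degree ([:0, 1:] * p) < card X"
    using degree_mult_le[of "[:0, 1:]" p] assms(3) by simp
  from divided_difference_kernel[OF X this, of 0]
  have "divided_difference X (\<lambda>x. poly ([:0, 1:] * p) x / (x + 0)) = 0" by simp
  moreover have "divided_difference X (\<lambda>x. poly ([:0, 1:] * p) x / (x + 0)) = divided_difference X (poly p)"
    unfolding divided_difference_def using X(2) by (intro sum.cong refl) force
  ultimately show ?thesis by simp
qed

text \<open>
  The indicator function makes this a function on the whole line, so that Lebesgue measure and its
  scaling rule can be used directly.
\<close>
definition stieltjes_kernel :: "real \<Rightarrow> real \<Rightarrow> real \<Rightarrow> real" where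
  "stieltjes_kernel \<alpha> t s = indicator {0<..} s * (s powr (\<alpha> - 1) / (t + s))"

text \<open>
  The kernel is dominated by \<open>s powr (\<alpha> - 1)\<close> near zero and by \<open>s powr (\<alpha> - 2)\<close> near infinity.
\<close>
lemma integrable_stieltjes_kernel_1:
  assumes "0 < \<alpha>" "\<alpha> < 1"
  shows "integrable lborel (stieltjes_kernel \<alpha> 1)"
proof -
  have 1: "integrable lborel (\<lambda>s. indicator {0<..1} s *\<^sub>R (s powr (\<alpha> - 1)))"
  proof -
    have "(\<lambda>s. s powr (\<alpha> - 1)) absolutely_integrable_on {0<..1}"
      using integrable_on_powr_from_0'[of "\<alpha> - 1" 1] assms
      by (subst absolutely_integrable_on_iff_nonneg) auto
    then show ?thesis unfolding set_integrable_def
      by (subst (asm) integrable_completion) auto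
  qed
  have 2: "integrable lborel (\<lambda>s. indicator {1..} s *\<^sub>R (s powr (\<alpha> - 2)))"
  proof -
    have "(\<lambda>s. s powr (\<alpha> - 2)) absolutely_integrable_on {1..}"
      using has_integral_powr_to_inf[of "\<alpha> - 2" 1] assms
      by (subst absolutely_integrable_on_iff_nonneg) (auto simp: integrable_on_def)
    then show ?thesis unfolding set_integrable_def
      by (subst (asm) integrable_completion) auto
  qed
  show ?thesis
  proof (rule Bochner_Integration.integrable_bound[OF Bochner_Integration.integrable_add[OF 1 2]])
    show "stieltjes_kernel \<alpha> 1 \<in> borel_measurable lborel"
      unfolding stieltjes_kernel_def by simp
    show "AE s in lborel. norm (stieltjes_kernel \<alpha> 1 s) \<le>
       norm (indicat_real {0<..1} s *\<^sub>R s powr (\<alpha> - 1) + indicat_real {1..} s *\<^sub>R s powr (\<alpha> - 2))"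
    proof (rule AE_I2)
      fix s :: real
      consider "s \<le> 0" | "0 < s" "s \<le> 1" | "s > 1" by linarith
      then show "norm (stieltjes_kernel \<alpha> 1 s) \<le>
         norm (indicat_real {0<..1} s *\<^sub>R s powr (\<alpha> - 1) + indicat_real {1..} s *\<^sub>R s powr (\<alpha> - 2))"
      proof cases
        case 2
        have "s powr (\<alpha> - 1) / (1 + s) \<le> s powr (\<alpha> - 1) / 1"
          using 2 by (intro divide_left_mono) auto
        also have "\<dots> \<le> s powr (\<alpha> - 1) + indicat_real {1..} s * s powr (\<alpha> - 2)" by simp
        finally show ?thesis using 2 by (simp add: stieltjes_kernel_def)
      next
        case 3
        have "s powr (\<alpha> - 1) / (1 + s) \<le> s powr (\<alpha> - 1) / s"
          using 3 by (intro divide_left_mono) auto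
        also have "\<dots> = s powr (\<alpha> - 2)"
          using 3 powr_add[of s "\<alpha> - 2" 1] by (simp add: field_simps)
        finally show ?thesis using 3 by (simp add: stieltjes_kernel_def)
      qed (auto simp: stieltjes_kernel_def)
    qed
  qed
qed

lemma AE_zero_on_halfline_False:
  fixes N :: "real set"
  assumes "AE s in lborel. s > 0 \<longrightarrow> s \<in> N" and N: "finite N"
  shows False
proof -
  have "AE s in lborel. s \<notin> N" using N
    by (intro AE_not_in finite_imp_null_set_lborel)
  with assms(1) have "AE s in lborel. \<not> (s \<in> {0<..<1::real})" by eventually_elim auto
  then have "emeasure lborel {0<..<1::real} = 0"
    by (subst (asm) AE_iff_measurable[of "{0<..<1}"]) auto
  then show False by simp
qed

text \<open>
  The substitution \<open>s = t * u\<close> reduces the integral to the case \<open>t = 1\<close>.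
\<close>
lemma stieltjes_integral:
  assumes "0 < \<alpha>" "\<alpha> < 1"
  obtains C where "C > 0"
    and "\<And>t. t > 0 \<Longrightarrow> has_bochner_integral lborel (stieltjes_kernel \<alpha> t) (C * t powr (\<alpha> - 1))"
proof
  define C where "C = integral\<^sup>L lborel (stieltjes_kernel \<alpha> 1)"
  note int = integrable_stieltjes_kernel_1[OF assms]
  have nn: "stieltjes_kernel \<alpha> 1 s \<ge> 0" for s by (simp add: stieltjes_kernel_def indicator_def)
  have "C \<noteq> 0"
  proof
    assume "C = 0"
    then have "AE s in lborel. stieltjes_kernel \<alpha> 1 s = 0"
      unfolding C_def using integral_nonneg_eq_0_iff_AE[OF int] nn by auto
    then have "AE s in lborel. s > 0 \<longrightarrow> s \<in> ({} :: real set)"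
      by eventually_elim (auto simp: stieltjes_kernel_def)
    from AE_zero_on_halfline_False[OF this] show False by simp
  qed
  moreover have "C \<ge> 0" unfolding C_def using nn by (intro integral_nonneg_AE) auto
  ultimately show "C > 0" by simp
  fix t :: real assume t: "t > 0"
  have "has_bochner_integral lborel (stieltjes_kernel \<alpha> 1) C"
    unfolding C_def using int by (rule has_bochner_integral_integrable)
  then have "has_bochner_integral lborel (\<lambda>s. stieltjes_kernel \<alpha> 1 (0 + (1 / t) * s)) (C /\<^sub>R \<bar>1 / t\<bar>)"
    using t by (subst (asm) lborel_has_bochner_integral_real_affine_iff[of "1 / t" _ _ 0]) auto
  then have "has_bochner_integral lborel (\<lambda>s. t powr (\<alpha> - 2) * stieltjes_kernel \<alpha> 1 (0 + (1 / t) * s))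
     (t powr (\<alpha> - 2) * (C /\<^sub>R \<bar>1 / t\<bar>))" by (intro has_bochner_integral_mult_right) auto
  moreover have "t powr (\<alpha> - 2) * stieltjes_kernel \<alpha> 1 (0 + (1 / t) * s) = stieltjes_kernel \<alpha> t s" for s
  proof (cases "s > 0")
    case True
    have a: "t powr (\<alpha> - 1) = t powr (\<alpha> - 2) * t"
      using t powr_add[of t "\<alpha> - 2" 1] by simp
    have "(s / t) powr (\<alpha> - 1) = s powr (\<alpha> - 1) / (t powr (\<alpha> - 2) * t)"
      using True t by (simp add: powr_divide a)
    then show ?thesis using True t by (simp add: stieltjes_kernel_def field_simps)
  next
    case False
    then show ?thesis using t by (simp add: stieltjes_kernel_def indicator_def zero_less_divide_iff)
  qed
  moreover have "t powr (\<alpha> - 2) * (C /\<^sub>R \<bar>1 / t\<bar>) = C * t powr (\<alpha> - 1)"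
    using t powr_add[of t "\<alpha> - 2" 1] by (simp add: mult_ac)
  ultimately show "has_bochner_integral lborel (stieltjes_kernel \<alpha> t) (C * t powr (\<alpha> - 1))"
    by (simp only: ext)
qed

text \<open>
  The source of all sign information about rational interpolants: inserting the Stieltjes integral for
  \<open>t powr (\<alpha> - 1)\<close> turns the divided difference into the integral of \<open>h(-s)\<close> against a positive weight.
\<close>
lemma divided_difference_powr_pos:
  fixes h :: "real poly"
  assumes \<alpha>: "0 < \<alpha>" "\<alpha> < 1"
    and X: "finite X" "\<And>x. x \<in> X \<Longrightarrow> x > 0" and deg: "degree h < card X"
    and "h \<noteq> 0" and nonneg: "\<And>s. s > 0 \<Longrightarrow> poly h (-s) \<ge> 0"
  shows "(-1) ^ (card X - 1) * divided_difference X (\<lambda>x. poly h x * x powr (\<alpha> - 1)) > 0"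
proof -
  obtain C where C: "C > 0"
    and int: "\<And>t. t > 0 \<Longrightarrow> has_bochner_integral lborel (stieltjes_kernel \<alpha> t) (C * t powr (\<alpha> - 1))"
    using stieltjes_integral[OF \<alpha>] by blast
  define D where "D = (-1) ^ (card X - 1) * divided_difference X (\<lambda>x. poly h x * x powr (\<alpha> - 1))"
  define w where "w s = indicator {0<..} s * (s powr (\<alpha> - 1) * poly h (-s) / (\<Prod>x\<in>X. x + s))" for s
  have "has_bochner_integral lborel (\<lambda>s. \<Sum>x\<in>X. (-1) ^ (card X - 1) * poly h x / (\<Prod>y\<in>X - {x}. x - y) * stieltjes_kernel \<alpha> x s)
     (\<Sum>x\<in>X. (-1) ^ (card X - 1) * poly h x / (\<Prod>y\<in>X - {x}. x - y) * (C * x powr (\<alpha> - 1)))"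
    using int X by (intro has_bochner_integral_sum has_bochner_integral_mult_right) auto
  moreover have "(\<Sum>x\<in>X. (-1) ^ (card X - 1) * poly h x / (\<Prod>y\<in>X - {x}. x - y) * (C * x powr (\<alpha> - 1))) = C * D"
    by (simp add: D_def divided_difference_def sum_distrib_left mult_ac)
  moreover have "(\<Sum>x\<in>X. (-1) ^ (card X - 1) * poly h x / (\<Prod>y\<in>X - {x}. x - y) * stieltjes_kernel \<alpha> x s) = w s" for s
  proof (cases "s > 0")
    case True
    have "(\<Sum>x\<in>X. (-1) ^ (card X - 1) * poly h x / (\<Prod>y\<in>X - {x}. x - y) * stieltjes_kernel \<alpha> x s)
      = (-1) ^ (card X - 1) * s powr (\<alpha> - 1) * divided_difference X (\<lambda>x. poly h x / (x + s))"
      using True by (simp add: stieltjes_kernel_def divided_difference_def sum_distrib_left mult_ac)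
    also have "\<dots> = w s" using True divided_difference_kernel[OF X deg, of s]
      by (simp add: w_def flip: power_add mult_2)
    finally show ?thesis .
  qed (simp add: stieltjes_kernel_def w_def)
  ultimately have wint: "has_bochner_integral lborel w (C * D)" by simp
  have pp: "(\<Prod>x\<in>X. x + s) > 0" if "s > 0" for s using X(2) that by (intro prod_pos) force
  have wnn: "w s \<ge> 0" for s
  proof (cases "s > 0")
    case True
    then show ?thesis using nonneg[OF True] pp[OF True] by (simp add: w_def)
  qed (simp add: w_def)
  have "C * D = integral\<^sup>L lborel w" using wint by (simp add: has_bochner_integral_iff)
  moreover have "\<dots> \<ge> 0" using wnn by (intro integral_nonneg_AE) auto
  moreover have "integral\<^sup>L lborel w \<noteq> 0"
  proof
    assume "integral\<^sup>L lborel w = 0"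
    moreover have "integrable lborel w" using wint by (simp add: has_bochner_integral_iff)
    ultimately have "AE s in lborel. w s = 0"
      using integral_nonneg_eq_0_iff_AE[of lborel w] wnn by auto
    then have "AE s in lborel. s > 0 \<longrightarrow> s \<in> uminus ` {t. poly h t = 0}"
    proof eventually_elim
      case (elim s)
      show ?case
      proof
        assume "s > 0"
        with elim pp[of s] have "poly h (-s) = 0" by (auto simp: w_def)
        then show "s \<in> uminus ` {t. poly h t = 0}" by (intro image_eqI[of _ _ "-s"]) auto
      qed
    qed
    then show False using AE_zero_on_halfline_False poly_roots_finite[OF \<open>h \<noteq> 0\<close>] by blast
  qed
  ultimately have "C * D > 0" by linarith
  then show ?thesis using C by (simp add: D_def zero_less_mult_iff)
qed

section \<open>Rational interpolants of a power\<close>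

text \<open>
  With one interpolation point more than there are degrees of freedom, \<open>Q(-s)\<close> would be orthogonal to
  itself with respect to the positive weight \<open>s powr \<alpha> / (\<Prod>x\<in>X. x + s)\<close> on the half-line.
\<close>
lemma interpolant_nondegenerate:
  fixes P Q :: "real poly"
  assumes \<alpha>: "0 < \<alpha>" "\<alpha> < 1"
    and X: "finite X" "\<And>x. x \<in> X \<Longrightarrow> x > 0"
    and interp: "\<And>x. x \<in> X \<Longrightarrow> poly P x = x powr \<alpha> * poly Q x"
    and deg: "degree P \<le> n" "degree Q \<le> n" and "Q \<noteq> 0"
  shows "card X < 2 * n + 2"
proof (rule ccontr)
  assume "\<not> ?thesis"
  then have card: "2 * n + 2 \<le> card X" by simp
  let ?h = "[:0, -1:] * (Q * Q)"
  have "degree (Q * Q) \<le> 2 * n" using degree_mult_le[of Q Q] deg by linarith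
  then have "degree ?h < card X"
    using degree_mult_le[of "[:0, -1:]" "Q * Q"] card by simp
  then have "(-1) ^ (card X - 1) * divided_difference X (\<lambda>x. poly ?h x * x powr (\<alpha> - 1)) > 0"
    using \<open>Q \<noteq> 0\<close> by (intro divided_difference_powr_pos \<alpha> X) auto
  moreover have "divided_difference X (\<lambda>x. poly ?h x * x powr (\<alpha> - 1)) = divided_difference X (poly (- (P * Q)))"
    unfolding divided_difference_def
  proof (intro sum.cong refl)
    fix x assume x: "x \<in> X"
    show "poly ?h x * x powr (\<alpha> - 1) / (\<Prod>y\<in>X - {x}. x - y) = poly (- (P * Q)) x / (\<Prod>y\<in>X - {x}. x - y)"
      using interp[OF x] X(2)[OF x] powr_add[of x "\<alpha> - 1" 1] by simp
  qed
  moreover have "divided_difference X (poly (- (P * Q))) = 0"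
    using degree_mult_le[of P Q] deg card by (intro divided_difference_poly_eq_0 X) auto
  ultimately show False by simp
qed

text \<open>
  The interpolation conditions make \<open>Q(-s)\<close> an orthogonal polynomial on the half-line, so that all its
  roots are simple and negative. The residues and the value at zero then get their signs from further
  choices of the test polynomial. The constant \<open>c\<close> is the value at zero rather than at infinity because
  the terms \<open>t / (t - z)\<close> vanish there.
\<close>
lemma interpolant_partial_fractions:
  fixes P Q :: "real poly"
  assumes \<alpha>: "0 < \<alpha>" "\<alpha> < 1"
    and X: "finite X" "\<And>x. x \<in> X \<Longrightarrow> x > 0" and card: "card X = 2 * n + 1"
    and interp: "\<And>x. x \<in> X \<Longrightarrow> poly P x = x powr \<alpha> * poly Q x"
    and deg: "degree P \<le> n" "degree Q \<le> n" and "Q \<noteq> 0"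
  obtains Z \<beta> c where "finite Z" "\<And>z. z \<in> Z \<Longrightarrow> z < 0" "c \<ge> 0" "\<And>z. z \<in> Z \<Longrightarrow> \<beta> z \<ge> 0"
    "\<And>t. t \<ge> 0 \<Longrightarrow> poly P t / poly Q t = c + (\<Sum>z\<in>Z. \<beta> z * (t / (t - z)))"
proof -
  have powr_split: "x * x powr (\<alpha> - 1) = x powr \<alpha>" if "x \<in> X" for x
    using X(2)[OF that] powr_add[of x "\<alpha> - 1" 1] by (simp add: mult.commute)
  define Z where "Z = {z. z < 0 \<and> poly Q z = 0}"
  have roots: "finite {z. poly Q z = 0}" "card {z. poly Q z = 0} \<le> degree Q"
    using poly_roots_finite[OF \<open>Q \<noteq> 0\<close>] card_poly_roots_bound[OF \<open>Q \<noteq> 0\<close>] by auto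
  have fZ: "finite Z" using roots(1) by (rule rev_finite_subset) (auto simp: Z_def)
  \<comment> \<open>If \<open>Q\<close> had too few sign changes on the negative half-line, multiplying by a polynomial \<open>g\<close> of
    degree less than \<open>n\<close> would remove them, which contradicts orthogonality.\<close>
  have "card Z \<ge> n"
  proof (rule ccontr)
    assume "\<not> ?thesis"
    then have less: "card Z < n" by simp
    have "\<exists>z\<in>Z. s < z \<and> z < t" if st: "s \<in> {..<0}" "t \<in> {..<0}" "s < t" "poly Q s * poly Q t < 0" for s t
      
    proof -
      obtain z where "s < z" "z < t" "poly Q z = 0" using poly_IVT[OF st(3,4)] by blast
      moreover have "z < 0" using \<open>z < t\<close> st(2) by simp
      ultimately show ?thesis by (auto simp: Z_def)
    qed
    then have "\<exists>S c. S \<subseteq> Z \<and> \<bar>c\<bar> = 1 \<and>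
        (\<forall>t\<in>{..<0}. poly Q t \<noteq> 0 \<longrightarrow> c * (\<Prod>z\<in>S. t - z) * poly Q t > 0)"
      by (intro sign_matching_product fZ) (auto simp: Z_def)
    then obtain S c where S: "S \<subseteq> Z" and c: "\<bar>c\<bar> = 1"
      and sgn: "\<And>t. t < 0 \<Longrightarrow> poly Q t \<noteq> 0 \<Longrightarrow> c * (\<Prod>z\<in>S. t - z) * poly Q t > 0"
      by (metis lessThan_iff)
    have fS: "finite S" using S fZ finite_subset by blast
    define g where "g = smult c (\<Prod>z\<in>S. [:-z, 1:])"
    have g: "poly g t = c * (\<Prod>z\<in>S. t - z)" for t by (simp add: g_def poly_prod)
    have "g \<noteq> 0" using c fS by (auto simp: g_def)
    have "degree (\<Prod>z\<in>S. [:-z, 1:]) \<le> card S"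
      using degree_prod_sum_le[OF fS, of "\<lambda>z. [:-z, 1:]"] by (simp add: o_def)
    also have "\<dots> \<le> card Z" using S fZ by (rule card_mono[rotated])
    finally have dg: "degree g < n" using less c by (auto simp: g_def)
    let ?h = "[:0, -1:] * (Q * g)"
    have "degree ?h < card X"
      using degree_mult_le[of "[:0, -1:]" "Q * g"] degree_mult_le[of Q g] deg dg card by simp
    moreover have "poly ?h (-s) \<ge> 0" if "s > 0" for s
    proof (cases "poly Q (-s) = 0")
      case False
      then have "s * (c * (\<Prod>z\<in>S. -s - z) * poly Q (-s)) > 0"
        by (intro mult_pos_pos[OF that] sgn) (use that in auto)
      then show ?thesis by (simp add: g mult_ac)
    qed simp
    ultimately have "(-1) ^ (card X - 1) * divided_difference X (\<lambda>x. poly ?h x * x powr (\<alpha> - 1)) > 0"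
      using \<open>Q \<noteq> 0\<close> \<open>g \<noteq> 0\<close> by (intro divided_difference_powr_pos \<alpha> X) auto
    moreover have "divided_difference X (\<lambda>x. poly ?h x * x powr (\<alpha> - 1)) = divided_difference X (poly (- (P * g)))"
      unfolding divided_difference_def
    proof (intro sum.cong refl)
      fix x assume x: "x \<in> X"
      have "poly ?h x * x powr (\<alpha> - 1) = - (x * x powr (\<alpha> - 1)) * poly Q x * poly g x" by simp
      then show "poly ?h x * x powr (\<alpha> - 1) / (\<Prod>y\<in>X - {x}. x - y) = poly (- (P * g)) x / (\<Prod>y\<in>X - {x}. x - y)"
        using interp[OF x] powr_split[OF x] by simp
    qed
    moreover have "divided_difference X (poly (- (P * g))) = 0"
      using degree_mult_le[of P g] deg dg card by (intro divided_difference_poly_eq_0 X) auto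
    ultimately show False by simp
  qed
  moreover have "card Z \<le> card {z. poly Q z = 0}"
    using roots(1) by (intro card_mono) (auto simp: Z_def)
  ultimately have cardZ: "card Z = n" and degQ: "degree Q = n" and "card {z. poly Q z = 0} = card Z"
    using roots(2) deg by linarith+
  then have Zeq: "Z = {z. poly Q z = 0}"
    using roots(1) by (intro card_subset_eq) (auto simp: Z_def)
  have Zneg: "z < 0" if "z \<in> Z" for z using that by (simp add: Z_def)
  have Qpos: "poly Q t \<noteq> 0" if "t \<ge> 0" for t
    using Zeq Zneg that by force
  have "\<forall>z\<in>Z. \<exists>q. Q = [:-z, 1:] * q"
    unfolding Z_def by (auto simp: poly_eq_0_iff_dvd dvd_def)
  then obtain K where K: "\<And>z. z \<in> Z \<Longrightarrow> Q = [:-z, 1:] * K z" by metis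
  have K0: "K z \<noteq> 0" if "z \<in> Z" for z using K[OF that] \<open>Q \<noteq> 0\<close> by auto
  have degK: "degree (K z) + 1 = n" if "z \<in> Z" for z
  proof -
    have "degree Q = degree ([:-z, 1:] * K z)" using K[OF that] by simp
    also have "\<dots> = 1 + degree (K z)" using K0[OF that] by (subst degree_mult_eq) auto
    finally show ?thesis using degQ by simp
  qed
  have polyQ: "poly Q t = (t - z) * poly (K z) t" if "z \<in> Z" for z t
    using arg_cong[OF K[OF that], of "\<lambda>p. poly p t"] by (simp add: algebra_simps)
  \<comment> \<open>Here \<open>K z = Q / (t - z)\<close>. The interpolation property turns the divided difference of
    \<open>K z * P / (t - z)\<close> into that of \<open>(K z)\<^sup>2 * t powr \<alpha>\<close>.\<close>
  have residue: "poly (K z) z * poly P z < 0" if z: "z \<in> Z" for z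
  proof -
    let ?h = "[:0, -1:] * (K z * K z)"
    have "degree ?h < card X"
      using degree_mult_le[of "[:0, -1:]" "K z * K z"] degree_mult_le[of "K z" "K z"] degK[OF z] card by simp
    then have pos: "(-1) ^ (card X - 1) * divided_difference X (\<lambda>x. poly ?h x * x powr (\<alpha> - 1)) > 0"
      using K0[OF z] by (intro divided_difference_powr_pos \<alpha> X) auto
    have "divided_difference X (\<lambda>x. poly ?h x * x powr (\<alpha> - 1)) =
          - divided_difference X (\<lambda>x. poly (K z * P) x / (x + (-z)))"
      unfolding divided_difference_def sum_negf[symmetric]
    proof (intro sum.cong refl)
      fix x assume x: "x \<in> X"
      have xz: "x - z \<noteq> 0" using X(2)[OF x] Zneg[OF z] by simp
      have "poly ?h x * x powr (\<alpha> - 1) = - (x * x powr (\<alpha> - 1)) * poly (K z) x * poly (K z) x" by simp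
      also have "\<dots> = - (poly (K z * P) x / (x + (-z)))"
        using interp[OF x] powr_split[OF x] xz by (simp add: polyQ[OF z])
      finally show "poly ?h x * x powr (\<alpha> - 1) / (\<Prod>y\<in>X - {x}. x - y) =
                    - (poly (K z * P) x / (x + (-z)) / (\<Prod>y\<in>X - {x}. x - y))" by simp
    qed
    also have "divided_difference X (\<lambda>x. poly (K z * P) x / (x + (-z))) =
         (-1) ^ (card X - 1) * poly (K z * P) (-(-z)) / (\<Prod>x\<in>X. x + (-z))"
      using degree_mult_le[of "K z" P] degK[OF z] deg card Zneg[OF z]
      by (intro divided_difference_kernel X) auto
    finally have "- (poly (K z * P) z / (\<Prod>x\<in>X. x + (-z))) > 0"
      using pos card by simp
    moreover have "(\<Prod>x\<in>X. x + (-z)) > 0"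
      using X(2) Zneg[OF z] by (intro prod_pos) force
    ultimately show ?thesis by (simp add: divide_less_0_iff)
  qed
  \<comment> \<open>The same argument with the kernel \<open>1 / t\<close>: the divided difference of \<open>Q * P / t\<close> equals
    that of \<open>Q\<^sup>2 * t powr (\<alpha> - 1)\<close>.\<close>
  have at0: "poly Q 0 * poly P 0 > 0"
  proof -
    have "degree (Q * Q) < card X"
      using degree_mult_le[of Q Q] deg card by simp
    then have pos: "(-1) ^ (card X - 1) * divided_difference X (\<lambda>x. poly (Q * Q) x * x powr (\<alpha> - 1)) > 0"
      using \<open>Q \<noteq> 0\<close> by (intro divided_difference_powr_pos \<alpha> X) auto
    have "divided_difference X (\<lambda>x. poly (Q * Q) x * x powr (\<alpha> - 1)) =
          divided_difference X (\<lambda>x. poly (Q * P) x / (x + 0))"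
      unfolding divided_difference_def
    proof (intro sum.cong refl)
      fix x assume x: "x \<in> X"
      have "poly (Q * Q) x * x powr (\<alpha> - 1) = poly (Q * P) x / (x + 0)"
        using interp[OF x] powr_split[OF x] X(2)[OF x] by (simp add: field_simps)
      then show "poly (Q * Q) x * x powr (\<alpha> - 1) / (\<Prod>y\<in>X - {x}. x - y) =
                    poly (Q * P) x / (x + 0) / (\<Prod>y\<in>X - {x}. x - y)" by simp
    qed
    also have "\<dots> = (-1) ^ (card X - 1) * poly (Q * P) (-0) / (\<Prod>x\<in>X. x + 0)"
      using degree_mult_le[of Q P] deg card by (intro divided_difference_kernel X) auto
    finally have "poly (Q * P) 0 / (\<Prod>x\<in>X. x) > 0"
      using pos card by simp
    moreover have "(\<Prod>x\<in>X. x) > 0" using X(2) by (intro prod_pos) auto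
    ultimately show ?thesis by (simp add: zero_less_divide_iff)
  qed
  define c where "c = poly P 0 / poly Q 0"
  define \<beta> where "\<beta> z = poly P z / (z * poly (K z) z)" for z
  \<comment> \<open>Both sides have degree at most \<open>n\<close> and agree at the \<open>n\<close> poles and at zero.\<close>
  have decomp: "P = smult c Q + (\<Sum>z\<in>Z. smult (\<beta> z) ([:0, 1:] * K z))" (is "P = ?R")
  proof (rule poly_eqI_degree[of "insert 0 Z"])
    have c0: "card (insert 0 Z) = n + 1" using fZ Zneg cardZ by (subst card_insert_disjoint) auto
    show "degree P < card (insert 0 Z)" using deg c0 by simp
    have "degree (smult (\<beta> z) ([:0, 1:] * K z)) \<le> n" if "z \<in> Z" for z
      using degree_smult_le[of "\<beta> z" "[:0, 1:] * K z"] degree_mult_le[of "[:0, 1:]" "K z"] degK[OF that]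
      by simp
    then have "degree (\<Sum>z\<in>Z. smult (\<beta> z) ([:0, 1:] * K z)) \<le> n"
      using fZ by (intro degree_sum_le) auto
    then have "degree ?R \<le> n"
      using degree_smult_le[of c Q] deg by (intro degree_add_le) auto
    then show "degree ?R < card (insert 0 Z)" using c0 by simp
  next
    fix x assume "x \<in> insert 0 Z"
    then show "poly P x = poly ?R x"
    proof
      assume "x = 0"
      then show ?thesis using Qpos[of 0] by (simp add: c_def poly_sum)
    next
      assume x: "x \<in> Z"
      have "(\<Sum>z\<in>Z. \<beta> z * (x * poly (K z) x)) = (\<Sum>z\<in>Z. if z = x then poly P x else 0)"
      proof (intro sum.cong refl)
        fix z assume z: "z \<in> Z"
        show "\<beta> z * (x * poly (K z) x) = (if z = x then poly P x else 0)"
        proof (cases "z = x")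
          case True
          then show ?thesis using residue[OF x] Zneg[OF x] by (auto simp: \<beta>_def)
        next
          case False
          have "poly Q x = 0" using x by (simp add: Z_def)
          then show ?thesis using False polyQ[OF z, of x] by simp
        qed
      qed
      moreover have "poly Q x = 0" using x by (simp add: Z_def)
      ultimately show ?thesis using x fZ by (simp add: poly_sum mult_ac)
    qed
  qed
  show ?thesis
  proof
    show "finite Z" by fact
    show "z < 0" if "z \<in> Z" for z using Zneg that .
    show "c \<ge> 0" using at0 by (auto simp: c_def zero_less_mult_iff zero_le_divide_iff)
    show "\<beta> z \<ge> 0" if "z \<in> Z" for z
      using residue[OF that] Zneg[OF that] by (auto simp: \<beta>_def mult_less_0_iff zero_le_divide_iff zero_le_mult_iff mult_le_0_iff)
    fix t :: real assume t: "t \<ge> 0"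
    have "poly P t = c * poly Q t + (\<Sum>z\<in>Z. \<beta> z * (t * poly (K z) t))"
      using arg_cong[OF decomp, of "\<lambda>p. poly p t"] by (simp add: poly_sum mult_ac)
    then have "poly P t / poly Q t = c + (\<Sum>z\<in>Z. \<beta> z * (t * poly (K z) t)) / poly Q t"
      using Qpos[OF t] by (simp add: add_divide_distrib)
    also have "(\<Sum>z\<in>Z. \<beta> z * (t * poly (K z) t)) / poly Q t = (\<Sum>z\<in>Z. \<beta> z * (t / (t - z)))"
      unfolding sum_divide_distrib
    proof (intro sum.cong refl)
      fix z assume z: "z \<in> Z"
      have "poly (K z) t \<noteq> 0" "t - z \<noteq> 0" using polyQ[OF z, of t] Qpos[OF t] by auto
      then show "\<beta> z * (t * poly (K z) t) / poly Q t = \<beta> z * (t / (t - z))"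
        by (simp add: polyQ[OF z])
    qed
    finally show "poly P t / poly Q t = c + (\<Sum>z\<in>Z. \<beta> z * (t / (t - z)))" .
  qed
qed

section \<open>Best rational approximation of a power\<close>

text \<open>
  Reducing the Bezout coefficient of \<open>A\<close> modulo \<open>B\<close> bounds its degree, and the degree of the other
  coefficient follows by comparing both sides.
\<close>
lemma bounded_degree_bezout:
  fixes A B w :: "real poly"
  assumes "coprime A B" and "B \<noteq> 0" and "degree A \<le> degree B" "degree B \<le> k" "degree w \<le> k + degree B"
  shows "\<exists>u v. degree u \<le> k \<and> degree v \<le> k \<and> u * B + v * A = w"
proof -
  obtain x y where xy: "x * A + y * B = 1"
    using bezout_coefficients_fst_snd[of A B] assms(1) by (metis coprime_iff_gcd_eq_1)
  define v where "v = (w * x) mod B"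
  have dv: "degree v \<le> degree B"
    using degree_mod_less[OF \<open>B \<noteq> 0\<close>, of "w * x"] by (auto simp: v_def)
  have "B dvd (w * x - v)" unfolding v_def by (simp add: minus_mod_eq_mult_div)
  then have "B dvd (w * x - v) * A + w * y * B" by simp
  also have "(w * x - v) * A + w * y * B = w * (x * A + y * B) - v * A"
    by (simp add: algebra_simps)
  finally have "B dvd (w - v * A)" using xy by simp
  then obtain u where u: "w - v * A = B * u" by (auto simp: dvd_def)
  have "degree (B * u) \<le> k + degree B"
    unfolding u[symmetric] using assms dv degree_mult_le[of v A]
    by (intro degree_diff_le) auto
  then have "degree u \<le> k"
    using \<open>B \<noteq> 0\<close> by (cases "u = 0") (auto simp: degree_mult_eq)
  moreover have "u * B + v * A = w" using u by (simp add: algebra_simps)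
  ultimately show ?thesis using dv assms by (intro exI[of _ u] exI[of _ v]) auto
qed

text \<open>
  The derivative of \<open>(P - e * u) / (Q - e * v)\<close> at \<open>e = 0\<close> is \<open>- (u * Q - v * P) / Q\<^sup>2\<close>. For a fraction
  in lowest terms the numerators fill the whole space of polynomials of degree at most
  \<open>k + max (degree P) (degree Q)\<close>; a dimension count cannot give more.
\<close>
lemma rational_tangent_space:
  fixes P Q w :: "real poly"
  assumes "coprime P Q" and "Q \<noteq> 0" and "degree P \<le> k" "degree Q \<le> k"
    and "degree w \<le> k + max (degree P) (degree Q)"
  obtains u v where "degree u \<le> k" "degree v \<le> k" "u * Q - v * P = w"
proof (cases "degree P \<le> degree Q")
  case True
  then obtain u v where "degree u \<le> k" "degree v \<le> k" "u * Q + v * P = w"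
    using bounded_degree_bezout[of P Q k w] assms by (auto simp: max_def)
  then show thesis using that[of u "-v"] by simp
next
  case False
  then have "P \<noteq> 0" by auto
  with False obtain u v where "degree u \<le> k" "degree v \<le> k" "u * P + v * Q = w"
    using bounded_degree_bezout[of Q P k w] assms by (auto simp: max_def coprime_commute)
  then show thesis using that[of v "-u"] by (simp add: add.commute)
qed

lemma uniform_error_le_iff:
  "uniform_error \<alpha> s \<le> ereal E \<longleftrightarrow> (\<forall>t\<in>{0..1}. \<bar>s t - t powr \<alpha>\<bar> \<le> E)"
  by (simp add: uniform_error_def SUP_le_iff)

lemma rational_functionsI:
  assumes "degree P \<le> k" "degree Q \<le> k" "poly Q 0 \<noteq> 0"
  shows "(\<lambda>t. poly P t / poly Q t) \<in> rational_functions k"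
proof -
  let ?c = "inverse (poly Q 0)"
  have "(\<lambda>t. poly P t / poly Q t) = (\<lambda>t. poly (smult ?c P) t / poly (smult ?c Q) t)"
    using assms(3) by auto
  moreover have "poly (smult ?c Q) 0 = 1" using assms(3) by simp
  ultimately show ?thesis unfolding rational_functions_def
    using assms by (intro CollectI exI[of _ "smult ?c P"] exI[of _ "smult ?c Q"]) auto
qed

lemma small_step_exists:
  fixes a b c a' b' c' :: real
  assumes "a > 0" "b > 0" "c > 0" "a' \<ge> 0" "b' \<ge> 0" "c' \<ge> 0"
  obtains \<epsilon> where "\<epsilon> > 0" "\<epsilon> * a' < a" "\<epsilon> * b' < b" "\<epsilon> * c' < c"
proof -
  define m where "m = min a (min b c)"
  define \<epsilon> where "\<epsilon> = m / (a' + b' + c' + 1)"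
  have m: "m > 0" "m \<le> a" "m \<le> b" "m \<le> c" using assms by (auto simp: m_def)
  have \<epsilon>: "\<epsilon> > 0" "\<epsilon> * (a' + b' + c' + 1) = m" using m assms by (auto simp: \<epsilon>_def)
  have "\<epsilon> * d < m" if "d < a' + b' + c' + 1" for d
    using \<epsilon> mult_strict_left_mono[OF that \<epsilon>(1)] by simp
  from this[of a'] this[of b'] this[of c'] show thesis
    using m \<epsilon> assms by (intro that[of \<epsilon>]) auto
qed

lemma continuous_on_powr_unit_interval: "0 < \<alpha> \<Longrightarrow> continuous_on {0..1} (\<lambda>t::real. t powr \<alpha>)"
  by (rule continuous_on_powr') (auto intro!: continuous_intros)

text \<open>
  If the error has at most \<open>k + max (degree P) (degree Q)\<close> zeros in the open interval, some polynomial
  \<open>w\<close> of at most that degree has the same sign as the error wherever the error does not vanish. Since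
  \<open>w / Q\<^sup>2\<close> is a tangent direction, a small step against it decreases the maximal error.
\<close>
lemma best_rational_approx_interpolates:
  fixes P Q :: "real poly"
  assumes \<alpha>: "0 < \<alpha>"
    and best: "best_rational_approx \<alpha> k (\<lambda>t. poly P t / poly Q t)"
    and cop: "coprime P Q" and deg: "degree P \<le> k" "degree Q \<le> k"
    and Qpos: "\<And>t. t \<in> {0..1} \<Longrightarrow> poly Q t > 0"
  obtains X where "X \<subseteq> {0<..<1}" "finite X" "card X = k + max (degree P) (degree Q) + 1"
    "\<And>x. x \<in> X \<Longrightarrow> poly P x = x powr \<alpha> * poly Q x"
proof -
  define n where "n = max (degree P) (degree Q)"
  define Z where "Z = {x \<in> {0<..<1}. poly P x = x powr \<alpha> * poly Q x}"
  define e where "e t = poly P t / poly Q t - t powr \<alpha>" for t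
  have conte: "continuous_on {0..1} e"
    unfolding e_def using Qpos \<alpha> by (intro continuous_intros continuous_on_powr_unit_interval) force+
  have e0: "e x = 0 \<longleftrightarrow> poly P x = x powr \<alpha> * poly Q x" if "x \<in> {0..1}" for x
    using Qpos[OF that] by (auto simp: e_def field_simps)
  have "\<exists>X\<subseteq>Z. finite X \<and> card X = k + n + 1"
  proof (rule ccontr)
    assume no: "\<not> ?thesis"
    have fZ: "finite Z" using no infinite_arbitrarily_large[of Z "k + n + 1"] by blast
    have cZ: "card Z \<le> k + n" 
      using no obtain_subset_with_card_n[of "k + n + 1" Z] 
      by (metis Suc_eq_plus1 not_less_eq_eq)
    have "\<exists>z\<in>Z. s < z \<and> z < t" if st: "s \<in> {0..1}" "t \<in> {0..1}" "s < t" "e s * e t < 0" for s t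
    proof -
      have cont: "continuous_on {s..t} e" using st by (intro continuous_on_subset[OF conte]) auto
      have "\<exists>z. s \<le> z \<and> z \<le> t \<and> e z = 0"
      proof (cases "e s < 0")
        case True
        with st have "e t > 0" by (auto simp: mult_less_0_iff)
        then show ?thesis using IVT'[of e s 0 t] cont True st by auto
      next
        case False
        with st have "e s > 0" "e t < 0" by (auto simp: mult_less_0_iff)
        then show ?thesis using IVT2'[of e t 0 s] cont st by auto
      qed
      then obtain z where z: "s \<le> z" "z \<le> t" "e z = 0" by blast
      then have "s \<noteq> z" "t \<noteq> z" using st by auto
      then show ?thesis using z st e0[of z] by (intro bexI[of _ z]) (auto simp: Z_def)
    qed
    moreover have "e z = 0" if "z \<in> Z" for z using that e0[of z] by (auto simp: Z_def)
    ultimately have "\<exists>S c. S \<subseteq> Z \<and> \<bar>c\<bar> = 1 \<and>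
        (\<forall>t\<in>{0..1}. e t \<noteq> 0 \<longrightarrow> c * (\<Prod>z\<in>S. t - z) * e t > 0)"
      by (intro sign_matching_product fZ)
    then obtain S c where S: "S \<subseteq> Z" and c: "\<bar>c\<bar> = 1"
      and sgn: "\<And>t. t \<in> {0..1} \<Longrightarrow> e t \<noteq> 0 \<Longrightarrow> c * (\<Prod>z\<in>S. t - z) * e t > 0"
      by blast
    have fS: "finite S" using S fZ finite_subset by blast
    define w where "w = smult c (\<Prod>z\<in>S. [:-z, 1:])"
    have w: "poly w t = c * (\<Prod>z\<in>S. t - z)" for t by (simp add: w_def poly_prod)
    have "degree (\<Prod>z\<in>S. [:-z, 1:]) \<le> card S"
      using degree_prod_sum_le[OF fS, of "\<lambda>z. [:-z, 1:]"] by (simp add: o_def)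
    also have "\<dots> \<le> card Z" using S fZ by (rule card_mono[rotated])
    finally have "degree w \<le> k + n" using cZ c by (auto simp: w_def)
    moreover have "Q \<noteq> 0" using Qpos[of 0] by auto
    ultimately obtain u v where uv: "degree u \<le> k" "degree v \<le> k" "u * Q - v * P = w"
      using rational_tangent_space[OF cop _ deg] unfolding n_def by metis
    have cI: "compact {0..1::real}" "{0..1::real} \<noteq> {}" by auto
    obtain q where q: "q > 0" "\<And>t. t \<in> {0..1} \<Longrightarrow> q \<le> poly Q t"
    proof -
      have "continuous_on {0..1} (poly Q)" by (intro continuous_intros)
      from continuous_attains_inf[OF cI this] obtain x where "x \<in> {0..1}" "\<forall>t\<in>{0..1}. poly Q x \<le> poly Q t" by blast
      then show ?thesis using Qpos by (intro that[of "poly Q x"]) auto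
    qed
    have bnd: "\<exists>M>0. \<forall>t\<in>{0..1}. \<bar>poly p t\<bar> \<le> M" for p :: "real poly"
    proof -
      have "continuous_on {0..1} (\<lambda>t. \<bar>poly p t\<bar>)" by (intro continuous_intros)
      from continuous_attains_sup[OF cI this] obtain x where "\<forall>t\<in>{0..1}. \<bar>poly p t\<bar> \<le> \<bar>poly p x\<bar>" by blast
      then show ?thesis by (intro exI[of _ "\<bar>poly p x\<bar> + 1"]) force
    qed
    obtain U where U: "U > 0" "\<And>t. t \<in> {0..1} \<Longrightarrow> \<bar>poly Q t\<bar> \<le> U" using bnd[of Q] by blast
    obtain V where V: "V > 0" "\<And>t. t \<in> {0..1} \<Longrightarrow> \<bar>poly v t\<bar> \<le> V" using bnd[of v] by blast
    obtain M where M: "M > 0" "\<And>t. t \<in> {0..1} \<Longrightarrow> \<bar>poly w t\<bar> \<le> M" using bnd[of w] by blast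
    have "continuous_on {0..1} (\<lambda>t. \<bar>e t\<bar>)" by (intro continuous_intros conte)
    from continuous_attains_sup[OF cI this] obtain t0 where
      t0: "t0 \<in> {0..1}" "\<And>t. t \<in> {0..1} \<Longrightarrow> \<bar>e t\<bar> \<le> \<bar>e t0\<bar>" by blast
    define E where "E = \<bar>e t0\<bar>"
    have E: "E > 0"
    proof (rule ccontr)
      assume "\<not> E > 0"
      then have "e t = 0" if "t \<in> {0..1}" for t using t0(2)[OF that] unfolding E_def by auto
      then have "Z = {0<..<1}" using e0 by (auto simp: Z_def)
      then show False using fZ by (simp add: infinite_Ioo)
    qed
    \<comment> \<open>On \<open>K\<close>, where the error is large, \<open>w * e\<close> is bounded below by some \<open>m > 0\<close>; off \<open>K\<close> there is
      room for any sufficiently small perturbation.\<close>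
    define K where "K = {t \<in> {0..1}. E / 2 \<le> \<bar>e t\<bar>}"
    have "continuous_on {0..1} (\<lambda>t. \<bar>e t\<bar>)" by (intro continuous_intros conte)
    then have "closed ({0..1} \<inter> (\<lambda>t. \<bar>e t\<bar>) -` {E / 2..})"
      by (intro continuous_closed_preimage) auto
    also have "{0..1} \<inter> (\<lambda>t. \<bar>e t\<bar>) -` {E / 2..} = K" by (auto simp: K_def)
    finally have "closed K" .
    moreover have "K \<inter> {0..1} = K" by (auto simp: K_def)
    ultimately have "compact K" using compact_Int_closed[of "{0..1}" K] by (simp add: Int_commute)
    moreover have "t0 \<in> K" using t0 E by (auto simp: K_def E_def)
    moreover have "continuous_on K (\<lambda>t. poly w t * e t)"
      by (intro continuous_intros continuous_on_subset[OF conte]) (auto simp: K_def)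
    ultimately obtain t1 where t1: "t1 \<in> K" "\<And>t. t \<in> K \<Longrightarrow> poly w t1 * e t1 \<le> poly w t * e t"
      using continuous_attains_inf[of K] by blast
    define m where "m = poly w t1 * e t1"
    have m: "m > 0" using t1(1) sgn[of t1] E unfolding m_def w K_def by auto
    define A where "A = 2 * m / (U * (U + q))"
    have Apos: "A > 0" using m U q by (auto simp: A_def intro!: divide_pos_pos mult_pos_pos)
    \<comment> \<open>The three conditions keep the denominator above \<open>q / 2\<close>, make the first order decrease on \<open>K\<close>
      dominate the second order term, and control the change of the error off \<open>K\<close>.\<close>
    obtain \<epsilon> where \<epsilon>: "\<epsilon> > 0" "\<epsilon> * V < q / 2" "\<epsilon> * (2 * M / q\<^sup>2)\<^sup>2 < A" "\<epsilon> * (2 * M / q\<^sup>2) < E / 2"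
      using small_step_exists[of "q / 2" A "E / 2" V "(2 * M / q\<^sup>2)\<^sup>2" "2 * M / q\<^sup>2"] q Apos E V M
      by auto
    let ?P = "P - smult \<epsilon> u" and ?Q = "Q - smult \<epsilon> v"
    have small: "\<epsilon> * \<bar>poly v t\<bar> < q / 2" if "t \<in> {0..1}" for t
      using mult_left_mono[OF V(2)[OF that], of \<epsilon>] \<epsilon>(1,2) by linarith
    have small': "\<bar>\<epsilon> * poly v t\<bar> < q / 2" if "t \<in> {0..1}" for t
      using small[OF that] \<epsilon> by (simp add: abs_mult)
    have Q'low: "q / 2 \<le> poly ?Q t" if "t \<in> {0..1}" for t
      using small'[OF that] q(2)[OF that] by simp
    have Q'up: "poly ?Q t \<le> U + q" if "t \<in> {0..1}" for t
    proof -
      have "poly ?Q t \<le> \<bar>poly Q t\<bar> + \<bar>\<epsilon> * poly v t\<bar>" by simp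
      then show ?thesis using small'[OF that] U(2)[OF that] q(1) by linarith
    qed
    define e' where "e' t = poly ?P t / poly ?Q t - t powr \<alpha>" for t
    have e'_eq: "e' t = e t - \<epsilon> * (poly w t / (poly Q t * poly ?Q t))" if t: "t \<in> {0..1}" for t
    proof -
      have nz: "poly Q t \<noteq> 0" "poly ?Q t \<noteq> 0" using Qpos[OF t] Q'low[OF t] q by auto
      have "poly ?P t / poly ?Q t - poly P t / poly Q t =
        (poly ?P t * poly Q t - poly P t * poly ?Q t) / (poly Q t * poly ?Q t)"
        using nz by (simp add: diff_frac_eq mult_ac)
      also have "poly ?P t * poly Q t - poly P t * poly ?Q t = - \<epsilon> * poly w t"
        unfolding uv(3)[symmetric] by (simp add: algebra_simps)
      finally show ?thesis by (simp add: e_def e'_def)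
    qed
    have less: "\<bar>e' t\<bar> < E" if t: "t \<in> {0..1}" for t
    proof -
      define g where "g = poly Q t * poly ?Q t"
      have "q * (q / 2) \<le> g" unfolding g_def
        using q(1) Q'low[OF t] Qpos[OF t] by (intro mult_mono q(2) t) linarith+
      then have glow: "q\<^sup>2 / 2 \<le> g" by (simp add: power2_eq_square)
      have gup: "g \<le> U * (U + q)" unfolding g_def
        using U(2)[OF t] Q'up[OF t] Q'low[OF t] q(1) U(1) Qpos[OF t] by (intro mult_mono) linarith+
      have gpos: "g > 0" using glow q by (meson half_gt_zero less_le_trans zero_less_power)
      have "\<bar>poly w t / g\<bar> \<le> M / (q\<^sup>2 / 2)"
        unfolding abs_divide using M gpos glow q by (intro frac_le M(2) t) auto
      then have wg: "\<bar>poly w t / g\<bar> \<le> 2 * M / q\<^sup>2" by (simp add: mult.commute)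
      have e't: "e' t = e t - \<epsilon> * (poly w t / g)" using e'_eq[OF t] by (simp add: g_def)
      show ?thesis
      proof (cases "t \<in> K")
        case True
        have "A = 2 * (m / (U * (U + q)))" by (simp add: A_def)
        also have "\<dots> \<le> 2 * (poly w t * e t / g)"
          using t1(2)[OF True] m gpos gup unfolding m_def[symmetric] by (intro mult_left_mono frac_le) auto
        finally have 1: "A \<le> 2 * (e t * (poly w t / g))" by (simp add: mult_ac)
        have "(poly w t / g)\<^sup>2 \<le> (2 * M / q\<^sup>2)\<^sup>2"
          using wg by (metis abs_ge_zero power2_abs power_mono)
        then have 2: "\<epsilon> * (poly w t / g)\<^sup>2 < A"
          using \<epsilon>(1,3) by (meson less_eq_real_def mult_left_mono order_le_less_trans)
        have "(e' t)\<^sup>2 = (e t)\<^sup>2 + \<epsilon> * (\<epsilon> * (poly w t / g)\<^sup>2 - 2 * (e t * (poly w t / g)))"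
          unfolding e't by (simp only: power2_eq_square) algebra
        also have "\<dots> < (e t)\<^sup>2" using 1 2 \<epsilon>(1) by (simp add: mult_less_0_iff)
        also have "\<dots> \<le> E\<^sup>2" unfolding E_def using t0(2)[OF t] by (simp add: abs_le_square_iff)
        finally have "(e' t)\<^sup>2 < E\<^sup>2" .
        then show ?thesis using E abs_le_square_iff[of E "e' t"] by simp
      next
        case False
        then have "\<bar>e t\<bar> < E / 2" using t by (auto simp: K_def)
        moreover have "\<bar>\<epsilon> * (poly w t / g)\<bar> < E / 2"
          unfolding abs_mult using wg \<epsilon>(1,4)
          by (smt (verit) mult_left_mono)
        ultimately show ?thesis unfolding e't by linarith
      qed
    qed
    have "continuous_on {0..1} (\<lambda>t. \<bar>e' t\<bar>)"
      unfolding e'_def using Q'low q \<alpha> by (intro continuous_intros continuous_on_powr_unit_interval) force+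
    from continuous_attains_sup[OF cI this] obtain t2 where
      t2: "t2 \<in> {0..1}" "\<And>t. t \<in> {0..1} \<Longrightarrow> \<bar>e' t\<bar> \<le> \<bar>e' t2\<bar>" by blast
    have "uniform_error \<alpha> (\<lambda>t. poly ?P t / poly ?Q t) \<le> ereal \<bar>e' t2\<bar>"
      unfolding uniform_error_le_iff using t2 by (simp add: e'_def)
    also have "\<dots> < ereal E" using less[OF t2(1)] by simp
    also have "ereal E \<le> uniform_error \<alpha> (\<lambda>t. poly P t / poly Q t)"
      unfolding uniform_error_def E_def e_def using t0(1) by (intro SUP_upper)
    finally have "uniform_error \<alpha> (\<lambda>t. poly ?P t / poly ?Q t) < uniform_error \<alpha> (\<lambda>t. poly P t / poly Q t)" .
    moreover have "(\<lambda>t. poly ?P t / poly ?Q t) \<in> rational_functions k"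
    proof (rule rational_functionsI)
      show "degree ?P \<le> k" "degree ?Q \<le> k"
        using deg uv degree_smult_le[of \<epsilon> u] degree_smult_le[of \<epsilon> v] by (auto intro!: degree_diff_le)
      show "poly ?Q 0 \<noteq> 0" using Q'low[of 0] q by simp
    qed
    ultimately show False using best unfolding best_rational_approx_def is_arg_min_def by blast
  qed
  then show thesis using that unfolding n_def Z_def by blast
qed

lemma le_on_unit_interval_cofinite:
  fixes f g :: "real \<Rightarrow> real"
  assumes "continuous_on {0..1} f" "continuous_on {0..1} g" "finite F"
    and le: "\<And>t. t \<in> {0..1} - F \<Longrightarrow> f t \<le> g t" and t: "t \<in> {0..1}"
  shows "f t \<le> g t"
proof -
  have "{0..1} - F \<noteq> {}"
    using assms(3) infinite_Icc[of 0 "1::real"] by (metis Diff_eq_empty_iff finite_subset zero_less_one)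
  have cl: "{0..1} \<subseteq> closure ({0..1} - F)"
  proof
    fix x :: real assume "x \<in> {0..1}"
    then have "x islimpt {0..1}" by (simp add: connected_imp_perfect)
    then have "x islimpt (({0..1} - F) \<union> (F \<inter> {0..1}))"
      by (rule islimpt_subset) auto
    then have "x islimpt ({0..1} - F)"
      using assms(3) islimpt_Un_finite[of "F \<inter> {0..1}" x "{0..1} - F"] by (simp add: Un_commute)
    then show "x \<in> closure ({0..1} - F)" by (simp add: closure_def)
  qed
  have cl': "closure ({0..1} - F) \<subseteq> {0..1}" by (rule closure_minimal) auto
  have "f t - g t \<le> 0"
  proof (rule continuous_le_on_closure[of "{0..1} - F" "\<lambda>t. f t - g t"])
    show "continuous_on (closure ({0..1} - F)) (\<lambda>t. f t - g t)"
      by (rule continuous_on_subset[OF _ cl']) (intro continuous_intros assms)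
    show "t \<in> closure ({0..1} - F)" using t cl by blast
  qed (use le in auto)
  then show ?thesis by simp
qed

text \<open>
  The best approximation need not be given in lowest terms, and at a common zero of \<open>P\<close> and \<open>Q\<close> the
  function \<open>r\<close> has the default value zero. The cancelled fraction \<open>P' / Q'\<close> is again a best
  approximation, and it interpolates at so many points that it must have full degree \<open>k\<close>; hence nothing
  was cancelled and \<open>r\<close> coincides with it everywhere.
\<close>
lemma best_rational_approx_partial_fractions:
  assumes \<alpha>: "0 < \<alpha>" "\<alpha> < 1" and best: "best_rational_approx \<alpha> k r"
  obtains Z \<beta> c where "finite Z" "\<And>z. z \<in> Z \<Longrightarrow> z < 0" "c \<ge> 0" "\<And>z. z \<in> Z \<Longrightarrow> \<beta> z \<ge> 0"
    "\<And>t. t \<ge> 0 \<Longrightarrow> r t = c + (\<Sum>z\<in>Z. \<beta> z * (t / (t - z)))"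
proof -
  have "r \<in> rational_functions k" using best by (simp add: best_rational_approx_def is_arg_min_def)
  then obtain P Q where r: "r = (\<lambda>t. poly P t / poly Q t)" and deg: "degree P \<le> k" "degree Q \<le> k"
    and Q1: "poly Q 0 = 1" by (auto simp: rational_functions_def)
  have Q0: "Q \<noteq> 0" using Q1 by auto
  define g where "g = gcd P Q"
  have "g \<noteq> 0" using Q0 by (simp add: g_def)
  then obtain P1 Q1 where PQ1: "P = P1 * g" "Q = Q1 * g" and cop1: "coprime P1 Q1"
    using gcd_coprime_exists[of P Q] unfolding g_def by blast
  define b where "b = poly g 0"
  have b0: "b \<noteq> 0" using Q1 PQ1 by (auto simp: b_def)
  define P' where "P' = smult b P1"
  define Q' where "Q' = smult b Q1"
  define G where "G = smult (inverse b) g"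
  have PQ: "P = P' * G" "Q = Q' * G" using b0 PQ1 by (auto simp: P'_def Q'_def G_def)
  have Q'1: "poly Q' 0 = 1" using Q1 PQ1 b_def by (simp add: Q'_def mult.commute)
  have unit: "is_unit [:b:]" using b0 by (simp add: is_unit_const_poly_iff dvd_field_iff)
  have "coprime ([:b:] * P1) ([:b:] * Q1)"
    using cop1 is_unit_left_imp_coprime[OF unit] is_unit_right_imp_coprime[OF unit]
    by (simp only: coprime_mult_left_iff coprime_mult_right_iff)
  then have cop: "coprime P' Q'" by (simp add: P'_def Q'_def)
  obtain x y where xy: "x * P' + y * Q' = 1"
    using bezout_coefficients_fst_snd[of P' Q'] cop by (metis coprime_iff_gcd_eq_1)
  have G0: "G \<noteq> 0" using \<open>g \<noteq> 0\<close> b0 by (simp add: G_def)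
  have Q'0: "Q' \<noteq> 0" using Q'1 by auto
  have degQ: "degree Q = degree Q' + degree G" using PQ G0 Q'0 by (simp add: degree_mult_eq)
  have degP: "P' \<noteq> 0 \<Longrightarrow> degree P = degree P' + degree G" using PQ G0 by (simp add: degree_mult_eq)
  have deg': "degree P' \<le> k" "degree Q' \<le> k" using degQ degP deg by (cases "P' = 0"; auto)+
  define F where "F = {t. poly G t = 0}"
  have fF: "finite F" unfolding F_def using poly_roots_finite[OF G0] .
  have rF: "r t = poly P' t / poly Q' t" if "t \<notin> F" for t
    using that by (simp add: r PQ F_def)
  have "(\<lambda>t. poly [:1/2:] t / poly 1 t) \<in> rational_functions k"
    by (rule rational_functionsI) auto
  then have half_in: "(\<lambda>t. 1/2) \<in> rational_functions k" by simp
  have "uniform_error \<alpha> (\<lambda>t. 1 / 2) \<le> ereal (1/2)"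
    unfolding uniform_error_le_iff
  proof
    fix t :: real assume "t \<in> {0..1}"
    then have "0 \<le> t powr \<alpha>" "t powr \<alpha> \<le> 1" using \<alpha> by (auto intro: powr_le1)
    then show "\<bar>1 / 2 - t powr \<alpha>\<bar> \<le> 1 / 2" unfolding abs_le_iff by linarith
  qed
  moreover have "uniform_error \<alpha> r \<le> uniform_error \<alpha> (\<lambda>t. 1 / 2)"
    using best half_in unfolding best_rational_approx_def is_arg_min_def by (meson not_le)
  ultimately have le_half: "uniform_error \<alpha> r \<le> ereal (1/2)" by simp
  moreover have "ereal \<bar>r 0 - 0 powr \<alpha>\<bar> \<le> uniform_error \<alpha> r"
    unfolding uniform_error_def by (rule SUP_upper) auto
  ultimately obtain E where E: "uniform_error \<alpha> r = ereal E" "E \<le> 1/2"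
    by (cases "uniform_error \<alpha> r") auto
  have errE: "\<bar>r t - t powr \<alpha>\<bar> \<le> E" if "t \<in> {0..1}" for t
    using E(1) that uniform_error_le_iff[of \<alpha> r E] by auto
  \<comment> \<open>The error of \<open>r\<close> is at most that of the constant \<open>1 / 2\<close>, so \<open>r\<close> is bounded and \<open>Q'\<close> has no
    zeros on the unit interval.\<close>
  have bound: "\<bar>poly P' t\<bar> \<le> 2 * \<bar>poly Q' t\<bar>" if "t \<in> {0..1}" for t
  proof (rule le_on_unit_interval_cofinite[OF _ _ finite_UnI[OF fF poly_roots_finite[OF Q'0]] _ that])
    fix t assume t: "t \<in> {0..1} - (F \<union> {t. poly Q' t = 0})"
    have "t powr \<alpha> \<le> 1" "0 \<le> t powr \<alpha>" using t \<alpha> by (auto intro: powr_le1)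
    moreover have "\<bar>r t - t powr \<alpha>\<bar> \<le> E" using errE[of t] t by simp
    ultimately have "\<bar>r t\<bar> \<le> 2" using E(2) by linarith
    then show "\<bar>poly P' t\<bar> \<le> 2 * \<bar>poly Q' t\<bar>"
      using rF[of t] t by (auto simp: field_simps)
  qed (intro continuous_intros)+
  have Q'ne: "poly Q' t \<noteq> 0" if "t \<in> {0..1}" for t
  proof
    assume "poly Q' t = 0"
    with bound[OF that] have "poly P' t = 0" by simp
    with \<open>poly Q' t = 0\<close> show False using arg_cong[OF xy, of "\<lambda>p. poly p t"] by simp
  qed
  have Q'pos: "poly Q' t > 0" if t: "t \<in> {0..1}" for t
  proof (rule ccontr)
    assume "\<not> ?thesis"
    then have "poly Q' t < 0" using Q'ne[OF t] by simp
    moreover have "t \<noteq> 0" using calculation Q'1 by auto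
    ultimately obtain s where "0 < s" "s < t" "poly Q' s = 0"
      using poly_IVT_neg[of 0 t Q'] Q'1 t by auto
    then show False using Q'ne[of s] t by auto
  qed
  have "\<bar>poly P' t / poly Q' t - t powr \<alpha>\<bar> \<le> E" if "t \<in> {0..1}" for t
  proof (rule le_on_unit_interval_cofinite[OF _ _ fF _ that])
    show "continuous_on {0..1} (\<lambda>t. \<bar>poly P' t / poly Q' t - t powr \<alpha>\<bar>)"
      using Q'pos \<alpha> by (intro continuous_intros continuous_on_powr_unit_interval) force+
    fix t assume "t \<in> {0..1} - F"
    then show "\<bar>poly P' t / poly Q' t - t powr \<alpha>\<bar> \<le> E" using errE[of t] rF[of t] by auto
  qed (intro continuous_intros)
  then have "uniform_error \<alpha> (\<lambda>t. poly P' t / poly Q' t) \<le> uniform_error \<alpha> r"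
    unfolding E uniform_error_le_iff by blast
  moreover have "(\<lambda>t. poly P' t / poly Q' t) \<in> rational_functions k"
    using deg' Q'1 by (intro rational_functionsI) auto
  ultimately have best': "best_rational_approx \<alpha> k (\<lambda>t. poly P' t / poly Q' t)"
    using best unfolding best_rational_approx_def is_arg_min_def by (meson less_le_trans)
  define n where "n = max (degree P') (degree Q')"
  from best_rational_approx_interpolates[OF \<alpha>(1) best' cop deg' Q'pos]
  obtain X where X: "X \<subseteq> {0<..<1}" "finite X" "card X = k + n + 1"
    and interp: "\<And>x. x \<in> X \<Longrightarrow> poly P' x = x powr \<alpha> * poly Q' x"
    unfolding n_def by metis
  have Xpos: "x > 0" if "x \<in> X" for x using X that by auto
  have "card X < 2 * n + 2"
    by (rule interpolant_nondegenerate[OF \<alpha> X(2) Xpos interp _ _ Q'0]) (auto simp: n_def)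
  moreover have "n \<le> k" using deg' by (simp add: n_def)
  ultimately have nk: "n = k" using X(3) by linarith
  have "degree G = 0"
  proof (cases "degree P' \<le> degree Q'")
    case True
    then show ?thesis using nk degQ deg by (simp add: n_def)
  next
    case False
    then have "P' \<noteq> 0" by auto
    then show ?thesis using False nk degP deg by (simp add: n_def)
  qed
  then obtain a where "G = [:a:]" by (rule degree_eq_zeroE)
  then have "F = {}" using G0 by (auto simp: F_def)
  then have r': "r t = poly P' t / poly Q' t" for t using rF by simp
  have "card X = 2 * k + 1" using X(3) nk by simp
  from interpolant_partial_fractions[OF \<alpha> X(2) Xpos this interp deg' Q'0]
  show thesis using that unfolding r' by metis
qed

section \<open>Spectral decomposition of a symmetric operator\<close>

text \<open>
  Gaussian elimination: a function that does not vanish at \<open>p\<close> is used to clear the values of all the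
  others at \<open>p\<close>.
\<close>
lemma linear_dependence_on_finite_set:
  fixes u :: "nat \<Rightarrow> 'x \<Rightarrow> real"
  assumes "finite I"
  shows "\<exists>c. (\<exists>j\<le>card I. c j \<noteq> 0) \<and> (\<forall>p\<in>I. (\<Sum>j\<le>card I. c j * u j p) = 0)"
  using assms
proof (induction I arbitrary: u rule: finite_induct)
  case empty
  show ?case by (intro exI[of _ "\<lambda>_. 1"]) auto
next
  case (insert p I)
  let ?n = "card I"
  have cardI: "card (insert p I) = Suc ?n" using insert by simp
  show ?case
  proof (cases "\<exists>m\<le>Suc ?n. u m p \<noteq> 0")
    case False
    obtain c where c: "\<exists>j\<le>?n. c j \<noteq> 0" "\<forall>q\<in>I. (\<Sum>j\<le>?n. c j * u j q) = 0"
      using insert.IH[of u] by blast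
    let ?c = "\<lambda>j. if j \<le> ?n then c j else 0"
    have "(\<Sum>j\<le>Suc ?n. ?c j * u j q) = 0" if "q \<in> insert p I" for q
    proof (cases "q = p")
      case True
      then show ?thesis using False by (intro sum.neutral) auto
    next
      case False
      then have "(\<Sum>j\<le>Suc ?n. ?c j * u j q) = (\<Sum>j\<le>?n. c j * u j q)" by simp
      then show ?thesis using c False that by simp
    qed
    moreover have "\<exists>j\<le>Suc ?n. ?c j \<noteq> 0" using c(1) by (metis le_SucI)
    ultimately show ?thesis unfolding cardI by (intro exI[of _ ?c]) blast
  next
    case True
    then obtain m where m: "m \<le> Suc ?n" "u m p \<noteq> 0" by blast
    \<comment> \<open>\<open>\<sigma>\<close> enumerates the remaining indices, skipping the pivot \<open>m\<close>.\<close>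
    define \<sigma> where "\<sigma> j = (if j < m then j else Suc j)" for j
    have img: "\<sigma> ` {..?n} = {..Suc ?n} - {m}"
    proof
      show "\<sigma> ` {..?n} \<subseteq> {..Suc ?n} - {m}" by (auto simp: \<sigma>_def)
      show "{..Suc ?n} - {m} \<subseteq> \<sigma> ` {..?n}"
      proof
        fix j assume j: "j \<in> {..Suc ?n} - {m}"
        show "j \<in> \<sigma> ` {..?n}"
        proof (cases "j < m")
          case True
          then show ?thesis using m by (intro image_eqI[of _ _ j]) (auto simp: \<sigma>_def)
        next
          case False
          then show ?thesis using j by (intro image_eqI[of _ _ "j - 1"]) (auto simp: \<sigma>_def)
        qed
      qed
    qed
    have inj: "inj_on \<sigma> {..?n}" by (auto simp: inj_on_def \<sigma>_def split: if_splits)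
    obtain c where c: "\<exists>j\<le>?n. c j \<noteq> 0"
      "\<forall>q\<in>I. (\<Sum>j\<le>?n. c j * (u (\<sigma> j) q - u (\<sigma> j) p / u m p * u m q)) = 0"
      using insert.IH[of "\<lambda>j q. u (\<sigma> j) q - u (\<sigma> j) p / u m p * u m q"] by blast
    define d where "d = inv_into {..?n} \<sigma>"
    have d: "d (\<sigma> j) = j" if "j \<le> ?n" for j using inj that by (simp add: d_def)
    let ?c = "\<lambda>j. if j = m then - (\<Sum>i\<le>?n. c i * (u (\<sigma> i) p / u m p)) else c (d j)"
    have split: "(\<Sum>j\<le>Suc ?n. ?c j * u j q) = (\<Sum>j\<le>?n. c j * (u (\<sigma> j) q - u (\<sigma> j) p / u m p * u m q))" for q
    proof -
      have "(\<Sum>j\<le>Suc ?n. ?c j * u j q) = ?c m * u m q + (\<Sum>j\<in>{..Suc ?n} - {m}. ?c j * u j q)"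
        using m by (subst sum.remove[of _ m]) auto
      also have "(\<Sum>j\<in>{..Suc ?n} - {m}. ?c j * u j q) = (\<Sum>j\<in>{..Suc ?n} - {m}. c (d j) * u j q)"
        by (intro sum.cong) auto
      also have "\<dots> = (\<Sum>j\<le>?n. c j * u (\<sigma> j) q)"
        unfolding img[symmetric] using d by (subst sum.reindex[OF inj]) simp
      finally have "(\<Sum>j\<le>Suc ?n. ?c j * u j q) =
          (\<Sum>j\<le>?n. c j * u (\<sigma> j) q) - (\<Sum>i\<le>?n. c i * (u (\<sigma> i) p / u m p)) * u m q" by simp
      also have "\<dots> = (\<Sum>j\<le>?n. c j * (u (\<sigma> j) q - u (\<sigma> j) p / u m p * u m q))"
        unfolding sum_distrib_right sum_subtractf[symmetric] by (intro sum.cong refl) (simp add: algebra_simps)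
      finally show ?thesis .
    qed
    have "(\<Sum>j\<le>Suc ?n. ?c j * u j q) = 0" if "q \<in> insert p I" for q
      unfolding split using that c m by auto
    moreover obtain j where j: "j \<le> ?n" "c j \<noteq> 0" using c by blast
    moreover have "\<sigma> j \<le> Suc ?n" "\<sigma> j \<noteq> m" using img j by auto
    ultimately show ?thesis unfolding cardI
      by (intro exI[of _ ?c] conjI exI[of _ "\<sigma> j"]) (auto simp: d)
  qed
qed

lemma map_poly_of_real_add:
  "map_poly (of_real :: real \<Rightarrow> complex) (p + q) = map_poly of_real p + map_poly of_real q"
  by (intro poly_eqI) (simp add: coeff_map_poly)

lemma map_poly_of_real_mult:
  "map_poly (of_real :: real \<Rightarrow> complex) (p * q) = map_poly of_real p * map_poly of_real q"
  by (intro poly_eqI) (simp add: coeff_map_poly coeff_mult)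

lemma real_poly_factor:
  fixes p :: "real poly"
  assumes "degree p > 0"
  obtains l q where "p = [:-l, 1:] * q" | a b q where "b \<noteq> 0" "p = [:a\<^sup>2 + b\<^sup>2, -2 * a, 1:] * q"
proof -
  let ?h = "map_poly (of_real :: real \<Rightarrow> complex)"
  have "degree (?h p) = degree p" by (rule map_poly_degree_eq) (use assms in auto)
  then have "\<not> constant (poly (?h p))" using assms by (simp add: constant_degree)
  then obtain z where z: "poly (?h p) z = 0" using fundamental_theorem_of_algebra by blast
  show thesis
  proof (cases "Im z = 0")
    case True
    then have "z = of_real (Re z)" by (simp add: complex_eq_iff)
    moreover have "poly (?h p) (of_real x) = of_real (poly p x)" for x
      by (induction p) (auto simp: map_poly_pCons)
    ultimately have "poly p (Re z) = 0" using z by (metis of_real_eq_0_iff)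
    then obtain q where "p = [:-Re z, 1:] * q" by (auto simp: poly_eq_0_iff_dvd dvd_def)
    then show thesis by (rule that(1))
  next
    case False
    let ?Q = "[:(Re z)\<^sup>2 + (Im z)\<^sup>2, -2 * Re z, 1:]"
    define R where "R = p mod ?Q"
    have dR: "degree R < 2"
      using degree_mod_less[of ?Q p] by (auto simp: R_def)
    have "poly (?h ?Q) z = 0"
      by (simp add: map_poly_pCons complex_eq_iff power2_eq_square algebra_simps)
    moreover have "?h p = ?h ?Q * ?h (p div ?Q) + ?h R"
      unfolding R_def by (simp only: map_poly_of_real_mult[symmetric] map_poly_of_real_add[symmetric] mult_div_mod_eq)
    ultimately have Rz: "poly (?h R) z = 0" using z by simp
    define r0 where "r0 = coeff R 0"
    define r1 where "r1 = coeff R 1"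
    have R: "R = [:r0, r1:]"
    proof (rule poly_eqI)
      fix n show "coeff R n = coeff [:r0, r1:] n"
        using dR coeff_eq_0[of R n] by (cases "n = 0"; cases "n = 1") (auto simp: r0_def r1_def coeff_pCons split: nat.split)
    qed
    have "r1 = 0" "r0 = 0" using Rz False unfolding R by (auto simp: map_poly_pCons complex_eq_iff)
    then have "R = 0" using R by simp
    then have "p = ?Q * (p div ?Q)" unfolding R_def by (metis mult_div_mod_eq add.right_neutral)
    then show thesis using False by (intro that(2)[of "Im z" "Re z"]) auto
  qed
qed

lemma shift_quotient:
  fixes d l u :: real
  assumes "d \<noteq> 0"
  shows "1 / d * ((l + d) * u) - l * (1 / d * u) = u"
proof -
  have "i * ((l + d) * u) - l * (i * u) = (d * i) * u" for i by algebra
  then have "1 / d * ((l + d) * u) - l * (1 / d * u) = (d * (1 / d)) * u" .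
  also have "(d * (1 / d)) * u = u" using assms by simp
  finally show ?thesis .
qed

text \<open>
  The set \<open>I\<close> separates the elements of \<open>V\<close>; it serves as the certificate that \<open>V\<close> is
  finite-dimensional.
\<close>
locale symmetric_operator =
  fixes V :: "('x \<Rightarrow> real) set" and I :: "'x set"
    and B :: "('x \<Rightarrow> real) \<Rightarrow> ('x \<Rightarrow> real) \<Rightarrow> real" and A :: "('x \<Rightarrow> real) \<Rightarrow> ('x \<Rightarrow> real)"
  assumes finite_I: "finite I"
    and zero_on_I: "v \<in> V \<Longrightarrow> (\<And>p. p \<in> I \<Longrightarrow> v p = 0) \<Longrightarrow> v = (\<lambda>x. 0)"
    and zero_in: "(\<lambda>x. 0) \<in> V"
    and comb_in: "u \<in> V \<Longrightarrow> v \<in> V \<Longrightarrow> (\<lambda>x. a * u x + b * v x) \<in> V"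
    and B_comb: "u \<in> V \<Longrightarrow> v \<in> V \<Longrightarrow> w \<in> V \<Longrightarrow> B (\<lambda>x. a * u x + b * v x) w = a * B u w + b * B v w"
    and B_sym: "u \<in> V \<Longrightarrow> v \<in> V \<Longrightarrow> B u v = B v u"
    and B_pos: "v \<in> V \<Longrightarrow> v \<noteq> (\<lambda>x. 0) \<Longrightarrow> B v v > 0"
    and A_in: "v \<in> V \<Longrightarrow> A v \<in> V"
    and A_comb: "u \<in> V \<Longrightarrow> v \<in> V \<Longrightarrow> A (\<lambda>x. a * u x + b * v x) = (\<lambda>x. a * A u x + b * A v x)"
    and A_sym: "u \<in> V \<Longrightarrow> v \<in> V \<Longrightarrow> B (A u) v = B u (A v)"
begin

abbreviation "eigen \<equiv> eigenspace V A"
abbreviation "\<Lambda> \<equiv> eigenvalues V A"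

lemma sum_in: "finite J \<Longrightarrow> (\<And>j. j \<in> J \<Longrightarrow> u j \<in> V) \<Longrightarrow> (\<lambda>x. \<Sum>j\<in>J. c j * u j x) \<in> V"
proof (induction J rule: finite_induct)
  case (insert j J)
  have "(\<lambda>x. c j * u j x + 1 * (\<Sum>i\<in>J. c i * u i x)) \<in> V"
    by (intro comb_in insert.IH) (use insert in auto)
  then show ?case using insert by simp
qed (simp add: zero_in)

lemma A_scale: "u \<in> V \<Longrightarrow> A (\<lambda>x. a * u x) = (\<lambda>x. a * A u x)"
  using A_comb[of u u a 0] by simp

lemma A_zero: "A (\<lambda>x. 0) = (\<lambda>x. 0)"
  using A_scale[OF zero_in, of 0] by simp

lemma A_sum: "finite J \<Longrightarrow> (\<And>j. j \<in> J \<Longrightarrow> u j \<in> V) \<Longrightarrow>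
    A (\<lambda>x. \<Sum>j\<in>J. c j * u j x) = (\<lambda>x. \<Sum>j\<in>J. c j * A (u j) x)"
proof (induction J rule: finite_induct)
  case (insert j J)
  have "A (\<lambda>x. c j * u j x + 1 * (\<Sum>i\<in>J. c i * u i x)) = (\<lambda>x. c j * A (u j) x + 1 * A (\<lambda>x. \<Sum>i\<in>J. c i * u i x) x)"
    by (intro A_comb sum_in) (use insert in auto)
  then show ?case using insert by simp
qed (simp add: A_zero)

lemma B_scale: "u \<in> V \<Longrightarrow> w \<in> V \<Longrightarrow> B (\<lambda>x. a * u x) w = a * B u w"
  using B_comb[of u u w a 0] by simp

lemma B_zero: "w \<in> V \<Longrightarrow> B (\<lambda>x. 0) w = 0"
  using B_scale[OF zero_in, of w 0] by simp

lemma B_sum: "finite J \<Longrightarrow> (\<And>j. j \<in> J \<Longrightarrow> u j \<in> V) \<Longrightarrow> w \<in> V \<Longrightarrow>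
    B (\<lambda>x. \<Sum>j\<in>J. c j * u j x) w = (\<Sum>j\<in>J. c j * B (u j) w)"
proof (induction J rule: finite_induct)
  case (insert j J)
  have "B (\<lambda>x. c j * u j x + 1 * (\<Sum>i\<in>J. c i * u i x)) w = c j * B (u j) w + 1 * B (\<lambda>x. \<Sum>i\<in>J. c i * u i x) w"
    by (intro B_comb sum_in) (use insert in auto)
  then show ?case using insert by simp
qed (simp add: B_zero)

lemma B_eq_0: "v \<in> V \<Longrightarrow> B v v = 0 \<Longrightarrow> v = (\<lambda>x. 0)"
  using B_pos[of v] by force

lemma eigen_in: "u \<in> eigen l \<Longrightarrow> u \<in> V" by (simp add: eigenspace_def)
lemma eigen_A: "u \<in> eigen l \<Longrightarrow> A u = (\<lambda>x. l * u x)" by (simp add: eigenspace_def)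

lemma eigen_comb:
  assumes "u \<in> eigen l" "v \<in> eigen l"
  shows "(\<lambda>x. a * u x + b * v x) \<in> eigen l"
  using assms comb_in[of u v a b] A_comb[of u v a b] by (auto simp: eigenspace_def algebra_simps)

lemma zero_eigen: "(\<lambda>x. 0) \<in> eigen l"
  by (simp add: eigenspace_def zero_in A_zero)

lemma eigen_orthogonal:
  assumes "u \<in> eigen l" "v \<in> eigen m" "l \<noteq> m"
  shows "B u v = 0"
proof -
  note V = eigen_in[OF assms(1)] eigen_in[OF assms(2)]
  have "l * B u v = B (A u) v" using V by (simp add: eigen_A[OF assms(1)] B_scale)
  also have "\<dots> = B u (A v)" by (rule A_sym[OF V])
  also have "\<dots> = B (A v) u" by (rule B_sym[OF V(1) A_in[OF V(2)]])
  also have "\<dots> = m * B u v" using V by (simp add: eigen_A[OF assms(2)] B_scale B_sym)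
  finally show ?thesis using assms(3) by simp
qed

lemma finite_eigenvalues: "finite \<Lambda>"
proof (rule ccontr)
  assume "infinite \<Lambda>"
  then obtain L where L: "L \<subseteq> \<Lambda>" "finite L" "card L = Suc (card I)"
    using infinite_arbitrarily_large by blast
  then obtain l where l: "bij_betw l {..card I} L"
    using bij_betw_iff_card[of "{..card I}" L] by auto
  have "\<forall>j\<le>card I. \<exists>v. v \<in> eigen (l j) \<and> v \<noteq> (\<lambda>x. 0)"
    using bij_betwE[OF l] L(1) by (fastforce simp: eigenvalues_def)
  then obtain u where u: "\<And>j. j \<le> card I \<Longrightarrow> u j \<in> eigen (l j)" "\<And>j. j \<le> card I \<Longrightarrow> u j \<noteq> (\<lambda>x. 0)"
    by metis
  obtain c m where m: "m \<le> card I" "c m \<noteq> 0" and c: "\<forall>p\<in>I. (\<Sum>j\<le>card I. c j * u j p) = 0"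
    using linear_dependence_on_finite_set[OF finite_I, of u] by blast
  have uV: "u j \<in> V" if "j \<in> {..card I}" for j using u(1)[of j] that eigen_in by auto
  have "(\<lambda>x. \<Sum>j\<le>card I. c j * u j x) = (\<lambda>x. 0)"
    by (rule zero_on_I[OF sum_in]) (use uV c in auto)
  then have "0 = B (\<lambda>x. \<Sum>j\<le>card I. c j * u j x) (u m)" using B_zero uV m by simp
  also have "\<dots> = (\<Sum>j\<le>card I. c j * B (u j) (u m))" using uV m by (intro B_sum) auto
  also have "\<dots> = (\<Sum>j\<le>card I. if j = m then c m * B (u m) (u m) else 0)"
  proof (intro sum.cong refl)
    fix j assume j: "j \<in> {..card I}"
    show "c j * B (u j) (u m) = (if j = m then c m * B (u m) (u m) else 0)"
    proof (cases "j = m")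
      case False
      then have "l j \<noteq> l m" using bij_betw_imp_inj_on[OF l] j m by (auto dest: inj_onD)
      then show ?thesis using eigen_orthogonal[of "u j" "l j" "u m" "l m"] u(1) j m False by simp
    qed simp
  qed
  also have "\<dots> = c m * B (u m) (u m)" using m by simp
  finally show False using m u(2)[of m] B_pos[OF uV, of m] by simp
qed

text \<open>
  The Horner scheme for \<open>p(A) v\<close>.
\<close>
definition poly_op :: "real poly \<Rightarrow> ('x \<Rightarrow> real) \<Rightarrow> 'x \<Rightarrow> real" where
  "poly_op p v = fold_coeffs (\<lambda>a w x. a * v x + A w x) p (\<lambda>x. 0)"

lemma poly_op_0: "poly_op 0 v = (\<lambda>x. 0)"
  by (simp add: poly_op_def)

lemma poly_op_pCons: "poly_op (pCons a p) v = (\<lambda>x. a * v x + A (poly_op p v) x)"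
  by (cases "a = 0 \<and> p = 0") (auto simp: poly_op_def A_zero)

lemma poly_op_in: "v \<in> V \<Longrightarrow> poly_op p v \<in> V"
proof (induction p)
  case (pCons a p)
  then show ?case using comb_in[of v "A (poly_op p v)" a 1] A_in by (simp add: poly_op_pCons)
qed (simp add: poly_op_0 zero_in)

lemma poly_op_add: "v \<in> V \<Longrightarrow> poly_op (p + q) v = (\<lambda>x. poly_op p v x + poly_op q v x)"
proof (induction p q rule: poly_induct2)
  case (pCons a p b q)
  have "A (\<lambda>x. 1 * poly_op p v x + 1 * poly_op q v x) = (\<lambda>x. 1 * A (poly_op p v) x + 1 * A (poly_op q v) x)"
    by (intro A_comb poly_op_in pCons)
  then show ?case using pCons by (simp add: poly_op_pCons algebra_simps)
qed (simp add: poly_op_0)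

lemma poly_op_smult: "v \<in> V \<Longrightarrow> poly_op (smult c p) v = (\<lambda>x. c * poly_op p v x)"
  by (induction p) (auto simp: poly_op_0 poly_op_pCons A_scale poly_op_in algebra_simps)

lemma poly_op_mult: "v \<in> V \<Longrightarrow> poly_op (p * q) v = poly_op p (poly_op q v)"
  by (induction p) (auto simp: poly_op_0 poly_op_pCons poly_op_add poly_op_smult)

lemma poly_op_monom: "v \<in> V \<Longrightarrow> poly_op (monom c n) v = (\<lambda>x. c * (A ^^ n) v x)"
proof (induction n)
  case 0
  then show ?case by (simp add: monom_0 poly_op_pCons poly_op_0 A_zero)
next
  case (Suc n)
  have "(A ^^ n) v \<in> V" using Suc.prems by (induction n) (auto intro: A_in)
  then show ?case using Suc by (simp add: monom_Suc poly_op_pCons A_scale)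
qed

text \<open>
  The vectors \<open>v, A v, A\<^sup>2 v, \<dots>\<close> are linearly dependent.
\<close>
lemma annihilating_poly:
  assumes v: "v \<in> V"
  obtains p where "p \<noteq> 0" "poly_op p v = (\<lambda>x. 0)"
proof -
  obtain c m where m: "m \<le> card I" "c m \<noteq> 0" and c: "\<forall>p\<in>I. (\<Sum>j\<le>card I. c j * (A ^^ j) v p) = 0"
    using linear_dependence_on_finite_set[OF finite_I, of "\<lambda>j. (A ^^ j) v"] by blast
  define p where "p = (\<Sum>j\<le>card I. monom (c j) j)"
  have sum: "poly_op (\<Sum>j\<in>J. monom (c j) j) v = (\<lambda>x. \<Sum>j\<in>J. c j * (A ^^ j) v x)" if "finite J" for J
    using that by induction (auto simp: poly_op_0 poly_op_add poly_op_monom v)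
  have "coeff p m = c m" using m by (simp add: p_def coeff_sum coeff_monom)
  then have "p \<noteq> 0" using m by auto
  moreover have "poly_op p v = (\<lambda>x. 0)"
  proof (rule zero_on_I)
    show "poly_op p v \<in> V" by (rule poly_op_in[OF v])
    show "poly_op p v q = 0" if "q \<in> I" for q unfolding p_def using c that by (simp add: sum)
  qed
  ultimately show thesis by (rule that)
qed

text \<open>
  Symmetry turns \<open>B ((A - l) u) ((A - l) u)\<close> into \<open>B ((A - l)\<^sup>2 u) u\<close>. So a symmetric operator has no
  generalized eigenvectors.
\<close>
lemma square_kernel:
  assumes u: "u \<in> V" and sq: "poly_op ([:-l, 1:] * [:-l, 1:]) u = (\<lambda>x. 0)"
  shows "poly_op [:-l, 1:] u = (\<lambda>x. 0)"
proof -
  let ?w = "poly_op [:-l, 1:] u"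
  have lin: "poly_op [:-l, 1:] v = (\<lambda>x. (-l) * v x + 1 * A v x)" for v
    by (simp add: poly_op_pCons poly_op_0 A_zero)
  have w: "?w \<in> V" by (rule poly_op_in[OF u])
  have "B ?w ?w = (-l) * B u ?w + B (A u) ?w"
    using B_comb[OF u A_in[OF u] w, of "-l" 1] by (simp add: lin[of u])
  also have "\<dots> = (-l) * B ?w u + B (A ?w) u"
    using A_sym[OF u w] B_sym[OF u w] B_sym[OF u A_in[OF w]] by simp
  also have "\<dots> = B (poly_op [:-l, 1:] ?w) u"
    using B_comb[OF w A_in[OF w] u, of "-l" 1] by (simp add: lin[of ?w])
  also have "poly_op [:-l, 1:] ?w = (\<lambda>x. 0)" using sq by (simp only: poly_op_mult[OF u])
  finally show ?thesis using B_zero[OF u] B_eq_0[OF w] by simp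
qed

text \<open>
  As before, \<open>B ((A - a) u) ((A - a) u) = - b\<^sup>2 * B u u\<close>. So a symmetric operator has no non-real
  eigenvalues.
\<close>
lemma definite_quadratic_kernel:
  assumes u: "u \<in> V" and b: "b \<noteq> 0" and q: "poly_op [:a\<^sup>2 + b\<^sup>2, -2 * a, 1:] u = (\<lambda>x. 0)"
  shows "u = (\<lambda>x. 0)"
proof -
  let ?w = "poly_op [:-a, 1:] u"
  have lin: "poly_op [:-a, 1:] v = (\<lambda>x. (-a) * v x + 1 * A v x)" for v
    by (simp add: poly_op_pCons poly_op_0 A_zero)
  have w: "?w \<in> V" by (rule poly_op_in[OF u])
  have "[:a\<^sup>2 + b\<^sup>2, -2 * a, 1:] = [:-a, 1:] * [:-a, 1:] + smult (b\<^sup>2) 1"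
    by (simp add: power2_eq_square)
  then have "(\<lambda>x. 0) = (\<lambda>x. poly_op [:-a, 1:] ?w x + b\<^sup>2 * poly_op 1 u x)"
    using q by (simp only: poly_op_add[OF u] poly_op_mult[OF u] poly_op_smult[OF u])
  then have eq: "poly_op [:-a, 1:] ?w = (\<lambda>x. - b\<^sup>2 * u x)"
    by (simp add: fun_eq_iff one_pCons poly_op_pCons poly_op_0 A_zero add_eq_0_iff)
  have "B ?w ?w = (-a) * B u ?w + B (A u) ?w"
    using B_comb[OF u A_in[OF u] w, of "-a" 1] by (simp add: lin[of u])
  also have "\<dots> = (-a) * B ?w u + B (A ?w) u"
    using A_sym[OF u w] B_sym[OF u w] B_sym[OF u A_in[OF w]] by simp
  also have "\<dots> = B (poly_op [:-a, 1:] ?w) u"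
    using B_comb[OF w A_in[OF w] u, of "-a" 1] by (simp add: lin[of ?w])
  also have "\<dots> = - b\<^sup>2 * B u u" unfolding eq by (rule B_scale[OF u u])
  finally have *: "B ?w ?w + b\<^sup>2 * B u u = 0" by simp
  have "B v v \<ge> 0" if "v \<in> V" for v
    using B_pos[OF that] B_zero[OF zero_in] by (cases "v = (\<lambda>x. 0)") force+
  then have "b\<^sup>2 * B u u = 0" using * u w
    by (metis add_nonneg_eq_0_iff mult_nonneg_nonneg zero_le_power2)
  then show ?thesis using b B_eq_0[OF u] by simp
qed

definition spectral :: "('x \<Rightarrow> real) \<Rightarrow> bool" where
  "spectral v \<longleftrightarrow> (\<exists>R u. finite R \<and> (\<forall>l\<in>R. u l \<in> eigen l) \<and> v = (\<lambda>x. \<Sum>l\<in>R. u l x))"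

text \<open>
  Induction along the real factorization of \<open>p\<close>. Definite quadratic factors may be dropped. For a linear
  factor \<open>[:-l, 1:]\<close> the vector \<open>(A - l) v\<close> is a sum of eigenvectors by induction; dividing the
  components of eigenvalue \<open>m \<noteq> l\<close> by \<open>m - l\<close> and subtracting them from \<open>v\<close> leaves a vector \<open>v'\<close> with
  \<open>(A - l)\<^sup>2 v' = 0\<close>, which is an eigenvector itself.
\<close>
lemma spectral_if_annihilated:
  "p \<noteq> 0 \<Longrightarrow> v \<in> V \<Longrightarrow> poly_op p v = (\<lambda>x. 0) \<Longrightarrow> spectral v"
proof (induction "degree p" arbitrary: p v rule: less_induct)
  case less
  show ?case
  proof (cases "degree p = 0")
    case True
    then obtain c where c: "p = [:c:]" by (rule degree_eq_zeroE)
    then have "v = (\<lambda>x. 0)" using less.prems by (auto simp: poly_op_pCons poly_op_0 A_zero fun_eq_iff)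
    then show ?thesis unfolding spectral_def by (intro exI[of _ "{}"]) auto
  next
    case False
    then have "degree p > 0" by simp
    then consider (lin) l q where "p = [:-l, 1:] * q"
      | (quad) a b q where "b \<noteq> 0" "p = [:a\<^sup>2 + b\<^sup>2, -2 * a, 1:] * q"
      by (rule real_poly_factor) blast+
    then show ?thesis
    proof cases
      case quad
      have "q \<noteq> 0" using quad less.prems by auto
      have "degree p = 2 + degree q" unfolding quad(2) using \<open>q \<noteq> 0\<close> by (subst degree_mult_eq) auto
      moreover have "poly_op q v = (\<lambda>x. 0)"
      proof (rule definite_quadratic_kernel[OF poly_op_in quad(1)])
        show "poly_op [:a\<^sup>2 + b\<^sup>2, -2 * a, 1:] (poly_op q v) = (\<lambda>x. 0)"
          using less.prems(3) unfolding quad(2) poly_op_mult[OF less.prems(2)] .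
      qed (fact less.prems(2))
      ultimately show ?thesis using less.hyps[of q v] less.prems \<open>q \<noteq> 0\<close> by simp
    next
      case lin
      have "q \<noteq> 0" using lin less.prems by auto
      have dq: "degree q < degree p" unfolding lin using \<open>q \<noteq> 0\<close> by (subst degree_mult_eq) auto
      have op: "poly_op [:-l, 1:] w = (\<lambda>x. A w x - l * w x)" for w
        by (simp add: poly_op_pCons poly_op_0 A_zero)
      define w where "w = poly_op [:-l, 1:] v"
      have "poly_op q w = poly_op (q * [:-l, 1:]) v" unfolding w_def by (rule poly_op_mult[OF less.prems(2), symmetric])
      also have "\<dots> = (\<lambda>x. 0)" using less.prems lin by (simp only: mult.commute)
      finally have "spectral w" using less.hyps[of q w] dq \<open>q \<noteq> 0\<close> poly_op_in[OF less.prems(2)] by (simp add: w_def)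
      then obtain R u where R: "finite R" and u: "\<And>m. m \<in> R \<Longrightarrow> u m \<in> eigen m"
        and wR: "w = (\<lambda>x. \<Sum>m\<in>R. u m x)" unfolding spectral_def by blast
      define S where "S = R - {l}"
      have fS: "finite S" using R by (simp add: S_def)
      have uV: "u m \<in> V" if "m \<in> S" for m using u that eigen_in by (auto simp: S_def)
      define y where "y = (\<lambda>x. \<Sum>m\<in>S. 1 / (m - l) * u m x)"
      have yV: "y \<in> V" unfolding y_def using fS uV by (intro sum_in)
      have Ay: "A y = (\<lambda>x. \<Sum>m\<in>S. 1 / (m - l) * A (u m) x)" unfolding y_def using fS uV by (intro A_sum)
      have opy: "poly_op [:-l, 1:] y = (\<lambda>x. \<Sum>m\<in>S. u m x)"
      proof
        fix x
        have "poly_op [:-l, 1:] y x = (\<Sum>m\<in>S. 1 / (m - l) * A (u m) x - l * (1 / (m - l) * u m x))"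
          unfolding op Ay by (simp add: sum_subtractf sum_distrib_left y_def)
        also have "\<dots> = (\<Sum>m\<in>S. u m x)"
        proof (intro sum.cong refl)
          fix m assume m: "m \<in> S"
          have Au: "A (u m) x = m * u m x" using eigen_A[OF u, of m] m by (simp add: S_def)
          have ne: "m - l \<noteq> 0" using m by (simp add: S_def)
          show "1 / (m - l) * A (u m) x - l * (1 / (m - l) * u m x) = u m x"
            unfolding Au using shift_quotient[OF ne, of l "u m x"] by simp
        qed
        finally show "poly_op [:-l, 1:] y x = (\<Sum>m\<in>S. u m x)" .
      qed
      define v' where "v' = (\<lambda>x. 1 * v x + (-1) * y x)"
      have v'V: "v' \<in> V" unfolding v'_def by (intro comb_in less.prems yV)
      have "poly_op [:-l, 1:] v' = (\<lambda>x. w x - (\<Sum>m\<in>S. u m x))"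
      proof
        fix x
        have "(\<Sum>m\<in>S. u m x) = A y x - l * y x" using fun_cong[OF opy, of x] by (simp add: op)
        moreover have "A v' x = 1 * A v x + (-1) * A y x"
          unfolding v'_def A_comb[OF less.prems(2) yV] ..
        ultimately show "poly_op [:-l, 1:] v' x = w x - (\<Sum>m\<in>S. u m x)"
          by (simp add: op w_def v'_def algebra_simps)
      qed
      also have "\<dots> = (\<lambda>x. if l \<in> R then u l x else 0)"
        unfolding wR S_def using R by (auto simp: sum_diff1)
      also have "\<dots> \<in> eigen l" using u zero_eigen by (cases "l \<in> R") auto
      finally have e: "poly_op [:-l, 1:] v' \<in> eigen l" .
      have "poly_op [:-l, 1:] v' = (\<lambda>x. 0)"
        by (intro square_kernel v'V, subst poly_op_mult[OF v'V], subst op) (simp add: eigen_A[OF e])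
      then have v'e: "v' \<in> eigen l" using v'V by (simp add: op eigenspace_def fun_eq_iff)
      define U where "U = (\<lambda>m. if m = l then v' else (\<lambda>x. 1 / (m - l) * u m x))"
      have "U m \<in> eigen m" if "m \<in> insert l S" for m
        using v'e that eigen_comb[OF u u, of m "1 / (m - l)" 0] by (auto simp: U_def S_def)
      moreover have "v = (\<lambda>x. \<Sum>m\<in>insert l S. U m x)"
      proof
        fix x
        have "l \<notin> S" by (simp add: S_def)
        then have "(\<Sum>m\<in>insert l S. U m x) = U l x + (\<Sum>m\<in>S. U m x)" using fS by simp
        also have "(\<Sum>m\<in>S. U m x) = y x" unfolding y_def by (intro sum.cong) (auto simp: U_def S_def)
        finally show "v x = (\<Sum>m\<in>insert l S. U m x)" by (simp add: U_def v'_def)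
      qed
      ultimately show ?thesis unfolding spectral_def using fS by blast
    qed
  qed
qed

lemma eigenprojection_eqI:
  assumes v: "v \<in> V" and w: "w \<in> eigen l" and orth: "\<And>z. z \<in> eigen l \<Longrightarrow> B v z = B w z"
  shows "eigenprojection V B A l v = w"
  unfolding eigenprojection_def
proof (rule the_equality)
  have diff: "B (\<lambda>x. v x - w' x) z = B v z - B w' z" if "w' \<in> V" "z \<in> V" for w' z
    using B_comb[OF v that, of 1 "-1"] by simp
  show "w \<in> eigen l \<and> (\<forall>z\<in>eigen l. B (\<lambda>x. v x - w x) z = 0)"
    using w orth diff eigen_in by auto
  fix w' assume w': "w' \<in> eigen l \<and> (\<forall>z\<in>eigen l. B (\<lambda>x. v x - w' x) z = 0)"
  define d where "d = (\<lambda>x. 1 * w' x + (-1) * w x)"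
  have d: "d \<in> eigen l" unfolding d_def using w' w by (intro eigen_comb) auto
  have "B w' d = B v d" using w' d diff[of w' d] eigen_in by auto
  moreover have "B w d = B v d" using orth[OF d] by simp
  ultimately have "B d d = 0"
    unfolding d_def using B_comb[of w' w d 1 "-1"] w' w d eigen_in by (auto simp: d_def)
  then have "d = (\<lambda>x. 0)" using B_eq_0 d eigen_in by blast
  then show "w' = w" by (auto simp: d_def fun_eq_iff)
qed

lemma spectral_decomposition:
  assumes v: "v \<in> V"
  shows "\<And>l. l \<in> \<Lambda> \<Longrightarrow> eigenprojection V B A l v \<in> eigen l"
    and "v = (\<lambda>x. \<Sum>l\<in>\<Lambda>. eigenprojection V B A l v x)"
proof -
  obtain p where "p \<noteq> 0" "poly_op p v = (\<lambda>x. 0)" using annihilating_poly[OF v] by blast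
  then have "spectral v" using v by (intro spectral_if_annihilated)
  then obtain R u where R: "finite R" and u: "\<And>m. m \<in> R \<Longrightarrow> u m \<in> eigen m"
    and vR: "v = (\<lambda>x. \<Sum>m\<in>R. u m x)" unfolding spectral_def by blast
  define U where "U m = (if m \<in> R then u m else (\<lambda>x. 0))" for m
  have U: "U m \<in> eigen m" for m using u zero_eigen by (auto simp: U_def)
  have proj: "eigenprojection V B A l v = U l" for l
  proof (rule eigenprojection_eqI[OF v U])
    fix z assume z: "z \<in> eigen l"
    have "B v z = B (\<lambda>x. \<Sum>m\<in>R. 1 * u m x) z" using vR by simp
    also have "\<dots> = (\<Sum>m\<in>R. 1 * B (u m) z)" using R u z eigen_in by (intro B_sum) blast+
    also have "\<dots> = (\<Sum>m\<in>R. if m = l then B (u l) z else 0)"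
      using eigen_orthogonal[OF u z] by (intro sum.cong) auto
    also have "\<dots> = B (U l) z" using R B_zero[OF eigen_in[OF z]] by (simp add: U_def)
    finally show "B v z = B (U l) z" .
  qed
  show "eigenprojection V B A l v \<in> eigen l" for l unfolding proj by (rule U)
  have "v x = (\<Sum>l\<in>\<Lambda>. U l x)" for x
  proof -
    have "v x = (\<Sum>m\<in>R. U m x)" by (simp add: vR U_def)
    also have "\<dots> = (\<Sum>m\<in>R \<inter> \<Lambda>. U m x)"
    proof (rule sum.mono_neutral_right[OF R])
      show "\<forall>m\<in>R - R \<inter> \<Lambda>. U m x = 0"
        using U unfolding eigenvalues_def by (metis (mono_tags, lifting) DiffD1 DiffD2 IntI mem_Collect_eq)
    qed auto
    also have "\<dots> = (\<Sum>m\<in>\<Lambda>. U m x)"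
      using finite_eigenvalues by (intro sum.mono_neutral_left) (auto simp: U_def)
    finally show ?thesis .
  qed
  then show "v = (\<lambda>x. \<Sum>l\<in>\<Lambda>. eigenprojection V B A l v x)" unfolding proj by (rule ext)
qed

end

section \<open>Positivity of resolvents and of operator functions\<close>

text \<open>
  The finite element setting reduced to what the positivity argument uses: a diagonal inner product, a
  nodal basis, a definite operator with an M-matrix, and the passage from nodal to pointwise
  non-negativity.
\<close>
locale lumped_operator_space = symmetric_operator V I B A
  for V :: "('x \<Rightarrow> real) set" and I B A +
  fixes m :: "'x \<Rightarrow> real" and \<phi> :: "'x \<Rightarrow> 'x \<Rightarrow> real"
  assumes B_lumped: "u \<in> V \<Longrightarrow> v \<in> V \<Longrightarrow> B u v = (\<Sum>p\<in>I. m p * u p * v p)"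
    and m_pos: "p \<in> I \<Longrightarrow> m p > 0"
    and \<phi>_in: "p \<in> I \<Longrightarrow> \<phi> p \<in> V"
    and \<phi>_nodal: "p \<in> I \<Longrightarrow> q \<in> I \<Longrightarrow> \<phi> p q = (if q = p then 1 else 0)"
    and nonneg_if_nodal: "v \<in> V \<Longrightarrow> (\<And>p. p \<in> I \<Longrightarrow> v p \<ge> 0) \<Longrightarrow> v x \<ge> 0"
    and A_pos: "v \<in> V \<Longrightarrow> v \<noteq> (\<lambda>x. 0) \<Longrightarrow> B (A v) v > 0"
    and off_diagonal: "p \<in> I \<Longrightarrow> q \<in> I \<Longrightarrow> p \<noteq> q \<Longrightarrow> B (A (\<phi> p)) (\<phi> q) \<le> 0"
begin

lemma eigenvalue_pos: "l \<in> \<Lambda> \<Longrightarrow> l > 0"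
proof -
  assume "l \<in> \<Lambda>"
  then obtain u where u: "u \<in> eigen l" "u \<noteq> (\<lambda>x. 0)" by (auto simp: eigenvalues_def)
  have "B (A u) u = l * B u u" unfolding eigen_A[OF u(1)] by (rule B_scale) (use u eigen_in in auto)
  then show "l > 0" using A_pos[of u] B_pos[of u] u eigen_in by (auto simp: zero_less_mult_iff)
qed

text \<open>
  Test with the nodal negative part \<open>neg\<close> of \<open>w = pos - neg\<close>. The term \<open>B (A pos) neg\<close> is non-positive
  by the M-matrix property, \<open>B (A neg) neg\<close> is non-negative by definiteness, and \<open>B w neg = - B neg neg\<close> since the
  inner product is diagonal. So \<open>B neg neg \<le> 0\<close>.
\<close>
lemma minimum_principle:
  assumes w: "w \<in> V" and s: "s > 0" and nonneg: "\<And>p. p \<in> I \<Longrightarrow> A w p + s * w p \<ge> 0" and p: "p \<in> I"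
  shows "w p \<ge> 0"
proof -
  define neg where "neg = (\<lambda>x. \<Sum>p\<in>I. max (- w p) 0 * \<phi> p x)"
  define pos where "pos = (\<lambda>x. \<Sum>p\<in>I. max (w p) 0 * \<phi> p x)"
  have in_V: "neg \<in> V" "pos \<in> V" unfolding neg_def pos_def using finite_I \<phi>_in by (auto intro!: sum_in)
  have nodal: "(\<Sum>p\<in>I. c p * \<phi> p q) = c q" if "q \<in> I" for c q
  proof -
    have "(\<Sum>p\<in>I. c p * \<phi> p q) = (\<Sum>p\<in>I. if p = q then c q else 0)"
      using that by (intro sum.cong) (auto simp: \<phi>_nodal)
    then show ?thesis using finite_I that by simp
  qed
  have neg: "neg q = max (- w q) 0" and pos: "pos q = max (w q) 0" if "q \<in> I" for q
    using nodal[OF that] by (auto simp: neg_def pos_def)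
  have "(\<lambda>x. 1 * neg x + (-1) * pos x) \<in> V" by (intro comb_in in_V)
  from comb_in[OF w this, of 1 1]
  have "(\<lambda>x. w x + (neg x - pos x)) \<in> V" by simp
  then have "(\<lambda>x. w x + (neg x - pos x)) = (\<lambda>x. 0)"
    by (rule zero_on_I) (auto simp: neg pos max_def)
  then have split: "w = (\<lambda>x. 1 * pos x + (-1) * neg x)" by (auto simp: fun_eq_iff algebra_simps add_eq_0_iff)
  have "B (A pos) neg = (\<Sum>p\<in>I. max (w p) 0 * B (A (\<phi> p)) neg)"
    unfolding pos_def using finite_I \<phi>_in A_in in_V by (subst A_sum) (auto intro!: B_sum)
  also have "\<dots> \<le> 0"
  proof (rule sum_nonpos)
    fix p assume p: "p \<in> I"
    have "B (A (\<phi> p)) neg = B neg (A (\<phi> p))" using p \<phi>_in A_in in_V by (intro B_sym) auto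
    also have "\<dots> = (\<Sum>q\<in>I. max (- w q) 0 * B (\<phi> q) (A (\<phi> p)))"
      unfolding neg_def using finite_I \<phi>_in A_in p by (intro B_sum) auto
    finally have "max (w p) 0 * B (A (\<phi> p)) neg = (\<Sum>q\<in>I. max (w p) 0 * (max (- w q) 0 * B (\<phi> q) (A (\<phi> p))))"
      by (simp add: sum_distrib_left)
    also have "\<dots> \<le> 0"
    proof (rule sum_nonpos)
      fix q assume q: "q \<in> I"
      show "max (w p) 0 * (max (- w q) 0 * B (\<phi> q) (A (\<phi> p))) \<le> 0"
      proof (cases "p = q")
        case False
        have "B (\<phi> q) (A (\<phi> p)) = B (A (\<phi> p)) (\<phi> q)" using p q \<phi>_in A_in by (intro B_sym) auto
        then have "B (\<phi> q) (A (\<phi> p)) \<le> 0" using off_diagonal[OF p q False] by simp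
        then show ?thesis by (intro mult_nonneg_nonpos) auto
      qed (auto simp: max_def)
    qed
    finally show "max (w p) 0 * B (A (\<phi> p)) neg \<le> 0" .
  qed
  finally have 1: "B (A pos) neg \<le> 0" .
  have 2: "B (A neg) neg \<ge> 0"
  proof (cases "neg = (\<lambda>x. 0)")
    case True
    then show ?thesis using B_zero[OF zero_in] by (simp add: A_zero)
  next
    case False
    then show ?thesis using A_pos[OF in_V(1)] by simp
  qed
  have "A w = (\<lambda>x. 1 * A pos x + (-1) * A neg x)"
    by (subst split) (rule A_comb[OF in_V(2,1)])
  then have "B (A w) neg = 1 * B (A pos) neg + (-1) * B (A neg) neg"
    using B_comb[OF A_in[OF in_V(2)] A_in[OF in_V(1)] in_V(1), of 1 "-1"] by metis
  then have 3: "B (A w) neg \<le> 0" using 1 2 by simp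
  have "0 \<le> (\<Sum>p\<in>I. m p * (A w p + s * w p) * neg p)"
    using m_pos nonneg by (intro sum_nonneg mult_nonneg_nonneg) (auto simp: neg less_imp_le)
  also have "\<dots> = B (A w) neg + s * B w neg"
    using w in_V A_in by (simp add: B_lumped sum_distrib_left algebra_simps sum.distrib)
  also have "B w neg = - (\<Sum>p\<in>I. m p * (neg p)\<^sup>2)"
    unfolding B_lumped[OF w in_V(1)] sum_negf[symmetric]
    by (intro sum.cong) (auto simp: neg max_def power2_eq_square)
  finally have "s * (\<Sum>p\<in>I. m p * (neg p)\<^sup>2) \<le> 0" using 3 by simp
  then have "(\<Sum>p\<in>I. m p * (neg p)\<^sup>2) \<le> 0" using s by (simp add: mult_le_0_iff)
  moreover have "(\<Sum>p\<in>I. m p * (neg p)\<^sup>2) \<ge> 0"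
    using m_pos by (intro sum_nonneg mult_nonneg_nonneg) (auto simp: less_imp_le)
  ultimately have "(\<Sum>p\<in>I. m p * (neg p)\<^sup>2) = 0" by simp
  then have "m p * (neg p)\<^sup>2 = 0"
    using finite_I m_pos p by (subst (asm) sum_nonneg_eq_0_iff) (auto simp: less_imp_le)
  then show ?thesis using m_pos[OF p] neg[OF p] by (auto simp: max_def split: if_splits)
qed

lemma resolvent_nonneg:
  assumes v: "v \<in> V" and nonneg: "\<And>p. p \<in> I \<Longrightarrow> v p \<ge> 0" and s: "s > 0"
  shows "(\<Sum>l\<in>\<Lambda>. eigenprojection V B A l v x / (l + s)) \<ge> 0"
proof -
  let ?P = "\<lambda>l. eigenprojection V B A l v"
  define w where "w = (\<lambda>x. \<Sum>l\<in>\<Lambda>. 1 / (l + s) * ?P l x)"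
  have P: "?P l \<in> eigen l" if "l \<in> \<Lambda>" for l using spectral_decomposition(1)[OF v that] .
  have PV: "?P l \<in> V" if "l \<in> \<Lambda>" for l using P[OF that] by (rule eigen_in)
  have wV: "w \<in> V" unfolding w_def using finite_eigenvalues PV by (intro sum_in)
  have Aw: "A w = (\<lambda>x. \<Sum>l\<in>\<Lambda>. 1 / (l + s) * A (?P l) x)"
    unfolding w_def using finite_eigenvalues PV by (intro A_sum)
  have "A w p + s * w p = v p" for p
  proof -
    have "A w p + s * w p = (\<Sum>l\<in>\<Lambda>. 1 / (l + s) * A (?P l) p + s * (1 / (l + s) * ?P l p))"
      unfolding Aw by (simp add: w_def sum.distrib sum_distrib_left)
    also have "\<dots> = (\<Sum>l\<in>\<Lambda>. ?P l p)"
    proof (intro sum.cong refl)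
      fix l assume l: "l \<in> \<Lambda>"
      have ne: "l + s \<noteq> 0" using eigenvalue_pos[OF l] s by simp
      have AP: "A (?P l) p = l * ?P l p" using fun_cong[OF eigen_A[OF P[OF l]]] .
      show "1 / (l + s) * A (?P l) p + s * (1 / (l + s) * ?P l p) = ?P l p"
        unfolding AP using shift_quotient[OF ne, of "- s" "?P l p"] by simp
    qed
    also have "\<dots> = v p" using spectral_decomposition(2)[OF v] by (simp add: fun_eq_iff)
    finally show ?thesis .
  qed
  then have "w p \<ge> 0" if "p \<in> I" for p using minimum_principle[OF wV s _ that] nonneg by simp
  then have "w x \<ge> 0" by (rule nonneg_if_nodal[OF wV])
  then show ?thesis by (simp add: w_def)
qed

text \<open>
  The Stieltjes representation with exponent \<open>1 - \<alpha>\<close> writes \<open>C * l powr (-\<alpha>)\<close> as the integral of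
  \<open>s powr (-\<alpha>) / (l + s)\<close>.
\<close>
lemma operator_function_powr_nonneg:
  assumes v: "v \<in> V" and nonneg: "\<And>p. p \<in> I \<Longrightarrow> v p \<ge> 0" and \<alpha>: "0 < \<alpha>" "\<alpha> < 1"
  shows "operator_function V B A (\<lambda>l. l powr (- \<alpha>)) v x \<ge> 0"
proof -
  let ?P = "\<lambda>l. eigenprojection V B A l v x"
  obtain C where C: "C > 0"
    and int: "\<And>t. t > 0 \<Longrightarrow> has_bochner_integral lborel (stieltjes_kernel (1 - \<alpha>) t) (C * t powr (1 - \<alpha> - 1))"
    using stieltjes_integral[of "1 - \<alpha>"] \<alpha> by auto
  have "has_bochner_integral lborel (\<lambda>s. \<Sum>l\<in>\<Lambda>. ?P l * stieltjes_kernel (1 - \<alpha>) l s)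
     (\<Sum>l\<in>\<Lambda>. ?P l * (C * l powr (1 - \<alpha> - 1)))"
    using int eigenvalue_pos by (intro has_bochner_integral_sum has_bochner_integral_mult_right) auto
  moreover have "(\<Sum>l\<in>\<Lambda>. ?P l * (C * l powr (1 - \<alpha> - 1))) = C * operator_function V B A (\<lambda>l. l powr (- \<alpha>)) v x"
    by (simp add: operator_function_def sum_distrib_left mult_ac)
  ultimately have "C * operator_function V B A (\<lambda>l. l powr (- \<alpha>)) v x =
      (\<integral>s. (\<Sum>l\<in>\<Lambda>. ?P l * stieltjes_kernel (1 - \<alpha>) l s) \<partial>lborel)"
    by (simp add: has_bochner_integral_iff)
  also have "\<dots> \<ge> 0"
  proof (intro integral_nonneg_AE AE_I2)
    fix s :: real
    show "0 \<le> (\<Sum>l\<in>\<Lambda>. ?P l * stieltjes_kernel (1 - \<alpha>) l s)"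
    proof (cases "s > 0")
      case True
      have "(\<Sum>l\<in>\<Lambda>. ?P l * stieltjes_kernel (1 - \<alpha>) l s) = s powr (- \<alpha>) * (\<Sum>l\<in>\<Lambda>. ?P l / (l + s))"
        using True by (simp add: stieltjes_kernel_def sum_distrib_left mult_ac)
      also have "\<dots> \<ge> 0" using resolvent_nonneg[OF v nonneg True] by simp
      finally show ?thesis .
    qed (simp add: stieltjes_kernel_def)
  qed
  finally show ?thesis using C by (simp add: zero_le_mult_iff)
qed

text \<open>
  With \<open>t = l1 / l\<close> one has \<open>t / (t - z) = s / (l + s)\<close> for \<open>s = - l1 / z > 0\<close>, a multiple of a
  resolvent.
\<close>
lemma operator_function_partial_fractions_nonneg:
  assumes v: "v \<in> V" and nonneg: "\<And>p. p \<in> I \<Longrightarrow> v p \<ge> 0" and "l1 > 0"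
    and Z: "\<And>z. z \<in> Z \<Longrightarrow> z < 0" and "c \<ge> 0" and \<beta>: "\<And>z. z \<in> Z \<Longrightarrow> \<beta> z \<ge> 0"
    and r: "\<And>t. t \<ge> 0 \<Longrightarrow> r t = c + (\<Sum>z\<in>Z. \<beta> z * (t / (t - z)))"
  shows "operator_function V B A (\<lambda>l. r (l1 * inverse l)) v x \<ge> 0"
proof -
  let ?P = "\<lambda>l. eigenprojection V B A l v x"
  have "r (l1 * inverse l) = c + (\<Sum>z\<in>Z. \<beta> z * (l1 / -z) / (l + l1 / -z))" if l: "l \<in> \<Lambda>" for l
  proof -
    have l0: "l > 0" using eigenvalue_pos[OF l] .
    have "r (l1 * inverse l) = c + (\<Sum>z\<in>Z. \<beta> z * (l1 * inverse l / (l1 * inverse l - z)))"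
      using l0 \<open>l1 > 0\<close> by (intro r) auto
    also have "(\<Sum>z\<in>Z. \<beta> z * (l1 * inverse l / (l1 * inverse l - z))) = (\<Sum>z\<in>Z. \<beta> z * (l1 / -z) / (l + l1 / -z))"
    proof (intro sum.cong refl)
      fix z assume z: "z \<in> Z"
      have "l1 * inverse l > 0" using l0 \<open>l1 > 0\<close> by simp
      moreover have "l1 / -z > 0" by (rule divide_pos_pos[OF \<open>l1 > 0\<close>]) (use Z[OF z] in simp)
      ultimately have ne: "l1 * inverse l - z \<noteq> 0" "l + l1 / -z \<noteq> 0"
        using l0 Z[OF z] by linarith+
      have "(l1 / -z) * (l1 * inverse l - z) = l1 * inverse l * (l + l1 / -z)"
        using l0 Z[OF z] by (simp add: field_simps)
      then have "l1 * inverse l / (l1 * inverse l - z) = (l1 / -z) / (l + l1 / -z)"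
        unfolding frac_eq_eq[OF ne] by (rule sym)
      then show "\<beta> z * (l1 * inverse l / (l1 * inverse l - z)) = \<beta> z * (l1 / -z) / (l + l1 / -z)"
        by (simp only: times_divide_eq_right)
    qed
    finally show ?thesis .
  qed
  then have "operator_function V B A (\<lambda>l. r (l1 * inverse l)) v x =
      (\<Sum>l\<in>\<Lambda>. (c + (\<Sum>z\<in>Z. \<beta> z * (l1 / -z) / (l + l1 / -z))) * ?P l)"
    unfolding operator_function_def by (intro sum.cong) auto
  also have "\<dots> = c * (\<Sum>l\<in>\<Lambda>. ?P l) + (\<Sum>l\<in>\<Lambda>. \<Sum>z\<in>Z. \<beta> z * (l1 / -z) * (?P l / (l + l1 / -z)))"
    by (simp add: algebra_simps sum.distrib sum_distrib_left sum_distrib_right)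
  also have "(\<Sum>l\<in>\<Lambda>. \<Sum>z\<in>Z. \<beta> z * (l1 / -z) * (?P l / (l + l1 / -z))) =
      (\<Sum>z\<in>Z. \<beta> z * (l1 / -z) * (\<Sum>l\<in>\<Lambda>. ?P l / (l + l1 / -z)))"
    by (subst sum.swap) (simp only: sum_distrib_left)
  also have "(\<Sum>l\<in>\<Lambda>. ?P l) = v x" using spectral_decomposition(2)[OF v] by (simp add: fun_eq_iff)
  also have "c * v x + (\<Sum>z\<in>Z. \<beta> z * (l1 / -z) * (\<Sum>l\<in>\<Lambda>. ?P l / (l + l1 / -z))) \<ge> 0"
  proof -
    have "v x \<ge> 0" by (rule nonneg_if_nodal[OF v nonneg])
    moreover have "\<beta> z * (l1 / -z) * (\<Sum>l\<in>\<Lambda>. ?P l / (l + l1 / -z)) \<ge> 0" if z: "z \<in> Z" for z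
    proof -
      have pos: "l1 / -z > 0" by (rule divide_pos_pos[OF \<open>l1 > 0\<close>]) (use Z[OF z] in simp)
      show ?thesis
        by (rule mult_nonneg_nonneg[OF mult_nonneg_nonneg[OF \<beta>[OF z] less_imp_le[OF pos]]
              resolvent_nonneg[OF v nonneg pos]])
    qed
    ultimately show ?thesis using \<open>c \<ge> 0\<close> by (intro add_nonneg_nonneg[OF mult_nonneg_nonneg] sum_nonneg)
  qed
  finally show ?thesis .
qed

end

section \<open>Finite element functions on a simplicial mesh\<close>

lemma affine_nonneg_on_hull:
  fixes g :: "'a::euclidean_space"
  assumes "\<And>P. P \<in> C \<Longrightarrow> g \<bullet> P + b \<ge> 0" "x \<in> convex hull C"
  shows "g \<bullet> x + b \<ge> 0"
proof -
  have "convex hull C \<subseteq> {x. g \<bullet> x \<ge> -b}"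
  proof (rule hull_minimal)
    show "C \<subseteq> {x. g \<bullet> x \<ge> -b}"
    proof
      fix P assume "P \<in> C"
      from assms(1)[OF this] show "P \<in> {x. g \<bullet> x \<ge> -b}" by simp
    qed
  qed (rule convex_halfspace_ge)
  then have "g \<bullet> x \<ge> -b" using assms(2) by blast
  then show ?thesis by simp
qed

lemma affine_zero_on_hull:
  fixes g :: "'a::euclidean_space"
  assumes "\<And>P. P \<in> C \<Longrightarrow> g \<bullet> P + b = 0" "x \<in> convex hull C"
  shows "g \<bullet> x + b = 0"
proof -
  have "g \<bullet> x + b \<ge> 0" by (rule affine_nonneg_on_hull[OF _ assms(2)]) (simp add: assms(1))
  moreover have "(-g) \<bullet> x + (-b) \<ge> 0"
  proof (rule affine_nonneg_on_hull[OF _ assms(2)])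
    fix P assume "P \<in> C"
    from assms(1)[OF this] show "(-g) \<bullet> P + (-b) \<ge> 0" by simp
  qed
  ultimately show ?thesis by simp
qed

lemma affine_interpolation:
  fixes F :: "'a::euclidean_space \<Rightarrow> real"
  assumes "\<not> affine_dependent C"
  shows "\<exists>g b. \<forall>P\<in>C. g \<bullet> P + b = F P"
proof (cases "C = {}")
  case False
  then obtain a where a: "a \<in> C" by blast
  have "independent ((\<lambda>x. - a + x) ` (C - {a}))"
    using affine_dependent_iff_dependent2[OF a] assms by simp
  from linear_independent_extend[OF this, of "\<lambda>y. F (a + y) - F a"] obtain L where L: "linear L"
    "\<forall>x\<in>(\<lambda>x. - a + x) ` (C - {a}). L x = F (a + x) - F a" by blast
  define g where "g = adjoint L (1::real)"
  have g: "g \<bullet> x = L x" for x using adjoint_works[OF L(1), of x 1] by (simp add: g_def inner_commute)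
  have "g \<bullet> P + (F a - g \<bullet> a) = F P" if P: "P \<in> C" for P
  proof (cases "P = a")
    case False
    then have "L (- a + P) = F (a + (- a + P)) - F a" using L(2) P by blast
    then have "g \<bullet> (P - a) = F P - F a" by (simp add: g)
    then show ?thesis by (simp add: inner_diff_right)
  qed simp
  then show ?thesis by blast
qed simp

lemma GDERIV_unique:
  fixes v :: "'a::real_inner \<Rightarrow> real"
  assumes "GDERIV v x :> g" "GDERIV v x :> g'"
  shows "g = g'"
proof -
  have "(\<lambda>h. h \<bullet> g) = (\<lambda>h. h \<bullet> g')" using has_derivative_unique assms by (auto simp: gderiv_def)
  then have "h \<bullet> g = h \<bullet> g'" for h by meson
  then show ?thesis by (metis vector_eq_ldot inner_commute)
qed

lemma gradient_affine:
  fixes v :: "real^'d \<Rightarrow> real"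
  assumes "\<And>x. x \<in> S \<Longrightarrow> v x = g \<bullet> x + b" "x \<in> interior S"
  shows "gradient v x = g"
proof -
  have "((\<lambda>x. g \<bullet> x + b) has_derivative (\<lambda>h. h \<bullet> g)) (at x)"
    by (auto intro!: derivative_eq_intros simp: inner_commute)
  then have "(v has_derivative (\<lambda>h. h \<bullet> g)) (at x)"
    by (rule has_derivative_transform_within_open[OF _ open_interior assms(2)])
       (use assms(1) interior_subset in fastforce)
  then have "GDERIV v x :> g" by (simp add: gderiv_def)
  then show ?thesis unfolding gradient_def using GDERIV_unique by (intro the_equality)
qed

locale fe_mesh =
  fixes \<Omega> :: "(real^'d) set" and T :: "(real^'d) set set"
  assumes domain: "bounded_domain \<Omega>" and mesh: "simplicial_mesh \<Omega> T"
begin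

lemma open_\<Omega>: "open \<Omega>" and bounded_\<Omega>: "bounded \<Omega>" and \<Omega>_ne: "\<Omega> \<noteq> {}" and connected_\<Omega>: "connected \<Omega>"
  using domain by (auto simp: bounded_domain_def)

lemmas mesh_conditions = mesh[unfolded simplicial_mesh_def triangulation_def]

lemma finite_T: "finite T"
  by (rule mesh_conditions[THEN conjunct1, THEN conjunct1])

lemma common_face:
  assumes "\<tau> \<in> T" "\<tau>' \<in> T"
  shows "\<tau> \<inter> \<tau>' face_of \<tau>" "\<tau> \<inter> \<tau>' face_of \<tau>'"
proof -
  have face: "T1 \<inter> T2 face_of T1" if "T1 \<in> T" "T2 \<in> T" for T1 T2
    using mesh_conditions[THEN conjunct1, THEN conjunct2, THEN conjunct2] that by simp
  show "\<tau> \<inter> \<tau>' face_of \<tau>" using face[OF assms] .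
  show "\<tau> \<inter> \<tau>' face_of \<tau>'" using face[OF assms(2,1)] by (simp only: Int_commute)
qed

lemma simplex_T: "\<tau> \<in> T \<Longrightarrow> int CARD('d) simplex \<tau>"
  by (rule bspec[OF mesh_conditions[THEN conjunct2, THEN conjunct1]])

lemma cover: "\<Union>T = closure \<Omega>"
  by (rule mesh_conditions[THEN conjunct2, THEN conjunct2, THEN conjunct1])

lemma frontier_faces: "frontier \<Omega> = \<Union>{F. F \<subseteq> frontier \<Omega> \<and> (\<exists>\<tau>\<in>T. F face_of \<tau>)}"
  by (rule mesh_conditions[THEN conjunct2, THEN conjunct2, THEN conjunct2])

lemma closure_diff: "x \<in> closure \<Omega> \<Longrightarrow> x \<notin> \<Omega> \<Longrightarrow> x \<in> frontier \<Omega>"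
  using open_\<Omega> by (simp add: frontier_def interior_open)

lemma frontier_not_in: "x \<in> frontier \<Omega> \<Longrightarrow> x \<notin> \<Omega>"
  using open_\<Omega> by (simp add: frontier_def interior_open)

lemma simplex_vertices:
  assumes "\<tau> \<in> T"
  shows "\<not> affine_dependent (vertices \<tau>)" "card (vertices \<tau>) = Suc CARD('d)" "convex hull (vertices \<tau>) = \<tau>"
proof -
  obtain C where C: "\<not> affine_dependent C" "int (card C) = int CARD('d) + 1" "\<tau> = convex hull C"
    using simplex_T[OF assms] unfolding simplex_def by blast
  have "vertices \<tau> = C"
    unfolding vertices_def C(3) using extreme_point_of_convex_hull_affine_independent[OF C(1)] by auto
  then show "\<not> affine_dependent (vertices \<tau>)" "card (vertices \<tau>) = Suc CARD('d)" "convex hull (vertices \<tau>) = \<tau>"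
    using C by auto
qed

lemma finite_vertices: "\<tau> \<in> T \<Longrightarrow> finite (vertices \<tau>)"
  using simplex_vertices(1) aff_independent_finite by blast

lemma vertices_subset: "\<tau> \<in> T \<Longrightarrow> vertices \<tau> \<subseteq> \<tau>"
  using simplex_vertices(3) hull_subset by metis

lemma convex_T: "\<tau> \<in> T \<Longrightarrow> convex \<tau>" and compact_T: "\<tau> \<in> T \<Longrightarrow> compact \<tau>"
  using simplex_T convex_simplex compact_simplex by blast+

lemma interior_ne: "\<tau> \<in> T \<Longrightarrow> interior \<tau> \<noteq> {}"
  using interior_convex_hull_eq_empty[of "vertices \<tau>"] simplex_vertices[of \<tau>] by simp

lemma interior_disjoint:
  assumes "\<tau> \<in> T" "\<tau>' \<in> T" "x \<in> interior \<tau>" "x \<in> interior \<tau>'"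
  shows "\<tau> = \<tau>'"
proof -
  have x: "x \<in> \<tau> \<inter> \<tau>'" using assms interior_subset by blast
  have "\<tau> \<inter> \<tau>' = \<tau>" using face_of_disjoint_interior[OF common_face(1)[OF assms(1,2)]] x assms(3) by blast
  moreover have "\<tau> \<inter> \<tau>' = \<tau>'" using face_of_disjoint_interior[OF common_face(2)[OF assms(1,2)]] x assms(4) by blast
  ultimately show ?thesis by simp
qed

abbreviation "nodes \<equiv> interior_nodes \<Omega> T"
abbreviation "V \<equiv> fe_space \<Omega> T"

lemma finite_nodes: "finite nodes"
  unfolding interior_nodes_def using finite_T finite_vertices by auto

lemma node_if_vertex: "\<tau> \<in> T \<Longrightarrow> P \<in> vertices \<tau> \<Longrightarrow> P \<in> \<Omega> \<Longrightarrow> P \<in> nodes"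
  by (auto simp: interior_nodes_def)

lemma fe_affine: "v \<in> V \<Longrightarrow> \<tau> \<in> T \<Longrightarrow> \<exists>g b. \<forall>x\<in>\<tau>. v x = g \<bullet> x + b"
  by (auto simp: fe_space_def)

lemma fe_outside: "v \<in> V \<Longrightarrow> x \<notin> \<Omega> \<Longrightarrow> v x = 0"
  by (auto simp: fe_space_def)

lemma fe_nonneg:
  assumes v: "v \<in> V" and nonneg: "\<And>P. P \<in> nodes \<Longrightarrow> v P \<ge> 0"
  shows "v x \<ge> 0"
proof (cases "x \<in> \<Omega>")
  case True
  then have "x \<in> closure \<Omega>" using closure_subset by blast
  then obtain \<tau> where \<tau>: "\<tau> \<in> T" "x \<in> \<tau>" using cover by blast
  obtain g b where gb: "\<And>x. x \<in> \<tau> \<Longrightarrow> v x = g \<bullet> x + b" using fe_affine[OF v \<tau>(1)] by blast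
  have "g \<bullet> P + b \<ge> 0" if P: "P \<in> vertices \<tau>" for P
  proof -
    have "v P \<ge> 0" using nonneg node_if_vertex[OF \<tau>(1) P] fe_outside[OF v, of P] by (cases "P \<in> \<Omega>") auto
    then show ?thesis using gb[of P] vertices_subset[OF \<tau>(1)] P by auto
  qed
  moreover have "x \<in> convex hull (vertices \<tau>)" unfolding simplex_vertices(3)[OF \<tau>(1)] by (rule \<tau>(2))
  ultimately have "g \<bullet> x + b \<ge> 0" by (rule affine_nonneg_on_hull)
  then show ?thesis using gb \<tau> by simp
qed (simp add: fe_outside[OF v])

lemma fe_comb:
  assumes "u \<in> V" "v \<in> V"
  shows "(\<lambda>x. a * u x + b * v x) \<in> V"
proof -
  have "\<exists>g c. \<forall>x\<in>\<tau>. a * u x + b * v x = g \<bullet> x + c" if \<tau>: "\<tau> \<in> T" for \<tau>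
  proof -
    obtain g c g' c' where "\<forall>x\<in>\<tau>. u x = g \<bullet> x + c" "\<forall>x\<in>\<tau>. v x = g' \<bullet> x + c'"
      using fe_affine[OF _ \<tau>] assms by meson
    then show ?thesis
      by (intro exI[of _ "a *\<^sub>R g + b *\<^sub>R g'"] exI[of _ "a * c + b * c'"]) (auto simp: inner_add_left algebra_simps)
  qed
  then show ?thesis using assms unfolding fe_space_def by (auto intro!: continuous_intros)
qed

lemma fe_zero: "(\<lambda>x. 0) \<in> V"
  unfolding fe_space_def by (auto intro!: exI[of _ 0])

lemma fe_zero_if_nodal:
  assumes v: "v \<in> V" and zero: "\<And>P. P \<in> nodes \<Longrightarrow> v P = 0"
  shows "v = (\<lambda>x. 0)"
proof
  fix x
  have "(\<lambda>x. (-1) * v x + 0 * v x) \<in> V" by (intro fe_comb v)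
  then have "- v x \<ge> 0" using fe_nonneg[of "\<lambda>x. - v x" x] zero by simp
  moreover have "v x \<ge> 0" using fe_nonneg[OF v] zero by simp
  ultimately show "v x = 0" by simp
qed

lemma fe_eq_if_nodal:
  assumes "u \<in> V" "v \<in> V" "\<And>P. P \<in> nodes \<Longrightarrow> u P = v P"
  shows "u = v"
proof -
  have "(\<lambda>x. 1 * u x + (-1) * v x) = (\<lambda>x. 0)"
    by (rule fe_zero_if_nodal[OF fe_comb]) (use assms in auto)
  then show ?thesis by (auto simp: fun_eq_iff)
qed

text \<open>
  The affine interpolants on the simplices fit together because two simplices meet in a common face,
  whose vertices are shared. Likewise the boundary is covered by faces whose vertices lie on the
  boundary, where the prescribed values are zero.
\<close>
lemma fe_interpolation:
  fixes F :: "real^'d \<Rightarrow> real"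
  shows "\<exists>v\<in>V. \<forall>P\<in>nodes. v P = F P"
proof -
  define F0 where "F0 P = (if P \<in> \<Omega> then F P else 0)" for P
  have "\<forall>\<tau>\<in>T. \<exists>g b. \<forall>P\<in>vertices \<tau>. g \<bullet> P + b = F0 P"
    using affine_interpolation[OF simplex_vertices(1), where F = F0] by simp
  then obtain g where "\<forall>\<tau>\<in>T. \<exists>b. \<forall>P\<in>vertices \<tau>. g \<tau> \<bullet> P + b = F0 P" by (rule bchoice[THEN exE])
  then obtain b where "\<forall>\<tau>\<in>T. \<forall>P\<in>vertices \<tau>. g \<tau> \<bullet> P + b \<tau> = F0 P" by (rule bchoice[THEN exE])
  then have gb: "\<And>\<tau> P. \<tau> \<in> T \<Longrightarrow> P \<in> vertices \<tau> \<Longrightarrow> g \<tau> \<bullet> P + b \<tau> = F0 P" by simp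
  have face_hull: "\<exists>c. c \<subseteq> vertices \<tau> \<and> K = convex hull c" if "\<tau> \<in> T" "K face_of \<tau>" for \<tau> K
    using face_of_convex_hull_affine_independent[OF simplex_vertices(1)[OF that(1)], of K]
      simplex_vertices(3)[OF that(1)] that(2) by simp
  have agree: "g \<tau> \<bullet> x + b \<tau> = g \<tau>' \<bullet> x + b \<tau>'" if \<tau>: "\<tau> \<in> T" "\<tau>' \<in> T" "x \<in> \<tau>" "x \<in> \<tau>'" for \<tau> \<tau>' x
  proof -
    let ?K = "\<tau> \<inter> \<tau>'"
    obtain c where c: "c \<subseteq> vertices \<tau>" "?K = convex hull c"
      using face_hull[OF \<tau>(1) common_face(1)[OF \<tau>(1,2)]] by blast
    have ext: "P \<in> vertices \<tau>'" if P: "P \<in> c" for P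
    proof -
      have "P \<in> ?K" using c(2) hull_inc[OF P] by metis
      moreover have "P extreme_point_of \<tau>" using c(1) P by (auto simp: vertices_def)
      ultimately have "P extreme_point_of ?K"
        using extreme_point_of_face[OF common_face(1)[OF \<tau>(1,2)]] by blast
      then show ?thesis
        using extreme_point_of_face[OF common_face(2)[OF \<tau>(1,2)]] by (simp add: vertices_def)
    qed
    have "(g \<tau> - g \<tau>') \<bullet> x + (b \<tau> - b \<tau>') = 0"
    proof (rule affine_zero_on_hull[where C = c])
      show "x \<in> convex hull c" using c(2) \<tau> by blast
      fix P assume "P \<in> c"
      then show "(g \<tau> - g \<tau>') \<bullet> P + (b \<tau> - b \<tau>') = 0"
        using gb[OF \<tau>(1), of P] gb[OF \<tau>(2) ext] c(1) by (force simp: inner_diff_left)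
    qed
    then show ?thesis by (simp add: inner_diff_left)
  qed
  have boundary: "g \<tau> \<bullet> x + b \<tau> = 0" if \<tau>: "\<tau> \<in> T" "x \<in> \<tau>" "x \<notin> \<Omega>" for \<tau> x
  proof -
    have "x \<in> closure \<Omega>" using \<tau> cover by blast
    then have "x \<in> frontier \<Omega>" using closure_diff \<tau> by blast
    then obtain K \<tau>' where K: "x \<in> K" "K \<subseteq> frontier \<Omega>" "\<tau>' \<in> T" "K face_of \<tau>'"
      using frontier_faces by blast
    obtain c where c: "c \<subseteq> vertices \<tau>'" "K = convex hull c" using face_hull[OF K(3,4)] by blast
    have "g \<tau>' \<bullet> x + b \<tau>' = 0"
    proof (rule affine_zero_on_hull[where C = c])
      show "x \<in> convex hull c" using c K by simp
      fix P assume P: "P \<in> c"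
      then have "P \<notin> \<Omega>" using c(2) K(2) hull_inc[OF P] frontier_not_in by blast
      then show "g \<tau>' \<bullet> P + b \<tau>' = 0" using gb[OF K(3), of P] c P by (auto simp: F0_def)
    qed
    then show ?thesis using agree[OF \<tau>(1) K(3) \<tau>(2)] K face_of_imp_subset by fastforce
  qed
  define v where "v x = (if x \<in> \<Omega> then g (SOME \<tau>. \<tau> \<in> T \<and> x \<in> \<tau>) \<bullet> x + b (SOME \<tau>. \<tau> \<in> T \<and> x \<in> \<tau>) else 0)" for x
  have v: "v x = g \<tau> \<bullet> x + b \<tau>" if \<tau>: "\<tau> \<in> T" "x \<in> \<tau>" for \<tau> x
  proof (cases "x \<in> \<Omega>")
    case True
    have "(SOME \<tau>. \<tau> \<in> T \<and> x \<in> \<tau>) \<in> T \<and> x \<in> (SOME \<tau>. \<tau> \<in> T \<and> x \<in> \<tau>)"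
      using \<tau> by (intro someI[of "\<lambda>\<tau>. \<tau> \<in> T \<and> x \<in> \<tau>"]) auto
    then show ?thesis using True agree[OF _ \<tau>(1) _ \<tau>(2)] by (simp add: v_def)
  next
    case False
    then show ?thesis using boundary[OF \<tau>] by (simp add: v_def)
  qed
  have "continuous_on (\<Union>\<tau>\<in>T. \<tau>) v"
  proof (rule continuous_on_closed_Union[OF finite_T])
    show "closed \<tau>" if "\<tau> \<in> T" for \<tau> using compact_T[OF that] compact_imp_closed by blast
    fix \<tau> assume \<tau>: "\<tau> \<in> T"
    have "continuous_on \<tau> (\<lambda>x. g \<tau> \<bullet> x + b \<tau>)" by (intro continuous_intros)
    then show "continuous_on \<tau> v" using v[OF \<tau>] by (simp cong: continuous_on_cong)
  qed
  then have "v \<in> V" using v cover unfolding fe_space_def by (auto simp: v_def)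
  moreover have "v P = F P" if P: "P \<in> nodes" for P
  proof -
    obtain \<tau> where \<tau>: "\<tau> \<in> T" "P \<in> vertices \<tau>" and "P \<in> \<Omega>" using P by (auto simp: interior_nodes_def)
    then show ?thesis using v[OF \<tau>(1)] gb[OF \<tau>] vertices_subset[OF \<tau>(1)] by (auto simp: F0_def)
  qed
  ultimately show ?thesis by blast
qed

lemma the_fe_function:
  fixes F :: "real^'d \<Rightarrow> real"
  defines "v \<equiv> THE v. v \<in> V \<and> (\<forall>P\<in>nodes. v P = F P)"
  shows "v \<in> V" "P \<in> nodes \<Longrightarrow> v P = F P"
proof -
  obtain u where u: "u \<in> V" "\<forall>P\<in>nodes. u P = F P" using fe_interpolation by blast
  have "v = u" unfolding v_def
  proof (rule the_equality)
    fix w assume w: "w \<in> V \<and> (\<forall>P\<in>nodes. w P = F P)"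
    then show "w = u" using u by (intro fe_eq_if_nodal) auto
  qed (use u in simp)
  then show "v \<in> V" "P \<in> nodes \<Longrightarrow> v P = F P" using u by auto
qed

lemma nodal_interpolant: "nodal_interpolant \<Omega> T f \<in> V" "P \<in> nodes \<Longrightarrow> nodal_interpolant \<Omega> T f P = f P"
  using the_fe_function[where F = f] by (simp_all add: nodal_interpolant_def)

lemma nodal_basis: "nodal_basis \<Omega> T P \<in> V" "Q \<in> nodes \<Longrightarrow> nodal_basis \<Omega> T P Q = (if Q = P then 1 else 0)"
  using the_fe_function[where F = "\<lambda>Q. if Q = P then 1 else 0"] by (simp_all add: nodal_basis_def)

text \<open>
  The constant gradient on the interior of a simplex, read off at an arbitrary interior point.
\<close>
definition fe_gradient :: "(real^'d \<Rightarrow> real) \<Rightarrow> (real^'d) set \<Rightarrow> real^'d" where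
  "fe_gradient v \<tau> = gradient v (SOME x. x \<in> interior \<tau>)"

lemma fe_gradient_eqI:
  assumes "\<tau> \<in> T" "\<And>x. x \<in> \<tau> \<Longrightarrow> v x = g \<bullet> x + b"
  shows "fe_gradient v \<tau> = g"
proof -
  have "(SOME x. x \<in> interior \<tau>) \<in> interior \<tau>" using interior_ne[OF assms(1)] by (simp add: some_in_eq)
  then show ?thesis unfolding fe_gradient_def using gradient_affine assms(2) by blast
qed

lemma fe_gradient:
  assumes "v \<in> V" "\<tau> \<in> T"
  obtains b where "\<And>x. x \<in> \<tau> \<Longrightarrow> v x = fe_gradient v \<tau> \<bullet> x + b"
    "\<And>x. x \<in> interior \<tau> \<Longrightarrow> gradient v x = fe_gradient v \<tau>"
proof -
  obtain g b where gb: "\<And>x. x \<in> \<tau> \<Longrightarrow> v x = g \<bullet> x + b" using fe_affine[OF assms] by blast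
  then have "fe_gradient v \<tau> = g" by (rule fe_gradient_eqI[OF assms(2)])
  then show thesis using that[of b] gb gradient_affine[OF gb] by blast
qed

lemma fe_gradient_comb:
  assumes "u \<in> V" "v \<in> V" and \<tau>: "\<tau> \<in> T"
  shows "fe_gradient (\<lambda>x. a * u x + b * v x) \<tau> = a *\<^sub>R fe_gradient u \<tau> + b *\<^sub>R fe_gradient v \<tau>"
proof -
  obtain c c' where "\<And>x. x \<in> \<tau> \<Longrightarrow> u x = fe_gradient u \<tau> \<bullet> x + c" "\<And>x. x \<in> \<tau> \<Longrightarrow> v x = fe_gradient v \<tau> \<bullet> x + c'"
    using fe_gradient[OF assms(1) \<tau>] fe_gradient[OF assms(2) \<tau>] by metis
  then show ?thesis
    by (intro fe_gradient_eqI[OF \<tau>, of _ _ "a * c + b * c'"]) (simp add: inner_add_left algebra_simps)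
qed

text \<open>
  A function with vanishing gradients takes finitely many values, so it is constant on the connected
  closure of \<open>\<Omega>\<close>; its value on the boundary is zero.
\<close>
lemma fe_constant_zero:
  assumes v: "v \<in> V" and zero: "\<And>\<tau>. \<tau> \<in> T \<Longrightarrow> fe_gradient v \<tau> = 0"
  shows "v = (\<lambda>x. 0)"
proof -
  have "\<forall>\<tau>\<in>T. \<exists>b. \<forall>x\<in>\<tau>. v x = b"
    using fe_gradient[OF v] zero by (metis add_0 inner_zero_left)
  then obtain b where b: "\<And>\<tau> x. \<tau> \<in> T \<Longrightarrow> x \<in> \<tau> \<Longrightarrow> v x = b \<tau>" by metis
  have "v ` closure \<Omega> \<subseteq> b ` T" using b cover by blast
  then have "finite (v ` closure \<Omega>)" using finite_T finite_surj by blast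
  moreover have "continuous_on (closure \<Omega>) v" using v by (simp add: fe_space_def)
  moreover have "connected (closure \<Omega>)" using connected_\<Omega> by (rule connected_imp_connected_closure)
  ultimately have "v constant_on closure \<Omega>" by (intro continuous_finite_range_constant)
  then obtain c where c: "\<And>x. x \<in> closure \<Omega> \<Longrightarrow> v x = c" by (auto simp: constant_on_def)
  have "frontier \<Omega> \<noteq> {}"
    using \<Omega>_ne bounded_\<Omega> not_bounded_UNIV by (auto simp: frontier_eq_empty)
  then obtain y where "y \<in> frontier \<Omega>" by blast
  then have "c = 0" using c[of y] fe_outside[OF v, of y] frontier_not_in by (auto simp: frontier_def)
  then show ?thesis using c fe_outside[OF v] closure_subset by blast
qed

end

section \<open>The energy form and the lumped mass operator\<close>

lemma open_measure_pos:
  fixes U :: "'a::euclidean_space set"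
  assumes "open U" "bounded U" "U \<noteq> {}"
  shows "measure lebesgue U > 0"
proof -
  have "\<not> negligible U" using open_not_negligible assms by blast
  moreover have "U \<in> lmeasurable" using assms by (intro lmeasurable_open)
  ultimately have "measure lebesgue U \<noteq> 0" by (simp add: negligible_iff_measure)
  then show ?thesis by (simp add: zero_less_measure_iff)
qed

locale fe_problem = fe_mesh \<Omega> T for \<Omega> :: "(real^'d) set" and T +
  fixes a :: "real^'d \<Rightarrow> real" and a0 a1 :: real
  assumes a_measurable: "a \<in> borel_measurable (lebesgue_on \<Omega>)"
    and a0_pos: "0 < a0" and a_lower: "\<And>x. x \<in> \<Omega> \<Longrightarrow> a0 \<le> a x" and a_upper: "\<And>x. x \<in> \<Omega> \<Longrightarrow> a x \<le> a1"
begin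

text \<open>
  The coefficient enters the energy form only through its integrals over the simplices.
\<close>
definition weight :: "(real^'d) set \<Rightarrow> real" where
  "weight \<tau> = (LINT x|lebesgue. indicator (interior \<tau>) x * (if x \<in> \<Omega> then a x else 0))"

lemma \<Omega>_lmeasurable: "\<Omega> \<in> lmeasurable"
  using bounded_\<Omega> open_\<Omega> by (rule lmeasurable_open)

lemma a_ext_measurable: "(\<lambda>x. if x \<in> \<Omega> then a x else 0) \<in> borel_measurable lebesgue"
  using a_measurable \<Omega>_lmeasurable by (simp add: borel_measurable_if fmeasurableD)

lemma weight_integrable: "integrable lebesgue (\<lambda>x. indicator (interior \<tau>) x * (if x \<in> \<Omega> then a x else 0))"
proof (rule Bochner_Integration.integrable_bound)
  show "integrable lebesgue (\<lambda>x. a1 * indicator \<Omega> x)"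
    using \<Omega>_lmeasurable by (auto simp: fmeasurable_def)
  have "interior \<tau> \<in> sets lebesgue" by (simp add: borel_open)
  then show "(\<lambda>x. indicator (interior \<tau>) x * (if x \<in> \<Omega> then a x else 0)) \<in> borel_measurable lebesgue"
    by (intro borel_measurable_times a_ext_measurable borel_measurable_indicator)
  show "AE x in lebesgue. norm (indicator (interior \<tau>) x * (if x \<in> \<Omega> then a x else 0)) \<le> norm (a1 * indicator \<Omega> x)"
  proof (rule AE_I2)
    fix x
    have "0 \<le> a x \<and> a x \<le> a1" if "x \<in> \<Omega>" using a_lower[OF that] a_upper[OF that] a0_pos by simp
    then show "norm (indicator (interior \<tau>) x * (if x \<in> \<Omega> then a x else 0)) \<le> norm (a1 * indicator \<Omega> x)"
      by (auto simp: indicator_def)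
  qed
qed

lemma weight_pos:
  assumes \<tau>: "\<tau> \<in> T"
  shows "weight \<tau> > 0"
proof -
  let ?U = "interior \<tau> \<inter> \<Omega>"
  have "interior \<tau> \<subseteq> closure \<Omega>" using \<tau> cover interior_subset by blast
  then have "?U \<noteq> {}"
    using interior_ne[OF \<tau>] open_Int_closure_eq_empty[OF open_interior, of \<tau> \<Omega>] by auto
  moreover have "open ?U" "bounded ?U" using open_\<Omega> bounded_\<Omega> bounded_Int by auto
  ultimately have "measure lebesgue ?U > 0" and U: "?U \<in> lmeasurable"
    using open_measure_pos[of ?U] lmeasurable_open[of ?U] by simp_all
  then have "0 < a0 * measure lebesgue ?U" using a0_pos by simp
  also have "\<dots> = (LINT x|lebesgue. a0 * indicator ?U x)" using U by simp
  also have "\<dots> \<le> weight \<tau>" unfolding weight_def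
  proof (rule integral_mono[OF _ weight_integrable])
    show "integrable lebesgue (\<lambda>x. a0 * indicator ?U x)" using U by (auto simp: fmeasurable_def)
    show "a0 * indicator ?U x \<le> indicator (interior \<tau>) x * (if x \<in> \<Omega> then a x else 0)" for x
      using a_lower[of x] by (auto simp: indicator_def)
  qed
  finally show ?thesis .
qed

text \<open>
  The integrand is constant times \<open>a\<close> on the interiors of the simplices, which are disjoint and cover
  \<open>\<Omega>\<close> up to the null set of their frontiers. This also takes care of the measurability of the
  gradients.
\<close>
lemma energy_form_eq:
  assumes w: "w \<in> V" and \<theta>: "\<theta> \<in> V"
  shows "energy_form \<Omega> a w \<theta> = (\<Sum>\<tau>\<in>T. weight \<tau> * (fe_gradient w \<tau> \<bullet> fe_gradient \<theta> \<tau>))"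
proof -
  define N where "N = (\<Union>\<tau>\<in>T. frontier \<tau>)"
  have "negligible N" unfolding N_def
    using finite_T convex_T by (intro negligible_Union) (auto intro: negligible_convex_frontier)
  then have N: "N \<in> null_sets lebesgue" by (simp add: negligible_iff_null_sets)
  let ?s = "\<lambda>x. \<Sum>\<tau>\<in>T. (fe_gradient w \<tau> \<bullet> fe_gradient \<theta> \<tau>) * (indicator (interior \<tau>) x * (if x \<in> \<Omega> then a x else 0))"
  let ?e = "\<lambda>x. if x \<in> \<Omega> then a x * (gradient w x \<bullet> gradient \<theta> x) else 0"
  have int: "integrable lebesgue ?s"
    by (intro Bochner_Integration.integrable_sum integrable_mult_right weight_integrable)
  have eq: "?s x = ?e x" if "x \<notin> N" for x
  proof (cases "x \<in> \<Omega>")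
    case True
    then have "x \<in> closure \<Omega>" using closure_subset by blast
    then obtain \<tau> where \<tau>: "\<tau> \<in> T" "x \<in> \<tau>" using cover by blast
    have "closed \<tau>" using compact_T[OF \<tau>(1)] by (rule compact_imp_closed)
    then have xi: "x \<in> interior \<tau>" using that \<tau> by (auto simp: N_def frontier_def closure_closed)
    have "?s x = (\<Sum>\<sigma>\<in>T. if \<sigma> = \<tau> then (fe_gradient w \<tau> \<bullet> fe_gradient \<theta> \<tau>) * a x else 0)"
    proof (intro sum.cong refl)
      fix \<sigma> assume \<sigma>: "\<sigma> \<in> T"
      have "x \<notin> interior \<sigma>" if "\<sigma> \<noteq> \<tau>" using interior_disjoint[OF \<sigma> \<tau>(1) _ xi] that by blast
      then show "(fe_gradient w \<sigma> \<bullet> fe_gradient \<theta> \<sigma>) * (indicator (interior \<sigma>) x * (if x \<in> \<Omega> then a x else 0)) =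
         (if \<sigma> = \<tau> then (fe_gradient w \<tau> \<bullet> fe_gradient \<theta> \<tau>) * a x else 0)"
        using xi True by (auto simp: indicator_def)
    qed
    also have "\<dots> = (fe_gradient w \<tau> \<bullet> fe_gradient \<theta> \<tau>) * a x" using finite_T \<tau> by simp
    also have "fe_gradient w \<tau> = gradient w x" using fe_gradient[OF w \<tau>(1)] xi by metis
    also have "fe_gradient \<theta> \<tau> = gradient \<theta> x" using fe_gradient[OF \<theta> \<tau>(1)] xi by metis
    finally show ?thesis using True by (simp add: mult.commute)
  qed simp
  have ae: "AE x in lebesgue. ?s x = ?e x"
    using AE_not_in[OF N] by eventually_elim (rule eq)
  have meas: "?s \<in> borel_measurable lebesgue" using int by (rule borel_measurable_integrable)
  then have meas': "?e \<in> borel_measurable lebesgue" using ae by (rule borel_measurable_AE)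
  have "energy_form \<Omega> a w \<theta> = (LINT x|lebesgue. ?e x)"
    unfolding energy_form_def using \<Omega>_lmeasurable
    by (subst Lebesgue_Measure.integral_restrict_UNIV[symmetric]) auto
  also have "\<dots> = (LINT x|lebesgue. ?s x)"
    using integral_cong_AE[OF meas meas' ae] by simp
  also have "\<dots> = (\<Sum>\<tau>\<in>T. (fe_gradient w \<tau> \<bullet> fe_gradient \<theta> \<tau>) * weight \<tau>)"
    unfolding weight_def
    by (subst Bochner_Integration.integral_sum) (intro integrable_mult_right weight_integrable, simp)
  finally show ?thesis by (simp add: mult.commute)
qed

abbreviation "E \<equiv> energy_form \<Omega> a"
abbreviation "A \<equiv> lumped_operator \<Omega> T a"
abbreviation "\<phi> \<equiv> nodal_basis \<Omega> T"

lemma E_comb: "u \<in> V \<Longrightarrow> v \<in> V \<Longrightarrow> w \<in> V \<Longrightarrow> E (\<lambda>x. c * u x + d * v x) w = c * E u w + d * E v w"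
  by (simp add: energy_form_eq fe_comb fe_gradient_comb inner_add_left algebra_simps sum.distrib sum_distrib_left)

lemma E_sym: "u \<in> V \<Longrightarrow> v \<in> V \<Longrightarrow> E u v = E v u"
  by (simp add: energy_form_eq inner_commute)

lemma E_pos:
  assumes v: "v \<in> V" "v \<noteq> (\<lambda>x. 0)"
  shows "E v v > 0"
proof -
  obtain \<tau> where \<tau>: "\<tau> \<in> T" "fe_gradient v \<tau> \<noteq> 0" using fe_constant_zero[OF v(1)] v(2) by blast
  have "0 < (\<Sum>\<tau>\<in>T. weight \<tau> * (fe_gradient v \<tau> \<bullet> fe_gradient v \<tau>))"
  proof (rule sum_pos2[OF finite_T \<tau>(1)])
    show "0 < weight \<tau> * (fe_gradient v \<tau> \<bullet> fe_gradient v \<tau>)"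
      using weight_pos[OF \<tau>(1)] \<tau>(2) by simp
    show "0 \<le> weight \<sigma> * (fe_gradient v \<sigma> \<bullet> fe_gradient v \<sigma>)" if "\<sigma> \<in> T" for \<sigma>
      using weight_pos[OF that] by simp
  qed
  then show ?thesis using energy_form_eq[OF v(1) v(1)] by simp
qed

text \<open>
  The diagonal entries of the lumped mass matrix.
\<close>
definition mass :: "real^'d \<Rightarrow> real" where
  "mass P = 1 / (real CARD('d) + 1) * (\<Sum>\<tau>\<in>{\<tau>\<in>T. P \<in> vertices \<tau>}. measure lebesgue \<tau>)"

lemma mass_pos:
  assumes "P \<in> nodes"
  shows "mass P > 0"
proof -
  obtain \<tau> where \<tau>: "\<tau> \<in> T" "P \<in> vertices \<tau>" using assms by (auto simp: interior_nodes_def)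
  have "measure lebesgue \<sigma> > 0" if \<sigma>: "\<sigma> \<in> T" for \<sigma>
  proof -
    have "bounded \<sigma>" using compact_T[OF \<sigma>] by (rule compact_imp_bounded)
    then have "0 < measure lebesgue (interior \<sigma>)"
      using interior_ne[OF \<sigma>] bounded_interior by (intro open_measure_pos) auto
    also have "\<dots> \<le> measure lebesgue \<sigma>"
      using compact_T[OF \<sigma>] interior_subset by (intro measure_mono_fmeasurable) (auto simp: lmeasurable_compact borel_open)
    finally show ?thesis .
  qed
  then show ?thesis unfolding mass_def using finite_T \<tau> by (intro mult_pos_pos sum_pos) auto
qed

lemma lumped_inner_eq:
  assumes z: "z \<in> V" and v: "v \<in> V"
  shows "lumped_inner T z v = (\<Sum>P\<in>nodes. mass P * z P * v P)"
proof -
  have "(\<Sum>\<tau>\<in>T. \<Sum>P\<in>vertices \<tau>. measure lebesgue \<tau> * z P * v P) =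
        (\<Sum>\<tau>\<in>T. \<Sum>P\<in>nodes. if P \<in> vertices \<tau> then measure lebesgue \<tau> * z P * v P else 0)"
  proof (rule sum.cong[OF refl])
    fix \<tau> assume \<tau>: "\<tau> \<in> T"
    have "(\<Sum>P\<in>vertices \<tau>. measure lebesgue \<tau> * z P * v P) = (\<Sum>P\<in>nodes \<inter> vertices \<tau>. measure lebesgue \<tau> * z P * v P)"
      using finite_vertices[OF \<tau>] node_if_vertex[OF \<tau>] fe_outside[OF v]
      by (intro sum.mono_neutral_right) auto
    then show "(\<Sum>P\<in>vertices \<tau>. measure lebesgue \<tau> * z P * v P) =
        (\<Sum>P\<in>nodes. if P \<in> vertices \<tau> then measure lebesgue \<tau> * z P * v P else 0)"
      using finite_nodes by (simp add: sum.inter_restrict)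
  qed
  also have "\<dots> = (\<Sum>P\<in>nodes. \<Sum>\<tau>\<in>T. if P \<in> vertices \<tau> then measure lebesgue \<tau> * z P * v P else 0)"
    by (rule sum.swap)
  also have "\<dots> = (\<Sum>P\<in>nodes. (\<Sum>\<tau>\<in>{\<tau>\<in>T. P \<in> vertices \<tau>}. measure lebesgue \<tau>) * z P * v P)"
  proof (intro sum.cong refl)
    fix P
    have "(\<Sum>\<tau>\<in>T. if P \<in> vertices \<tau> then measure lebesgue \<tau> * z P * v P else 0) =
       (\<Sum>\<tau>\<in>{\<tau>\<in>T. P \<in> vertices \<tau>}. measure lebesgue \<tau> * z P * v P)"
      by (rule sum.inter_filter[OF finite_T, symmetric])
    then show "(\<Sum>\<tau>\<in>T. if P \<in> vertices \<tau> then measure lebesgue \<tau> * z P * v P else 0) =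
       (\<Sum>\<tau>\<in>{\<tau>\<in>T. P \<in> vertices \<tau>}. measure lebesgue \<tau>) * z P * v P"
      by (simp add: sum_distrib_right)
  qed
  finally have eq: "(\<Sum>\<tau>\<in>T. \<Sum>P\<in>vertices \<tau>. measure lebesgue \<tau> * z P * v P) = \<dots>" .
  show ?thesis
    unfolding lumped_inner_def mass_def eq by (subst sum_distrib_left) (simp only: mult.assoc)
qed

lemma fe_sum: "finite J \<Longrightarrow> (\<lambda>x. \<Sum>P\<in>J. c P * \<phi> P x) \<in> V"
proof (induction J rule: finite_induct)
  case (insert P J)
  then show ?case using fe_comb[OF nodal_basis(1)[of P] insert.IH, of "c P" 1] by simp
qed (simp add: fe_zero)

lemma E_sum: "finite J \<Longrightarrow> v \<in> V \<Longrightarrow> E (\<lambda>x. \<Sum>P\<in>J. c P * \<phi> P x) v = (\<Sum>P\<in>J. c P * E (\<phi> P) v)"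
proof (induction J rule: finite_induct)
  case empty
  then show ?case using E_comb[OF fe_zero fe_zero empty(1), of 0 0] by simp
next
  case (insert P J)
  then show ?case using E_comb[OF nodal_basis(1)[of P] fe_sum[OF insert(1), of c] insert.prems, of "c P" 1] by simp
qed

lemma nodal_expansion:
  assumes \<theta>: "\<theta> \<in> V"
  shows "\<theta> = (\<lambda>x. \<Sum>P\<in>nodes. \<theta> P * \<phi> P x)"
proof (rule fe_eq_if_nodal[OF \<theta> fe_sum[OF finite_nodes]])
  fix Q assume Q: "Q \<in> nodes"
  have "(\<Sum>P\<in>nodes. \<theta> P * \<phi> P Q) = (\<Sum>P\<in>nodes. if P = Q then \<theta> Q else 0)"
    by (intro sum.cong) (auto simp: nodal_basis(2)[OF Q])
  then show "\<theta> Q = (\<Sum>P\<in>nodes. \<theta> P * \<phi> P Q)" using finite_nodes Q by simp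
qed

lemma lumped_operator_eqI:
  assumes w: "w \<in> V" and eq: "\<And>\<theta>. \<theta> \<in> V \<Longrightarrow> lumped_inner T w \<theta> = E v \<theta>"
  shows "A v = w"
  unfolding lumped_operator_def
proof (rule the_equality)
  show "w \<in> V \<and> (\<forall>\<theta>\<in>V. lumped_inner T w \<theta> = E v \<theta>)" using assms by blast
  fix w' assume w': "w' \<in> V \<and> (\<forall>\<theta>\<in>V. lumped_inner T w' \<theta> = E v \<theta>)"
  have nodal: "lumped_inner T u (\<phi> P) = mass P * u P" if "u \<in> V" "P \<in> nodes" for u P
  proof -
    have "lumped_inner T u (\<phi> P) = (\<Sum>Q\<in>nodes. if Q = P then mass P * u P else 0)"
      unfolding lumped_inner_eq[OF that(1) nodal_basis(1)]
      by (intro sum.cong) (auto simp: nodal_basis(2))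
    then show ?thesis using finite_nodes that by simp
  qed
  show "w' = w"
  proof (rule fe_eq_if_nodal)
    fix P assume P: "P \<in> nodes"
    have "mass P * w' P = mass P * w P"
      using w' eq[OF nodal_basis(1)] nodal_basis(1) nodal[OF _ P] w by metis
    then show "w' P = w P" using mass_pos[OF P] by simp
  qed (use w w' in auto)
qed

text \<open>
  Testing with the nodal basis shows that the nodal values of \<open>A v\<close> must be
  \<open>E (\<phi> P) v / mass P\<close>.
\<close>
lemma lumped_operator:
  assumes v: "v \<in> V"
  shows "A v \<in> V" "\<theta> \<in> V \<Longrightarrow> lumped_inner T (A v) \<theta> = E v \<theta>"
proof -
  obtain w where w: "w \<in> V" "\<forall>P\<in>nodes. w P = E (\<phi> P) v / mass P"
    using fe_interpolation[of "\<lambda>P. E (\<phi> P) v / mass P"] by blast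
  have eq: "lumped_inner T w \<theta> = E v \<theta>" if \<theta>: "\<theta> \<in> V" for \<theta>
  proof -
    have "lumped_inner T w \<theta> = (\<Sum>P\<in>nodes. \<theta> P * E (\<phi> P) v)"
      unfolding lumped_inner_eq[OF w(1) \<theta>] using w(2) mass_pos by (intro sum.cong) force+
    also have "\<dots> = E \<theta> v"
      using E_sum[OF finite_nodes v, of \<theta>] nodal_expansion[OF \<theta>] by simp
    finally show ?thesis using E_sym[OF v \<theta>] by simp
  qed
  have "A v = w" by (rule lumped_operator_eqI[OF w(1) eq])
  then show "A v \<in> V" "\<theta> \<in> V \<Longrightarrow> lumped_inner T (A v) \<theta> = E v \<theta>" using w eq by auto
qed

lemma lumped_inner_comb:
  "u \<in> V \<Longrightarrow> v \<in> V \<Longrightarrow> w \<in> V \<Longrightarrow>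
    lumped_inner T (\<lambda>x. c * u x + d * v x) w = c * lumped_inner T u w + d * lumped_inner T v w"
  by (simp add: lumped_inner_eq fe_comb algebra_simps sum.distrib sum_distrib_left)

lemma lumped_inner_sym: "u \<in> V \<Longrightarrow> v \<in> V \<Longrightarrow> lumped_inner T u v = lumped_inner T v u"
  by (simp add: lumped_inner_eq mult_ac)

lemma lumped_inner_pos:
  assumes v: "v \<in> V" "v \<noteq> (\<lambda>x. 0)"
  shows "lumped_inner T v v > 0"
proof -
  obtain P where P: "P \<in> nodes" "v P \<noteq> 0" using fe_zero_if_nodal[OF v(1)] v(2) by blast
  have "0 < (\<Sum>P\<in>nodes. mass P * v P * v P)"
  proof (rule sum_pos2[OF finite_nodes P(1)])
    show "0 < mass P * v P * v P" using mass_pos[OF P(1)] P(2) by (simp add: zero_less_mult_iff mult.assoc) (auto simp: neq_iff)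
    show "0 \<le> mass Q * v Q * v Q" if "Q \<in> nodes" for Q
      using mass_pos[OF that] by (simp add: mult.assoc)
  qed
  then show ?thesis using lumped_inner_eq[OF v(1) v(1)] by simp
qed

lemma lumped_operator_space:
  assumes M: "M_matrix nodes (stiffness_matrix \<Omega> T a)"
  shows "lumped_operator_space V nodes (lumped_inner T) A mass \<phi>"
proof
  show "finite nodes" by (rule finite_nodes)
  show "v = (\<lambda>x. 0)" if "v \<in> V" "\<And>p. p \<in> nodes \<Longrightarrow> v p = 0" for v by (rule fe_zero_if_nodal[OF that])
  show "(\<lambda>x. 0) \<in> V" by (rule fe_zero)
  show "(\<lambda>x. c * u x + d * v x) \<in> V" if "u \<in> V" "v \<in> V" for u v c d by (rule fe_comb[OF that])
  show "lumped_inner T (\<lambda>x. c * u x + d * v x) w = c * lumped_inner T u w + d * lumped_inner T v w"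
    if "u \<in> V" "v \<in> V" "w \<in> V" for u v w c d by (rule lumped_inner_comb[OF that])
  show "lumped_inner T u v = lumped_inner T v u" if "u \<in> V" "v \<in> V" for u v by (rule lumped_inner_sym[OF that])
  show "0 < lumped_inner T v v" if "v \<in> V" "v \<noteq> (\<lambda>x. 0)" for v by (rule lumped_inner_pos[OF that])
  show "A v \<in> V" if "v \<in> V" for v by (rule lumped_operator(1)[OF that])
  show "A (\<lambda>x. c * u x + d * v x) = (\<lambda>x. c * A u x + d * A v x)" if uv: "u \<in> V" "v \<in> V" for u v c d
  proof (rule lumped_operator_eqI[OF fe_comb])
    fix \<theta> assume "\<theta> \<in> V"
    then show "lumped_inner T (\<lambda>x. c * A u x + d * A v x) \<theta> = E (\<lambda>x. c * u x + d * v x) \<theta>"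
      using uv by (simp add: lumped_inner_comb lumped_operator E_comb)
  qed (use uv lumped_operator in auto)
  show "lumped_inner T (A u) v = lumped_inner T u (A v)" if uv: "u \<in> V" "v \<in> V" for u v
    using uv lumped_operator(2)[OF uv] lumped_operator(2)[OF uv(2,1)] E_sym[OF uv]
      lumped_inner_sym[OF uv(1) lumped_operator(1)[OF uv(2)]] by simp
  show "lumped_inner T u v = (\<Sum>p\<in>nodes. mass p * u p * v p)" if "u \<in> V" "v \<in> V" for u v
    by (rule lumped_inner_eq[OF that])
  show "0 < mass p" if "p \<in> nodes" for p by (rule mass_pos[OF that])
  show "\<phi> p \<in> V" for p by (rule nodal_basis(1))
  show "\<phi> p q = (if q = p then 1 else 0)" if "q \<in> nodes" for p q by (rule nodal_basis(2)[OF that])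
  show "0 \<le> v x" if "v \<in> V" "\<And>p. p \<in> nodes \<Longrightarrow> 0 \<le> v p" for v x by (rule fe_nonneg[OF that])
  show "0 < lumped_inner T (A v) v" if "v \<in> V" "v \<noteq> (\<lambda>x. 0)" for v
    using lumped_operator(2)[OF that(1) that(1)] E_pos[OF that] by simp
  show "lumped_inner T (A (\<phi> p)) (\<phi> q) \<le> 0" if "p \<in> nodes" "q \<in> nodes" "p \<noteq> q" for p q
    using M that lumped_operator(2)[OF nodal_basis(1) nodal_basis(1), of p q]
    by (simp add: M_matrix_def stiffness_matrix_def)
qed

end

section \<open>Non-negativity of the lumped mass approximations\<close>

theorem mainTheorem5:
  fixes \<Omega> :: "(real^'d) set"
    and a f :: "real^'d \<Rightarrow> real"
    and a0 \<alpha> h :: real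
    and H :: "real set"
    and \<T> :: "real \<Rightarrow> (real^'d) set set"
    and k :: nat
    and r :: "real \<Rightarrow> real"
  assumes "bounded_domain \<Omega>"
    and "a \<in> borel_measurable (lebesgue_on \<Omega>)"
    and "\<exists>a1. \<forall>x\<in>\<Omega>. a x \<le> a1"
    and "0 < a0" and "\<forall>x\<in>\<Omega>. a0 \<le> a x"
    and "H \<subseteq> {0<..}"
    and "\<forall>h\<in>H. simplicial_mesh \<Omega> (\<T> h)"
    and "quasi_uniform H \<T>"
    and "h \<in> H"
    and "0 < \<alpha>" and "\<alpha> < 1"
    and "1 \<le> k"
    and "best_rational_approx \<alpha> k r"
    and "M_matrix (interior_nodes \<Omega> (\<T> h)) (stiffness_matrix \<Omega> (\<T> h) a)"
    and "continuous_on \<Omega> f"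
    and "\<forall>x\<in>\<Omega>. 0 \<le> f x"
  shows "(\<forall>x\<in>\<Omega>. 0 \<le> semidiscrete_approx \<Omega> (\<T> h) a \<alpha> f x) \<and>
         (\<forall>x\<in>\<Omega>. 0 \<le> fully_discrete_approx \<Omega> (\<T> h) a \<alpha> r f x)"
proof -
  obtain a1 where a1: "\<forall>x\<in>\<Omega>. a x \<le> a1" using assms(3) by blast
  have mesh: "simplicial_mesh \<Omega> (\<T> h)" using assms(7,9) by blast
  interpret fe_problem \<Omega> "\<T> h" a a0 a1
    by unfold_locales (use assms(1,2,4,5) mesh a1 in simp_all)
  interpret op: lumped_operator_space V nodes "lumped_inner (\<T> h)" A mass \<phi>
    by (rule lumped_operator_space[OF assms(14)])
  let ?v = "nodal_interpolant \<Omega> (\<T> h) f"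
  have v: "?v \<in> V" by (rule nodal_interpolant(1))
  have nonneg: "?v P \<ge> 0" if "P \<in> nodes" for P
    using nodal_interpolant(2)[OF that] assms(16) that by (auto simp: interior_nodes_def)
  have semi: "0 \<le> semidiscrete_approx \<Omega> (\<T> h) a \<alpha> f x" for x
    unfolding semidiscrete_approx_def
    by (rule op.operator_function_powr_nonneg[OF v nonneg assms(10,11)])
  obtain Z \<beta> c where Z: "\<And>z. z \<in> Z \<Longrightarrow> z < 0" and c: "c \<ge> 0" and \<beta>: "\<And>z. z \<in> Z \<Longrightarrow> \<beta> z \<ge> 0"
    and r: "\<And>t. t \<ge> 0 \<Longrightarrow> r t = c + (\<Sum>z\<in>Z. \<beta> z * (t / (t - z)))"
    using best_rational_approx_partial_fractions[OF assms(10,11,13)] by metis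
  define l1 where "l1 = smallest_eigenvalue \<Omega> (\<T> h) a"
  have op: "0 \<le> operator_function V (lumped_inner (\<T> h)) A (\<lambda>l. r (l1 * inverse l)) ?v x" for x
  \<comment> \<open>Without interior nodes the space is trivial, \<open>l1\<close> is unspecified, and the sum over the
    eigenvalues is empty.\<close>
  proof (cases "eigenvalues V A = {}")
    case True
    then show ?thesis by (simp add: operator_function_def)
  next
    case False
    have "l1 \<in> eigenvalues V A"
      unfolding l1_def smallest_eigenvalue_def using op.finite_eigenvalues False by (rule Min_in)
    then have "l1 > 0" by (rule op.eigenvalue_pos)
    show ?thesis
      by (rule op.operator_function_partial_fractions_nonneg[OF v nonneg \<open>l1 > 0\<close> Z c \<beta> r]) simp_all
  qed
  have full: "0 \<le> fully_discrete_approx \<Omega> (\<T> h) a \<alpha> r f x" for x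
    unfolding fully_discrete_approx_def Let_def l1_def[symmetric] using op[of x] by simp
  show ?thesis using semi full by blast
qed

end
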